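(* Assume $\diamondsuit(S)$ for some stationary co-stationary $S\subseteq\omega_1$. Let $\omega\le\alpha<\omega_1$, let a partial realisation of Talagrand's construction up to stage $\alpha$ be given, and let $F,G\subseteq K_\alpha$ be disjoint infinite closed sets and $h:F\to G$ a homeomorphism (the data given by a diamond guess at stage $\alpha$). Then the successor split $$K_{\alpha+1}=(Y_\alpha\times\{0\})\cup(Z_\alpha\times\{1\})$$ (together with the remaining stage-$\alpha$ data $\eta(\alpha)$, $U_n(\alpha,\cdot)$, $\nu_n(\alpha,\cdot)$ and the sets $I(\cdot,\alpha+1)$, $J(\cdot,\cdot,\alpha+1)$, and $N_e(\theta,\delta)$ for the new pairs with $\max\{\theta,\delta\}=\alpha$) can be chosen so that a partial realisation up to stage $\alpha+1$ is obtained, i.e. conditions (A)–(G) remain valid, but such that no final homeomorphism extends $h$: whenever this partial realisation is continued to a full realisation with final compactum $T$, there are no closed subspaces $\widehat F,\widehat G\subseteq T$ with $\pi_\alpha[\widehat F]=F$ and $\pi_\alpha[\widehat G]=G$ and no homeomorphism $H:\widehat F\to\widehat G$ satisfying $$\pi_\alpha H=h\pi_\alpha\quad\text{on }\widehat F,$$ where $\pi_\alpha=\pi_{\alpha,\omega_1}|_T:T\to K_\alpha$.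
   Context: For a stationary set $S\subseteq\omega_1$, $\diamondsuit(S)$ says: there are sets $D_\alpha\subseteq\alpha$ ($\alpha\in S$) such that for every $A\subseteq\omega_1$ the set $\{\alpha\in S: D_\alpha=A\cap\alpha\}$ is stationary. Co-stationary means that $\omega_1\setminus S$ is stationary. (In the construction a diamond guess $D_\alpha$ is decoded as a triple $(F,G,h)$ as in the claim.) Notation. $2^\alpha=\{0,1\}^\alpha$ has the product topology; for $\beta\le\alpha$, $\pi_{\beta,\alpha}$ is restriction of coordinates from $\alpha$ to $\beta$. For compact $K$, $M(K)=C(K)^*$ is the space of signed Radon measures with total variation norm; $\lambda^+$ is the positive part of $\lambda$; $f_*\lambda$ is the push-forward. A (full) realisation of Talagrand's construction consists of the following data. (1) Compact spaces $K_\alpha\subseteq 2^\alpha$ ($\omega\le\alpha\le\omega_1$) with $K_\omega=2^\omega$; $K_{\alpha+1}=(Y_\alpha\times\{0\})\cup(Z_\alpha\times\{1\})$ with $Y_\alpha,Z_\alpha\subseteq K_\alpha$ closed and $Y_\alpha\cup Z_\alpha=K_\alpha$; and, for limit $\rho>\omega$, $K_\rho=\{t\in 2^\rho: t|_\beta\in K_\beta\text{ for all }\omega\le\beta<\rho\}$ (the inverse limit). The final compactum is $T=K_{\omega_1}$. (2) A scheduling map $\eta:[\omega,\omega_1)\to[\omega,\omega_1)\times\omega_1$ such that $\eta(\alpha)=(\theta,\delta)$ implies $\theta\le\alpha$ and $\delta\le\alpha$, and each pair $(\theta,\delta)\in[\omega,\omega_1)\times\omega_1$ equals $\eta(\alpha)$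 for cofinally many $\alpha<\omega_1$ with $\alpha\ge\max\{\theta,\delta\}$. (3) For each $\beta\in[\omega,\omega_1)$, an enumeration $\big((U_n(\beta,\gamma))_{n\in\omega}\big)_{\gamma<\omega_1}$ of all sequences of pairwise disjoint non-empty clopen subsets of $K_\beta$. For $\theta\le\alpha$ and $\eta(\theta)=(\beta,\gamma)$ put $V_n(\theta,\alpha)=\pi_{\beta,\alpha}^{-1}(U_n(\beta,\gamma))\cap K_\alpha$. (4) For each $\theta\in[\omega,\omega_1)$, an enumeration $\big((\nu_n(\theta,\delta))_{n\in\omega}\big)_{\delta<\omega_1}$ of all admissible sequences in $M(K_\theta)$, i.e. those with $\|\nu_n\|=|\nu_n|(V_n(\theta,\theta))=1$ and $\|\nu_n^+\|\ge\frac12$ for all $n$. For $\theta\le\alpha$ put $B_n(\theta,\delta,\alpha)=\{\lambda\in M(K_\alpha):\|\lambda\|=1,\ (\pi_{\theta,\alpha})_*\lambda=\nu_n(\theta,\delta)\}$. (5) Sets $I(\theta,\alpha)$, $J(\theta,\delta,\alpha)$ (for $\omega\le\theta<\alpha<\omega_1$, $\delta<\alpha$) and $N_0(\theta,\delta),N_1(\theta,\delta)$, all subsets of $\omega$, such that: (A) $J(\theta,\delta,\alpha)\subseteq I(\theta,\alpha)$. (B) $N_0(\theta,\delta)\cap N_1(\theta,\delta)=\varnothing$. (C) $J(\theta,\delta,\alpha)\cap N_e(\theta,\delta)$ is infinite for $e=0,1$. (D) If $\alpha'\le\alpha$ and $\delta<\alpha'$, then $J(\theta,\delta,\alpha)\setminus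 J(\theta,\delta,\alpha')$ and $I(\theta,\alpha)\setminus I(\theta,\alpha')$ are finite whenever both sides are defined. (E) If $\omega\le\theta\le\alpha'<\alpha$, then for all sufficiently large $n\in I(\theta,\alpha)$: if $t,t'\in V_n(\theta,\alpha)$ and $\pi_{\theta,\alpha}(t)=\pi_{\theta,\alpha}(t')$, then $t(\alpha')=t'(\alpha')$. (F) For every choice $\lambda_n\in B_n(\theta,\delta,\alpha)$, the weak-star limit of $\lambda_n$ as $n\to\infty$ along $J(\theta,\delta,\alpha)$ exists. (G) If $\alpha=\alpha'+1$ and $\eta(\alpha')=(\theta,\delta)$, then for every choice $\lambda_n\in B_n(\theta,\delta,\alpha)$ both sets $\{n:\lambda_n(Z_{\alpha'}\times\{1\})\ge 1/6\}$ and $\{n:\lambda_n(Z_{\alpha'}\times\{1\})=0\}$ are infinite. A partial realisation up to stage $\alpha$ ($\omega\le\alpha<\omega_1$) consists of: spaces $K_\beta$ for $\omega\le\beta\le\alpha$ as in (1); values $\eta(\beta)$ for $\omega\le\beta<\alpha$, where $\eta(\beta)=(\theta,\delta)$ satisfies $\theta,\delta\le\beta$ (no cofinality requirement); enumerations $U_n(\beta,\cdot)$, $\nu_n(\beta,\cdot)$ as in (3), (4) for $\omega\le\beta<\alpha$; sets $I(\theta,\beta),J(\theta,\delta,\beta)$ for $\omega\le\theta<\beta\le\alpha$, $\delta<\beta$, and $N_0(\theta,\delta),N_1(\theta,\delta)$ for $\omega\le\theta<\alpha$, $\delta<\alpha$, satisfying (A)–(G) at all ranks $\le\alpha$. A full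 realisation continues a partial one if it agrees with it on all these data. *)

theory Defs
  imports "HOL-Analysis.Analysis" "HOL-Library.Countable_Set_Type"
begin

section \<open>The ordinal $\omega_1$\<close>

text \<open>The elements of this type are the countable ordinals; the ordinal $\alpha$, as a set,
  is the initial segment \<open>{..<\<alpha>}\<close>, and $\omega_1$, as a set, is \<open>UNIV\<close>.\<close>

typedef omega1 = "Field (cardSuc natLeq)"
proof -
  have "infinite (Field (cardSuc natLeq))"
    using cardSuc_finite[OF natLeq_Card_order] by (simp add: Field_natLeq)
  then show ?thesis
    by (metis finite.emptyI ex_in_conv)
qed

lemma Card_order_omega1: "Card_order (cardSuc natLeq)"
  by (rule cardSuc_Card_order[OF natLeq_Card_order])

lemma Well_order_omega1: "Well_order (cardSuc natLeq)"
  using Card_order_omega1 by (simp add: card_order_on_def)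

instantiation omega1 :: wellorder
begin

definition less_eq_omega1 :: "omega1 \<Rightarrow> omega1 \<Rightarrow> bool" where
  "less_eq_omega1 x y \<longleftrightarrow> (Rep_omega1 x, Rep_omega1 y) \<in> cardSuc natLeq"

definition less_omega1 :: "omega1 \<Rightarrow> omega1 \<Rightarrow> bool" where
  "less_omega1 x y \<longleftrightarrow> x \<le> y \<and> \<not> y \<le> (x :: omega1)"

instance
proof
  have refl: "refl_on (Field (cardSuc natLeq)) (cardSuc natLeq)"
    and trans: "trans (cardSuc natLeq)" and antisym: "antisym (cardSuc natLeq)"
    and total: "total_on (Field (cardSuc natLeq)) (cardSuc natLeq)"
    and wf: "wf (cardSuc natLeq - Id)"
    using Well_order_omega1
    by (auto simp: well_order_on_def linear_order_on_def partial_order_on_def preorder_on_def)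
  fix x y z :: omega1
  show "x < y \<longleftrightarrow> x \<le> y \<and> \<not> y \<le> x"
    by (rule less_omega1_def)
  show "x \<le> x"
    unfolding less_eq_omega1_def using refl Rep_omega1 by (auto simp: refl_on_def)
  show "x \<le> z" if "x \<le> y" "y \<le> z"
    using that trans unfolding less_eq_omega1_def by (blast dest: transD)
  show "x = y" if "x \<le> y" "y \<le> x"
    using that antisym unfolding less_eq_omega1_def
    by (metis Rep_omega1_inject antisymD)
  show tot: "x \<le> y \<or> y \<le> x"
    using total refl Rep_omega1 unfolding less_eq_omega1_def
    by (metis refl_onD total_on_def)
  fix P :: "omega1 \<Rightarrow> bool" and a :: omega1
  assume step: "\<And>x. (\<And>y. y < x \<Longrightarrow> P y) \<Longrightarrow> P x"
  have "wf (inv_image (cardSuc natLeq - Id) Rep_omega1)"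
    using wf by (rule wf_inv_image)
  then show "P a"
  proof (induction a rule: wf_induct_rule)
    case (less x)
    show ?case
    proof (rule step)
      fix y assume "y < x"
      then have "(y, x) \<in> inv_image (cardSuc natLeq - Id) Rep_omega1"
        unfolding less_omega1_def less_eq_omega1_def by (auto simp: in_inv_image)
      then show "P y" by (rule less.IH)
    qed
  qed
qed

end

context
  includes cardinal_syntax
begin

lemma countable_lessThan_omega1: "countable {..<\<alpha> :: omega1}"
proof -
  let ?r = "cardSuc natLeq"
  have "|underS ?r (Rep_omega1 \<alpha>)| <o ?r"
    using Card_order_omega1 Rep_omega1 by (rule card_of_underS)
  then have "|underS ?r (Rep_omega1 \<alpha>)| \<le>o natLeq"
    using cardSuc_ordLeq_ordLess[OF natLeq_Card_order card_of_Card_order] by blast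
  then have c: "countable (underS ?r (Rep_omega1 \<alpha>))"
    by (simp add: countable_card_le_natLeq)
  have "Rep_omega1 ` {..<\<alpha>} \<subseteq> underS ?r (Rep_omega1 \<alpha>)"
    by (auto simp: underS_def less_le Rep_omega1_inject)
      (simp add: less_eq_omega1_def)
  then have "countable (Rep_omega1 ` {..<\<alpha>})"
    using c countable_subset by blast
  then show ?thesis
    by (rule countable_image_inj_on) (simp add: inj_on_def Rep_omega1_inject)
qed

lemma uncountable_omega1: "uncountable (UNIV :: omega1 set)"
proof
  let ?r = "cardSuc natLeq"
  assume "countable (UNIV :: omega1 set)"
  then have "countable (Rep_omega1 ` UNIV)" by (rule countable_image)
  then have "countable (Field ?r)"
    using type_definition.Rep_range[OF type_definition_omega1] by simp
  then have "|Field ?r| \<le>o natLeq" by (simp add: countable_card_le_natLeq)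
  moreover have "?r =o |Field ?r|"
    using Card_order_omega1 card_of_Field_ordIso ordIso_symmetric by blast
  ultimately have "?r \<le>o natLeq" by (rule ordIso_ordLeq_trans[rotated])
  then show False
    using cardSuc_greater[OF natLeq_Card_order] not_ordLess_ordLeq by blast
qed

end

definition osucc :: "omega1 \<Rightarrow> omega1" where
  "osucc \<alpha> = (LEAST \<beta>. \<alpha> < \<beta>)"

definition limit_ordinal :: "omega1 \<Rightarrow> bool" where
  "limit_ordinal \<rho> \<longleftrightarrow> (\<exists>\<beta>. \<beta> < \<rho>) \<and> (\<forall>\<beta>. \<rho> \<noteq> osucc \<beta>)"

definition omega :: omega1 where
  "omega = (LEAST \<rho>. limit_ordinal \<rho>)"

lemma less_osucc: "\<alpha> < osucc \<alpha>"
proof -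
  have "countable {..\<alpha>}"
    using countable_lessThan_omega1[of \<alpha>] by (simp add: ivl_disj_un_singleton(2)[symmetric])
  then have "{..\<alpha>} \<noteq> UNIV" using uncountable_omega1 by metis
  then obtain \<beta> where "\<alpha> < \<beta>" by (metis UNIV_eq_I atMost_iff not_le)
  then show ?thesis unfolding osucc_def by (rule LeastI)
qed

lemma limit_ordinal_omega: "limit_ordinal omega"
proof -
  have "\<exists>\<rho>. limit_ordinal \<rho>"
  proof (rule ccontr)
    assume no: "\<nexists>\<rho>. limit_ordinal \<rho>"
    define z :: omega1 where "z = (LEAST \<beta>. True)"
    have z: "z \<le> \<beta>" for \<beta> unfolding z_def by (simp add: Least_le)
    have "\<beta> \<in> range (\<lambda>n. (osucc ^^ n) z)" for \<beta>
    proof (induction \<beta> rule: less_induct)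
      case (less \<beta>)
      show ?case
      proof (cases "\<exists>\<gamma>. \<gamma> < \<beta>")
        case True
        then obtain \<gamma> where \<gamma>: "\<beta> = osucc \<gamma>" using no unfolding limit_ordinal_def by blast
        then obtain n where "\<gamma> = (osucc ^^ n) z" using less less_osucc by blast
        then have "\<beta> = (osucc ^^ Suc n) z" using \<gamma> by simp
        then show ?thesis by blast
      next
        case False
        then have "\<beta> = (osucc ^^ 0) z" using z[of \<beta>] by (auto simp: le_less)
        then show ?thesis by blast
      qed
    qed
    then have "(UNIV :: omega1 set) \<subseteq> range (\<lambda>n. (osucc ^^ n) z)" by blast
    then show False
      using uncountable_omega1 countable_subset by blast
  qed
  then show ?thesis unfolding omega_def by (rule LeastI_ex)
qed

definition club :: "omega1 set \<Rightarrow> bool" where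
  "club C \<longleftrightarrow> (\<forall>\<xi>. \<exists>\<gamma>\<in>C. \<xi> < \<gamma>) \<and>
     (\<forall>\<rho>. limit_ordinal \<rho> \<and> (\<forall>\<xi><\<rho>. \<exists>\<gamma>\<in>C. \<xi> < \<gamma> \<and> \<gamma> < \<rho>) \<longrightarrow> \<rho> \<in> C)"

definition stationary :: "omega1 set \<Rightarrow> bool" where
  "stationary S \<longleftrightarrow> (\<forall>C. club C \<longrightarrow> S \<inter> C \<noteq> {})"

definition diamond :: "omega1 set \<Rightarrow> bool" where
  "diamond S \<longleftrightarrow> (\<exists>D :: omega1 \<Rightarrow> omega1 set. (\<forall>\<alpha>\<in>S. D \<alpha> \<subseteq> {..<\<alpha>}) \<and>
     (\<forall>A. stationary {\<alpha>\<in>S. D \<alpha> = A \<inter> {..<\<alpha>}}))"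


section \<open>Signed Radon measures\<close>

text \<open>A signed measure on a topological space is a real-valued set function; it is normalised to
  be 0 on sets that are not Borel, so that equality of measures is equality of functions.\<close>

definition borel_sets :: "'a topology \<Rightarrow> 'a set set" where
  "borel_sets X = sigma_sets (topspace X) {U. openin X U}"

definition variation :: "'a topology \<Rightarrow> ('a set \<Rightarrow> real) \<Rightarrow> 'a set \<Rightarrow> real" where
  "variation X \<mu> A = (if A \<in> borel_sets X
     then SUP P \<in> {P. finite P \<and> P \<subseteq> borel_sets X \<and> disjoint P \<and> \<Union>P = A}. \<Sum>E\<in>P. \<bar>\<mu> E\<bar>
     else 0)"

definition tv_norm :: "'a topology \<Rightarrow> ('a set \<Rightarrow> real) \<Rightarrow> real" where
  "tv_norm X \<mu> = variation X \<mu> (topspace X)"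

definition radon_measures :: "'a topology \<Rightarrow> ('a set \<Rightarrow> real) set" where
  "radon_measures X = {\<mu>.
     (\<forall>A. A \<notin> borel_sets X \<longrightarrow> \<mu> A = 0) \<and>
     (\<forall>A :: nat \<Rightarrow> 'a set. range A \<subseteq> borel_sets X \<and> disjoint_family A \<longrightarrow>
        (\<lambda>n. \<mu> (A n)) sums \<mu> (\<Union>n. A n)) \<and>
     (\<forall>A\<in>borel_sets X. \<forall>\<epsilon>>0. \<exists>C\<in>borel_sets X.
        compactin X C \<and> C \<subseteq> A \<and> variation X \<mu> (A - C) < \<epsilon>)}"

definition pos_part :: "'a topology \<Rightarrow> ('a set \<Rightarrow> real) \<Rightarrow> 'a set \<Rightarrow> real" where
  "pos_part X \<mu> A = (if A \<in> borel_sets X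
     then SUP B \<in> {B. B \<in> borel_sets X \<and> B \<subseteq> A}. \<mu> B else 0)"

definition neg_part :: "'a topology \<Rightarrow> ('a set \<Rightarrow> real) \<Rightarrow> 'a set \<Rightarrow> real" where
  "neg_part X \<mu> = pos_part X (\<lambda>A. - \<mu> A)"

definition signed_integral :: "'a topology \<Rightarrow> ('a set \<Rightarrow> real) \<Rightarrow> ('a \<Rightarrow> real) \<Rightarrow> real" where
  "signed_integral X \<mu> f =
     integral\<^sup>L (measure_of (topspace X) (borel_sets X) (\<lambda>A. ennreal (pos_part X \<mu> A))) f -
     integral\<^sup>L (measure_of (topspace X) (borel_sets X) (\<lambda>A. ennreal (neg_part X \<mu> A))) f"

definition push_forward ::
  "'a topology \<Rightarrow> 'b topology \<Rightarrow> ('a \<Rightarrow> 'b) \<Rightarrow> ('a set \<Rightarrow> real) \<Rightarrow> 'b set \<Rightarrow> real" where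
  "push_forward X Y f \<mu> B = (if B \<in> borel_sets Y then \<mu> {x \<in> topspace X. f x \<in> B} else 0)"

definition weak_star_limit ::
  "'a topology \<Rightarrow> (nat \<Rightarrow> 'a set \<Rightarrow> real) \<Rightarrow> ('a set \<Rightarrow> real) \<Rightarrow> nat filter \<Rightarrow> bool" where
  "weak_star_limit X \<mu> \<mu>' \<F> \<longleftrightarrow> (\<forall>f. continuous_map X euclideanreal f \<longrightarrow>
     ((\<lambda>n. signed_integral X (\<mu> n) f) \<longlongrightarrow> signed_integral X \<mu>' f) \<F>)"

definition along :: "nat set \<Rightarrow> nat filter" where
  "along J = inf sequentially (principal J)"


section \<open>Realisations of Talagrand's construction\<close>

text \<open>Points of $2^\alpha$ are functions in \<open>{..<\<alpha>} \<rightarrow>\<^sub>E UNIV\<close>, and the coordinate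
  restriction from $\alpha$ to $\beta$ is \<open>\<pi> \<beta>\<close> (whatever $\alpha$ is). The space
  $2^{\omega_1}$ has index set \<open>UNIV\<close>. The bit 0 is \<open>False\<close>, 1 is \<open>True\<close>.\<close>

type_synonym point = "omega1 \<Rightarrow> bool"

definition cube :: "omega1 set \<Rightarrow> point topology" where
  "cube A = product_topology (\<lambda>_. discrete_topology UNIV) A"

definition \<pi> :: "omega1 \<Rightarrow> point \<Rightarrow> point" where
  "\<pi> \<beta> t = restrict t {..<\<beta>}"

text \<open>\<open>append_bit \<alpha> A b\<close> is the subset $A \times \{b\}$ of $2^{\alpha+1}$, for
  $A \subseteq 2^\alpha$.\<close>

definition append_bit :: "omega1 \<Rightarrow> point set \<Rightarrow> bool \<Rightarrow> point set" where
  "append_bit \<alpha> A b = (\<lambda>t. t(\<alpha> := b)) ` A"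

text \<open>One record type serves for partial and full realisations: all components are total functions,
  and the values at indices outside the range of the realisation are irrelevant.\<close>

record realisation =
  spc :: "omega1 \<Rightarrow> point set"  \<comment> \<open>$K_\alpha$, for $\omega \le \alpha < \omega_1$\<close>
  lower :: "omega1 \<Rightarrow> point set"  \<comment> \<open>$Y_\alpha$\<close>
  upper :: "omega1 \<Rightarrow> point set"  \<comment> \<open>$Z_\alpha$\<close>
  sched :: "omega1 \<Rightarrow> omega1 \<times> omega1"  \<comment> \<open>$\eta$\<close>
  clop :: "omega1 \<Rightarrow> omega1 \<Rightarrow> nat \<Rightarrow> point set"  \<comment> \<open>$U_n(\beta,\gamma)$\<close>
  meas :: "omega1 \<Rightarrow> omega1 \<Rightarrow> nat \<Rightarrow> point set \<Rightarrow> real"  \<comment> \<open>$\nu_n(\theta,\delta)$\<close>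
  Iset :: "omega1 \<Rightarrow> omega1 \<Rightarrow> nat set"  \<comment> \<open>$I(\theta,\alpha)$\<close>
  Jset :: "omega1 \<Rightarrow> omega1 \<Rightarrow> omega1 \<Rightarrow> nat set"  \<comment> \<open>$J(\theta,\delta,\alpha)$\<close>
  N0set :: "omega1 \<Rightarrow> omega1 \<Rightarrow> nat set"  \<comment> \<open>$N_0(\theta,\delta)$\<close>
  N1set :: "omega1 \<Rightarrow> omega1 \<Rightarrow> nat set"  \<comment> \<open>$N_1(\theta,\delta)$\<close>

definition top_at :: "realisation \<Rightarrow> omega1 \<Rightarrow> point topology" where
  "top_at R \<alpha> = subtopology (cube {..<\<alpha>}) (spc R \<alpha>)"

definition final_space :: "realisation \<Rightarrow> point set" where
  "final_space R = {t. \<forall>\<beta>\<ge>omega. \<pi> \<beta> t \<in> spc R \<beta>}"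

definition final_top :: "realisation \<Rightarrow> point topology" where
  "final_top R = subtopology (cube UNIV) (final_space R)"

definition Vset :: "realisation \<Rightarrow> nat \<Rightarrow> omega1 \<Rightarrow> omega1 \<Rightarrow> point set" where
  "Vset R n \<theta> \<alpha> = (case sched R \<theta> of (\<beta>, \<gamma>) \<Rightarrow> {t \<in> spc R \<alpha>. \<pi> \<beta> t \<in> clop R \<beta> \<gamma> n})"

definition clopen_sequences :: "realisation \<Rightarrow> omega1 \<Rightarrow> (nat \<Rightarrow> point set) set" where
  "clopen_sequences R \<beta> = {u. disjoint_family u \<and>
     (\<forall>n. u n \<noteq> {} \<and> openin (top_at R \<beta>) (u n) \<and> closedin (top_at R \<beta>) (u n))}"

definition admissible_sequences :: "realisation \<Rightarrow> omega1 \<Rightarrow> (nat \<Rightarrow> point set \<Rightarrow> real) set" where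
  "admissible_sequences R \<theta> = {\<nu>. \<forall>n.
     \<nu> n \<in> radon_measures (top_at R \<theta>) \<and>
     tv_norm (top_at R \<theta>) (\<nu> n) = 1 \<and>
     variation (top_at R \<theta>) (\<nu> n) (Vset R n \<theta> \<theta>) = 1 \<and>
     tv_norm (top_at R \<theta>) (pos_part (top_at R \<theta>) (\<nu> n)) \<ge> 1/2}"

definition Bset :: "realisation \<Rightarrow> nat \<Rightarrow> omega1 \<Rightarrow> omega1 \<Rightarrow> omega1 \<Rightarrow> (point set \<Rightarrow> real) set" where
  "Bset R n \<theta> \<delta> \<alpha> = {\<mu> \<in> radon_measures (top_at R \<alpha>).
     tv_norm (top_at R \<alpha>) \<mu> = 1 \<and>
     push_forward (top_at R \<alpha>) (top_at R \<theta>) (\<pi> \<theta>) \<mu> = meas R \<theta> \<delta> n}"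

definition spaces_upto :: "omega1 \<Rightarrow> realisation \<Rightarrow> bool" where
  "spaces_upto \<alpha> R \<longleftrightarrow>
     (\<forall>\<beta>. omega \<le> \<beta> \<and> \<beta> \<le> \<alpha> \<longrightarrow> compactin (cube {..<\<beta>}) (spc R \<beta>)) \<and>
     spc R omega = topspace (cube {..<omega}) \<and>
     (\<forall>\<beta>. omega \<le> \<beta> \<and> \<beta> < \<alpha> \<longrightarrow>
        closedin (top_at R \<beta>) (lower R \<beta>) \<and> closedin (top_at R \<beta>) (upper R \<beta>) \<and>
        lower R \<beta> \<union> upper R \<beta> = spc R \<beta> \<and>
        spc R (osucc \<beta>) = append_bit \<beta> (lower R \<beta>) False \<union> append_bit \<beta> (upper R \<beta>) True) \<and>
     (\<forall>\<rho>. limit_ordinal \<rho> \<and> omega < \<rho> \<and> \<rho> \<le> \<alpha> \<longrightarrow>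
        spc R \<rho> = {t \<in> topspace (cube {..<\<rho>}). \<forall>\<beta>. omega \<le> \<beta> \<and> \<beta> < \<rho> \<longrightarrow> \<pi> \<beta> t \<in> spc R \<beta>})"

definition schedule_upto :: "omega1 \<Rightarrow> realisation \<Rightarrow> bool" where
  "schedule_upto \<alpha> R \<longleftrightarrow> (\<forall>\<beta> \<theta> \<delta>. omega \<le> \<beta> \<and> \<beta> < \<alpha> \<and> sched R \<beta> = (\<theta>, \<delta>) \<longrightarrow>
     omega \<le> \<theta> \<and> \<theta> \<le> \<beta> \<and> \<delta> \<le> \<beta>)"

definition enumerations_upto :: "omega1 \<Rightarrow> realisation \<Rightarrow> bool" where
  "enumerations_upto \<alpha> R \<longleftrightarrow> (\<forall>\<beta>. omega \<le> \<beta> \<and> \<beta> < \<alpha> \<longrightarrow>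
     range (clop R \<beta>) = clopen_sequences R \<beta> \<and> range (meas R \<beta>) = admissible_sequences R \<beta>)"

definition condA :: "omega1 \<Rightarrow> realisation \<Rightarrow> bool" where
  "condA \<alpha> R \<longleftrightarrow> (\<forall>\<theta> \<delta> \<beta>. omega \<le> \<theta> \<and> \<theta> < \<beta> \<and> \<delta> < \<beta> \<and> \<beta> \<le> \<alpha> \<longrightarrow>
     Jset R \<theta> \<delta> \<beta> \<subseteq> Iset R \<theta> \<beta>)"

definition condB :: "omega1 \<Rightarrow> realisation \<Rightarrow> bool" where
  "condB \<alpha> R \<longleftrightarrow> (\<forall>\<theta> \<delta>. omega \<le> \<theta> \<and> \<theta> < \<alpha> \<and> \<delta> < \<alpha> \<longrightarrow>
     N0set R \<theta> \<delta> \<inter> N1set R \<theta> \<delta> = {})"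

definition condC :: "omega1 \<Rightarrow> realisation \<Rightarrow> bool" where
  "condC \<alpha> R \<longleftrightarrow> (\<forall>\<theta> \<delta> \<beta>. omega \<le> \<theta> \<and> \<theta> < \<beta> \<and> \<delta> < \<beta> \<and> \<beta> \<le> \<alpha> \<longrightarrow>
     infinite (Jset R \<theta> \<delta> \<beta> \<inter> N0set R \<theta> \<delta>) \<and> infinite (Jset R \<theta> \<delta> \<beta> \<inter> N1set R \<theta> \<delta>))"

definition condD :: "omega1 \<Rightarrow> realisation \<Rightarrow> bool" where
  "condD \<alpha> R \<longleftrightarrow> (\<forall>\<theta> \<delta> \<beta>' \<beta>. omega \<le> \<theta> \<and> \<theta> < \<beta>' \<and> \<delta> < \<beta>' \<and> \<beta>' \<le> \<beta> \<and> \<beta> \<le> \<alpha> \<longrightarrow>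
     finite (Jset R \<theta> \<delta> \<beta> - Jset R \<theta> \<delta> \<beta>') \<and> finite (Iset R \<theta> \<beta> - Iset R \<theta> \<beta>'))"

definition condE :: "omega1 \<Rightarrow> realisation \<Rightarrow> bool" where
  "condE \<alpha> R \<longleftrightarrow> (\<forall>\<theta> \<beta>' \<beta>. omega \<le> \<theta> \<and> \<theta> \<le> \<beta>' \<and> \<beta>' < \<beta> \<and> \<beta> \<le> \<alpha> \<longrightarrow>
     (\<exists>m. \<forall>n\<in>Iset R \<theta> \<beta>. n \<ge> m \<longrightarrow>
        (\<forall>t\<in>Vset R n \<theta> \<beta>. \<forall>t'\<in>Vset R n \<theta> \<beta>. \<pi> \<theta> t = \<pi> \<theta> t' \<longrightarrow> t \<beta>' = t' \<beta>')))"

definition condF :: "omega1 \<Rightarrow> realisation \<Rightarrow> bool" where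
  "condF \<alpha> R \<longleftrightarrow> (\<forall>\<theta> \<delta> \<beta>. omega \<le> \<theta> \<and> \<theta> < \<beta> \<and> \<delta> < \<beta> \<and> \<beta> \<le> \<alpha> \<longrightarrow>
     (\<forall>\<mu>. (\<forall>n. \<mu> n \<in> Bset R n \<theta> \<delta> \<beta>) \<longrightarrow>
        (\<exists>\<mu>'\<in>radon_measures (top_at R \<beta>).
           weak_star_limit (top_at R \<beta>) \<mu> \<mu>' (along (Jset R \<theta> \<delta> \<beta>)))))"

definition condG :: "omega1 \<Rightarrow> realisation \<Rightarrow> bool" where
  "condG \<alpha> R \<longleftrightarrow> (\<forall>\<beta> \<theta> \<delta>. omega \<le> \<beta> \<and> \<beta> < \<alpha> \<and> sched R \<beta> = (\<theta>, \<delta>) \<longrightarrow>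
     (\<forall>\<mu>. (\<forall>n. \<mu> n \<in> Bset R n \<theta> \<delta> (osucc \<beta>)) \<longrightarrow>
        infinite {n. \<mu> n (append_bit \<beta> (upper R \<beta>) True) \<ge> 1/6} \<and>
        infinite {n. \<mu> n (append_bit \<beta> (upper R \<beta>) True) = 0}))"

definition partial_realisation :: "omega1 \<Rightarrow> realisation \<Rightarrow> bool" where
  "partial_realisation \<alpha> R \<longleftrightarrow>
     spaces_upto \<alpha> R \<and> schedule_upto \<alpha> R \<and> enumerations_upto \<alpha> R \<and>
     condA \<alpha> R \<and> condB \<alpha> R \<and> condC \<alpha> R \<and> condD \<alpha> R \<and> condE \<alpha> R \<and> condF \<alpha> R \<and> condG \<alpha> R"

text \<open>Every requirement on a full realisation except the cofinality of the schedule, and the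
  definition of $K_{\omega_1}$ as the inverse limit (which is \<open>final_space\<close>), only involves
  ranks below $\omega_1$.\<close>

definition full_realisation :: "realisation \<Rightarrow> bool" where
  "full_realisation R \<longleftrightarrow>
     (\<forall>\<alpha>\<ge>omega. partial_realisation \<alpha> R) \<and>
     (\<forall>\<theta> \<delta>. omega \<le> \<theta> \<longrightarrow>
        (\<forall>\<xi>. \<exists>\<alpha>\<ge>\<xi>. omega \<le> \<alpha> \<and> max \<theta> \<delta> \<le> \<alpha> \<and> sched R \<alpha> = (\<theta>, \<delta>)))"

definition agree_upto :: "omega1 \<Rightarrow> realisation \<Rightarrow> realisation \<Rightarrow> bool" where
  "agree_upto \<alpha> P R \<longleftrightarrow>
     (\<forall>\<beta>. omega \<le> \<beta> \<and> \<beta> \<le> \<alpha> \<longrightarrow> spc R \<beta> = spc P \<beta>) \<and>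
     (\<forall>\<beta>. omega \<le> \<beta> \<and> \<beta> < \<alpha> \<longrightarrow>
        lower R \<beta> = lower P \<beta> \<and> upper R \<beta> = upper P \<beta> \<and> sched R \<beta> = sched P \<beta> \<and>
        clop R \<beta> = clop P \<beta> \<and> meas R \<beta> = meas P \<beta>) \<and>
     (\<forall>\<theta> \<beta>. omega \<le> \<theta> \<and> \<theta> < \<beta> \<and> \<beta> \<le> \<alpha> \<longrightarrow> Iset R \<theta> \<beta> = Iset P \<theta> \<beta>) \<and>
     (\<forall>\<theta> \<delta> \<beta>. omega \<le> \<theta> \<and> \<theta> < \<beta> \<and> \<delta> < \<beta> \<and> \<beta> \<le> \<alpha> \<longrightarrow> Jset R \<theta> \<delta> \<beta> = Jset P \<theta> \<delta> \<beta>) \<and>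
     (\<forall>\<theta> \<delta>. omega \<le> \<theta> \<and> \<theta> < \<alpha> \<and> \<delta> < \<alpha> \<longrightarrow>
        N0set R \<theta> \<delta> = N0set P \<theta> \<delta> \<and> N1set R \<theta> \<delta> = N1set P \<theta> \<delta>)"

end

theory Submission
  imports Defs "HOL-Complex_Analysis.Great_Picard"
begin

text \<open>Let $p$ be an accumulation point of $F$, let $x_j \to p$ in $F$ and $y_j = h(x_j)$, so that
  $y_j \to q = h(p)$ in $G$. The split is made at the point $p$ only, $Y_\alpha \cap Z_\alpha = \{p\}$, where
  $Z_\alpha$ is the union of $\{p\}$ and a sequence of clopen annuli around $p$ that contain the $x_j$ with
  $j$ even and none of the others. The Dirac measures at the $y_j$ are part of an admissible sequence
  $\nu_n(\alpha, \alpha)$, and its indices are distributed over $N_0$ and $N_1$ according to the parity of $j$.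
  In a continuation, (F) and (C) force the lifts of the even $y_j$ and those of the odd $y_j$ to have a
  common accumulation point, whereas coordinate $\alpha$ separates the lifts of the even $x_j$ from those of the
  odd $x_j$; a homeomorphism covering $h$ cannot do both.

  To keep (C)--(F) for the old pairs $(\theta, \delta)$, the annuli are chosen recursively and very sparse.
  Since the $V_n(\theta, \alpha)$ are disjoint, $p$ lies in at most one of them, so infinitely many indices of
  $J(\theta, \delta, \alpha) \cap N_e(\theta, \delta)$ can be kept for which $V_n(\theta, \alpha)$ misses all later
  annuli, and for these the measure of the earlier annuli is already close to its limit. For the new pairs
  $(\theta, \alpha)$ a convergent subsequence is extracted.\<close>

section \<open>Signed Borel measures\<close>

text \<open>The difficulty is that one Dirac sequence at level \<alpha> must serve several
  conditions at once. (G) wants infinitely many of its points in the upper part of the split, while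
  the points h(x_j) must all stay outside it, so that their lifts have bit 0 at \<alpha> and
  converge as (F) demands. All annuli therefore lie in a neighbourhood of p disjoint from G, and the
  sequence interleaves h(x_j), at n = 2j, with x_j, at n = 2j + 1; the latter serve (G). The new J
  is the set of even n, and the parity of j cuts it into the classes 4i and 4i + 2. The new V_n
  avoid p, so nothing splits over them and the Dirac measures have unique lifts to \<alpha> + 1.
  Rank \<alpha> + 1 already involves all pairs (\<alpha>, \<delta>) with \<delta> \<le> \<alpha>,
  hence all these sequences are chosen equal. That \<omega>_1 suffices to enumerate sequences of
  clopen sets and of measures is the continuum hypothesis, which diamond implies. For an old pair,
  one new clopen set, the one on which coordinate \<alpha> is 1, generates the clopen algebra of the
  new space over that of the old; so (F) reduces to its measure. The final contradiction is found at
  a countable rank because disjoint compact sets in a cube are separated by finitely many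
  coordinates.\<close>

lemma sigma_algebra_borel_sets: "sigma_algebra (topspace X) (borel_sets X)"
  unfolding borel_sets_def by (rule sigma_algebra_sigma_sets) (auto dest: openin_subset)

lemma borel_sets_subset: "A \<in> borel_sets X \<Longrightarrow> A \<subseteq> topspace X"
  unfolding borel_sets_def using sigma_sets_into_sp[of "{U. openin X U}" "topspace X"] openin_subset by blast

lemma openin_borel: "openin X U \<Longrightarrow> U \<in> borel_sets X"
  unfolding borel_sets_def by (simp add: sigma_sets.Basic)

lemma borel_sets_diff: "A \<in> borel_sets X \<Longrightarrow> B \<in> borel_sets X \<Longrightarrow> A - B \<in> borel_sets X"
  and borel_sets_Un: "A \<in> borel_sets X \<Longrightarrow> B \<in> borel_sets X \<Longrightarrow> A \<union> B \<in> borel_sets X"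
  and borel_sets_Int: "A \<in> borel_sets X \<Longrightarrow> B \<in> borel_sets X \<Longrightarrow> A \<inter> B \<in> borel_sets X"
  and borel_sets_empty: "{} \<in> borel_sets X"
  and borel_sets_top: "topspace X \<in> borel_sets X"
proof -
  interpret sigma_algebra "topspace X" "borel_sets X" by (rule sigma_algebra_borel_sets)
  show "A \<in> borel_sets X \<Longrightarrow> B \<in> borel_sets X \<Longrightarrow> A - B \<in> borel_sets X"
    "A \<in> borel_sets X \<Longrightarrow> B \<in> borel_sets X \<Longrightarrow> A \<union> B \<in> borel_sets X"
    "A \<in> borel_sets X \<Longrightarrow> B \<in> borel_sets X \<Longrightarrow> A \<inter> B \<in> borel_sets X"
    "{} \<in> borel_sets X" "topspace X \<in> borel_sets X" by auto
qed

lemma closedin_borel: "closedin X C \<Longrightarrow> C \<in> borel_sets X"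
  using borel_sets_diff[OF borel_sets_top openin_borel[of X "topspace X - C"]]
  by (simp add: closedin_def double_diff)

lemma borel_sets_UN: "range (A :: nat \<Rightarrow> _) \<subseteq> borel_sets X \<Longrightarrow> (\<Union>n. A n) \<in> borel_sets X"
  using sigma_algebra.countable_nat_UN[OF sigma_algebra_borel_sets] by blast

section \<open>Jordan decomposition of bounded finitely additive set functions\<close>

definition upper_part :: "'a set set \<Rightarrow> ('a set \<Rightarrow> real) \<Rightarrow> 'a set \<Rightarrow> real" where
  "upper_part M \<mu> A = (SUP B \<in> {B. B \<in> M \<and> B \<subseteq> A}. \<mu> B)"

text \<open>Finite additivity on an algebra is the common ground of two uses: Borel measures, and
  set functions on the clopen algebra, where weak-star limits first appear before being extended to
  measures.\<close>

locale charge = algebra \<Omega> M for \<Omega> :: "'a set" and M +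
  fixes \<mu> :: "'a set \<Rightarrow> real"
  assumes additive: "A \<in> M \<Longrightarrow> B \<in> M \<Longrightarrow> A \<inter> B = {} \<Longrightarrow> \<mu> (A \<union> B) = \<mu> A + \<mu> B"
    and bounded: "\<exists>K. \<forall>A\<in>M. \<bar>\<mu> A\<bar> \<le> K"
begin

lemma empty: "\<mu> {} = 0"
  using additive[of "{}" "{}"] by simp

lemma diff: "A \<in> M \<Longrightarrow> B \<in> M \<Longrightarrow> B \<subseteq> A \<Longrightarrow> \<mu> (A - B) = \<mu> A - \<mu> B"
  using additive[of "A - B" B] Diff[of A B] by (simp add: Un_absorb2 Int_commute)

lemma bdd: "bdd_above (\<mu> ` {B. B \<in> M \<and> B \<subseteq> A})"
  using bounded by (auto simp: bdd_above_def) (metis abs_le_iff)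

lemma le_upper: "B \<in> M \<Longrightarrow> B \<subseteq> A \<Longrightarrow> \<mu> B \<le> upper_part M \<mu> A"
  unfolding upper_part_def using bdd by (intro cSUP_upper) auto

lemma upper_le: "(\<And>B. B \<in> M \<Longrightarrow> B \<subseteq> A \<Longrightarrow> \<mu> B \<le> K) \<Longrightarrow> upper_part M \<mu> A \<le> K"
  unfolding upper_part_def by (rule cSUP_least) auto

lemma upper_nonneg: "0 \<le> upper_part M \<mu> A"
  using le_upper[of "{}" A] empty by simp

lemma upper_mono: "A \<subseteq> B \<Longrightarrow> upper_part M \<mu> A \<le> upper_part M \<mu> B"
  by (rule upper_le) (auto intro: le_upper)

lemma upper_additive:
  assumes "A \<in> M" "B \<in> M" "A \<inter> B = {}"
  shows "upper_part M \<mu> (A \<union> B) = upper_part M \<mu> A + upper_part M \<mu> B"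
proof (rule antisym)
  show "upper_part M \<mu> (A \<union> B) \<le> upper_part M \<mu> A + upper_part M \<mu> B"
  proof (rule upper_le)
    fix E assume E: "E \<in> M" "E \<subseteq> A \<union> B"
    have "\<mu> E = \<mu> ((E \<inter> A) \<union> (E \<inter> B))" using E by (simp add: Int_Un_distrib[symmetric] Int_absorb2)
    also have "\<dots> = \<mu> (E \<inter> A) + \<mu> (E \<inter> B)" using E assms by (intro additive) auto
    also have "\<dots> \<le> upper_part M \<mu> A + upper_part M \<mu> B"
      using E assms by (intro add_mono le_upper) auto
    finally show "\<mu> E \<le> upper_part M \<mu> A + upper_part M \<mu> B" .
  qed
  have "upper_part M \<mu> A \<le> upper_part M \<mu> (A \<union> B) - \<mu> E" if E: "E \<in> M" "E \<subseteq> B" for E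
  proof (rule upper_le)
    fix D assume D: "D \<in> M" "D \<subseteq> A"
    have "\<mu> D + \<mu> E = \<mu> (D \<union> E)" using D E assms by (intro additive[symmetric]) auto
    also have "\<dots> \<le> upper_part M \<mu> (A \<union> B)" using D E by (intro le_upper) auto
    finally show "\<mu> D \<le> upper_part M \<mu> (A \<union> B) - \<mu> E" by simp
  qed
  then have "upper_part M \<mu> B \<le> upper_part M \<mu> (A \<union> B) - upper_part M \<mu> A"
    by (intro upper_le) (simp add: le_diff_eq add.commute)
  then show "upper_part M \<mu> A + upper_part M \<mu> B \<le> upper_part M \<mu> (A \<union> B)" by simp
qed

text \<open>Exchanging \<open>B\<close> and \<open>A - B\<close> turns competitors for
  \<open>- \<mu>\<close> into competitors for \<open>\<mu>\<close>, shifted by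
  \<open>\<mu> A\<close>. This gives the Jordan decomposition without a Hahn decomposition.\<close>

lemma upper_minus:
  assumes A: "A \<in> M"
  shows "upper_part M (\<lambda>A. - \<mu> A) A = upper_part M \<mu> A - \<mu> A"
proof -
  interpret n: charge \<Omega> M "\<lambda>A. - \<mu> A"
    using additive bounded by unfold_locales auto
  have "- \<mu> B \<le> upper_part M \<mu> A - \<mu> A" if "B \<in> M" "B \<subseteq> A" for B
    using le_upper[of "A - B" A] diff[of A B] Diff[of A B] that A by auto
  moreover have "\<mu> B \<le> upper_part M (\<lambda>A. - \<mu> A) A + \<mu> A" if "B \<in> M" "B \<subseteq> A" for B
    using n.le_upper[of "A - B" A] diff[of A B] Diff[of A B] that A by auto
  ultimately show ?thesis
    using n.upper_le[of A "upper_part M \<mu> A - \<mu> A"] upper_le[of A "upper_part M (\<lambda>A. - \<mu> A) A + \<mu> A"]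
    by fastforce
qed

lemma uminus: "charge \<Omega> M (\<lambda>A. - \<mu> A)"
  using additive bounded by unfold_locales auto

end

text \<open>On the spaces considered below the regularity clause of \<open>radon_measures\<close> is automatic, see
  \<open>radon_iff\<close>.\<close>

definition signed_measure :: "'a topology \<Rightarrow> ('a set \<Rightarrow> real) \<Rightarrow> bool" where
  "signed_measure X \<mu> \<longleftrightarrow> (\<forall>A. A \<notin> borel_sets X \<longrightarrow> \<mu> A = 0) \<and>
     (\<forall>A :: nat \<Rightarrow> 'a set. range A \<subseteq> borel_sets X \<and> disjoint_family A \<longrightarrow>
        (\<lambda>n. \<mu> (A n)) sums \<mu> (\<Union>n. A n))"

lemma radon_imp_signed: "\<mu> \<in> radon_measures X \<Longrightarrow> signed_measure X \<mu>"
  by (auto simp: radon_measures_def signed_measure_def)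

lemma signed_measure_sums:
  "signed_measure X \<mu> \<Longrightarrow> range A \<subseteq> borel_sets X \<Longrightarrow> disjoint_family A \<Longrightarrow>
    (\<lambda>n. \<mu> (A n)) sums \<mu> (\<Union>n. A n)"
  by (auto simp: signed_measure_def)

lemma signed_measure_uminus: "signed_measure X \<mu> \<Longrightarrow> signed_measure X (\<lambda>A. - \<mu> A)"
  by (auto simp: signed_measure_def intro: sums_minus)

lemma signed_measure_empty: assumes "signed_measure X \<mu>" shows "\<mu> {} = 0"
proof -
  have "(\<lambda>n::nat. \<mu> {}) sums \<mu> (\<Union>n::nat. {})"
    using assms by (intro signed_measure_sums) (auto simp: disjoint_family_on_def borel_sets_empty)
  then have "(\<lambda>n::nat. \<mu> {}) \<longlonglongrightarrow> 0" using sums_summable summable_LIMSEQ_zero by blast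
  then show ?thesis by (simp add: LIMSEQ_const_iff)
qed

lemma signed_measure_additive:
  assumes m: "signed_measure X \<mu>" and A: "A \<in> borel_sets X" "B \<in> borel_sets X" "A \<inter> B = {}"
  shows "\<mu> (A \<union> B) = \<mu> A + \<mu> B"
proof -
  have "(\<lambda>n. \<mu> (binaryset A B n)) sums \<mu> (\<Union>n. binaryset A B n)"
    using A by (intro signed_measure_sums[OF m])
      (auto simp: range_binaryset_eq borel_sets_empty disjoint_family_on_def binaryset_def)
  moreover have "(\<lambda>n. \<mu> (binaryset A B n)) sums (\<mu> A + \<mu> B)"
    by (rule binaryset_sums) (rule signed_measure_empty[OF m])
  ultimately show ?thesis by (metis sums_unique2 UN_binaryset_eq)
qed

lemma (in charge) finite_additive:
  "finite P \<Longrightarrow> P \<subseteq> M \<Longrightarrow> disjoint P \<Longrightarrow> \<mu> (\<Union>P) = (\<Sum>E\<in>P. \<mu> E)"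
proof (induction P rule: finite_induct)
  case (insert E P)
  have "E \<inter> \<Union>P = {}" using insert.prems insert.hyps by (auto simp: pairwise_def disjnt_def)
  moreover have "\<Union>P \<in> M" using insert by (intro finite_Union) auto
  ultimately show ?case using insert by (simp add: additive pairwise_insert)
qed (simp add: empty)

text \<open>A set with unboundedly charged subsets splits into a part of the same kind and a rest of
  mass above 1. Iteration produces disjoint rests whose masses do not tend to 0, although countable
  additivity makes their series converge.\<close>

lemma signed_measure_bounded:
  assumes m: "signed_measure X \<mu>"
  shows "\<exists>K. \<forall>A\<in>borel_sets X. \<bar>\<mu> A\<bar> \<le> K"
proof (rule ccontr)
  define big where "big E \<longleftrightarrow> E \<in> borel_sets X \<and> (\<forall>K. \<exists>B\<in>borel_sets X. B \<subseteq> E \<and> \<bar>\<mu> B\<bar> > K)" for E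
  have split: "\<mu> E = \<mu> B + \<mu> (E - B)" if "E \<in> borel_sets X" "B \<in> borel_sets X" "B \<subseteq> E" for B E
    using signed_measure_additive[OF m that(2) borel_sets_diff[OF that(1,2)]] that(3)
    by (simp add: Un_absorb1)
  have step: "\<exists>E'. big E' \<and> E' \<subseteq> E \<and> \<bar>\<mu> (E - E')\<bar> > 1" if E: "big E" for E
  proof -
    \<comment> \<open>The margin in the bound makes \<open>\<mu> B\<close> and
      \<open>\<mu> (E - B)\<close> both exceed 1 in absolute value, so either of the two pieces may
      be discarded.\<close>
    obtain B where B: "B \<in> borel_sets X" "B \<subseteq> E" "\<bar>\<mu> B\<bar> > 1 + \<bar>\<mu> E\<bar>"
      using E unfolding big_def by blast
    have EB: "E - B \<in> borel_sets X" using E B borel_sets_diff unfolding big_def by blast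
    show ?thesis
    proof (cases "big B")
      case True
      moreover have "E \<in> borel_sets X" using E unfolding big_def by blast
      then have "\<bar>\<mu> (E - B)\<bar> > 1" using split[OF _ B(1,2)] B(3) by linarith
      ultimately show ?thesis using B(2) by blast
    next
      case False
      then obtain K where K: "\<And>D. D \<in> borel_sets X \<Longrightarrow> D \<subseteq> B \<Longrightarrow> \<bar>\<mu> D\<bar> \<le> K"
        using B unfolding big_def by (meson not_le)
      have "big (E - B)" unfolding big_def
      proof (intro conjI allI)
        fix L
        obtain D where D: "D \<in> borel_sets X" "D \<subseteq> E" "\<bar>\<mu> D\<bar> > L + K"
          using E unfolding big_def by blast
        have "\<mu> D = \<mu> (D \<inter> B) + \<mu> (D - D \<inter> B)"
          using D B by (intro split) (auto intro: borel_sets_Int)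
        moreover have "\<bar>\<mu> (D \<inter> B)\<bar> \<le> K" using D B by (intro K) (auto intro: borel_sets_Int)
        moreover have "D - D \<inter> B = D - B" by auto
        ultimately have "\<mu> D = \<mu> (D \<inter> B) + \<mu> (D - B)" "\<bar>\<mu> (D \<inter> B)\<bar> \<le> K" by simp_all
        then have "\<bar>\<mu> (D - B)\<bar> > L" using D(3) by linarith
        then show "\<exists>B'\<in>borel_sets X. B' \<subseteq> E - B \<and> L < \<bar>\<mu> B'\<bar>"
          using D B by (intro bexI[of _ "D - B"]) (auto intro: borel_sets_diff)
      qed (rule EB)
      moreover have "E - (E - B) = B" using B(2) by blast
      moreover have "\<bar>\<mu> B\<bar> > 1" using B(3) by linarith
      ultimately show ?thesis by (metis Diff_subset)
    qed
  qed
  assume no: "\<nexists>K. \<forall>A\<in>borel_sets X. \<bar>\<mu> A\<bar> \<le> K"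
  have "big (topspace X)"
    unfolding big_def
  proof (intro conjI allI borel_sets_top)
    fix K
    obtain B where "B \<in> borel_sets X" "\<not> \<bar>\<mu> B\<bar> \<le> K" using no by blast
    then show "\<exists>B\<in>borel_sets X. B \<subseteq> topspace X \<and> K < \<bar>\<mu> B\<bar>"
      using borel_sets_subset[of B X] by (intro bexI[of _ B]) auto
  qed
  then have "\<exists>E. big E" by blast
  then obtain E :: "nat \<Rightarrow> 'a set" where "\<forall>n. big (E n) \<and> E (Suc n) \<subseteq> E n \<and> \<bar>\<mu> (E n - E (Suc n))\<bar> > 1"
    using dependent_nat_choice[of "\<lambda>_. big" "\<lambda>_ E E'. E' \<subseteq> E \<and> \<bar>\<mu> (E - E')\<bar> > 1", OF _ step] by auto
  then have E: "big (E n)" "E (Suc n) \<subseteq> E n" "\<bar>\<mu> (E n - E (Suc n))\<bar> > 1" for n by blast+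
  have dec: "decseq E" using E(2) by (rule decseq_SucI)
  have "disjoint_family (\<lambda>n. E n - E (Suc n))"
    unfolding disjoint_family_on_def
  proof (intro ballI impI)
    fix i j :: nat assume "i \<noteq> j"
    then have "Suc i \<le> j \<or> Suc j \<le> i" by auto
    then show "(E i - E (Suc i)) \<inter> (E j - E (Suc j)) = {}"
      using decseqD[OF dec] by blast
  qed
  moreover have "range (\<lambda>n. E n - E (Suc n)) \<subseteq> borel_sets X"
    using E(1) borel_sets_diff unfolding big_def by blast
  ultimately have "(\<lambda>n. \<mu> (E n - E (Suc n))) sums \<mu> (\<Union>n. E n - E (Suc n))"
    by (intro signed_measure_sums[OF m])
  then have "(\<lambda>n. \<mu> (E n - E (Suc n))) \<longlonglongrightarrow> 0"
    using sums_summable summable_LIMSEQ_zero by blast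
  then obtain n where "norm (\<mu> (E n - E (Suc n)) - 0) < 1"
    using LIMSEQ_D[of _ 0 1] zero_less_one le_refl by blast
  then show False using E(3)[of n] by simp
qed

lemma signed_measure_charge: "signed_measure X \<mu> \<Longrightarrow> charge (topspace X) (borel_sets X) \<mu>"
  by (intro charge.intro charge_axioms.intro sigma_algebra.axioms(1)[OF sigma_algebra_borel_sets]
      signed_measure_additive signed_measure_bounded)

lemma pos_part_eq: "A \<in> borel_sets X \<Longrightarrow> pos_part X \<mu> A = upper_part (borel_sets X) \<mu> A"
  by (simp add: pos_part_def upper_part_def)

text \<open>Finite additivity and monotonicity bound the partial sums. For the reverse inequality
  each competitor inside the union is cut along the \<open>A n\<close>, and countable additivity of
  \<open>\<mu>\<close> sums the pieces.\<close>

lemma signed_measure_pos_part: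
  assumes m: "signed_measure X \<mu>"
  shows "signed_measure X (pos_part X \<mu>)"
  unfolding signed_measure_def
proof (intro conjI allI impI)
  interpret charge "topspace X" "borel_sets X" \<mu> by (rule signed_measure_charge[OF m])
  let ?p = "pos_part X \<mu>"
  show "?p A = 0" if "A \<notin> borel_sets X" for A using that by (simp add: pos_part_def)
  fix A :: "nat \<Rightarrow> 'a set" assume A: "range A \<subseteq> borel_sets X \<and> disjoint_family A"
  then have AM: "A n \<in> borel_sets X" for n by auto
  have UM: "(\<Union>n. A n) \<in> borel_sets X" using A by (intro borel_sets_UN) auto
  have fin: "(\<Union>i<n. A i) \<in> borel_sets X" for n using AM by (intro finite_UN) auto
  have nn: "0 \<le> ?p (A n)" for n using upper_nonneg pos_part_eq[OF AM] by simp
  have eq: "(\<Sum>i<n. ?p (A i)) = ?p (\<Union>i<n. A i)" for n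
  proof (induction n)
    case 0
    have "upper_part (borel_sets X) \<mu> {} \<le> 0" by (rule upper_le) (simp add: empty)
    then have "upper_part (borel_sets X) \<mu> {} = 0" using upper_nonneg[of "{}"] by (rule antisym)
    then show ?case by (simp add: pos_part_eq[OF borel_sets_empty])
  next
    case (Suc n)
    have "A i \<inter> A n = {}" if "i < n" for i using disjoint_family_onD[of A UNIV i n] A that by auto
    then have "(\<Union>i<n. A i) \<inter> A n = {}" by blast
    then have "?p (\<Union>i<n. A i) + ?p (A n) = ?p ((\<Union>i<n. A i) \<union> A n)"
      using upper_additive[OF fin AM] pos_part_eq[OF fin] pos_part_eq[OF AM] pos_part_eq[OF Un[OF fin AM]]
      by simp
    then show ?case using Suc by (simp add: lessThan_Suc Un_commute)
  qed
  have le: "(\<Sum>i<n. ?p (A i)) \<le> ?p (\<Union>n. A n)" for n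
    unfolding eq pos_part_eq[OF fin] pos_part_eq[OF UM] by (rule upper_mono) auto
  have s: "summable (\<lambda>n. ?p (A n))" 
    using nn le[of "Suc _"] unfolding lessThan_Suc_atMost by (rule bounded_imp_summable)
  have "?p (\<Union>n. A n) \<le> (\<Sum>n. ?p (A n))"
    unfolding pos_part_eq[OF UM]
  proof (rule upper_le)
    fix B assume B: "B \<in> borel_sets X" "B \<subseteq> (\<Union>n. A n)"
    have "(\<lambda>n. \<mu> (B \<inter> A n)) sums \<mu> (\<Union>n. B \<inter> A n)"
    proof (rule signed_measure_sums[OF m])
      show "range (\<lambda>n. B \<inter> A n) \<subseteq> borel_sets X" using B AM by blast
      have "disjoint_family A" using A by blast
      then show "disjoint_family (\<lambda>n. B \<inter> A n)" by (rule disjoint_family_subset) blast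
    qed
    moreover have "(\<Union>n. B \<inter> A n) = B" using B by auto
    ultimately have sm: "(\<lambda>n. \<mu> (B \<inter> A n)) sums \<mu> B" by simp
    have "\<mu> (B \<inter> A n) \<le> ?p (A n)" for n
      unfolding pos_part_eq[OF AM] using B AM by (intro le_upper) auto
    then show "\<mu> B \<le> (\<Sum>n. ?p (A n))"
      using sums_le[OF _ sm summable_sums[OF s]] by blast
  qed
  moreover have "(\<Sum>n. ?p (A n)) \<le> ?p (\<Union>n. A n)" using s le by (intro suminf_le_const) auto
  ultimately show "(\<lambda>n. ?p (A n)) sums ?p (\<Union>n. A n)"
    using s by (metis antisym summable_sums)
qed

lemma signed_measure_neg_part: "signed_measure X \<mu> \<Longrightarrow> signed_measure X (neg_part X \<mu>)"
  unfolding neg_part_def by (intro signed_measure_pos_part signed_measure_uminus)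

lemma pos_part_nonneg: "signed_measure X \<mu> \<Longrightarrow> 0 \<le> pos_part X \<mu> A"
  using charge.upper_nonneg[OF signed_measure_charge, of X \<mu> A] by (cases "A \<in> borel_sets X") (simp_all add: pos_part_eq, simp add: pos_part_def)

lemma neg_part_nonneg: "signed_measure X \<mu> \<Longrightarrow> 0 \<le> neg_part X \<mu> A"
  unfolding neg_part_def by (intro pos_part_nonneg signed_measure_uminus)

lemma neg_part_eq: "signed_measure X \<mu> \<Longrightarrow> neg_part X \<mu> A = pos_part X \<mu> A - \<mu> A"
  using charge.upper_minus[OF signed_measure_charge, of X \<mu> A]
  by (cases "A \<in> borel_sets X")
    (simp_all add: neg_part_def pos_part_eq, simp add: pos_part_def signed_measure_def)

text \<open>Norms are defined by finite partitions, integrals by the positive and negative parts;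
  this connects them. For the inequality from below, partitions into the two pieces \<open>B\<close>
  and \<open>A - B\<close> are enough.\<close>

lemma variation_eq:
  assumes m: "signed_measure X \<mu>"
  shows "variation X \<mu> A = pos_part X \<mu> A + neg_part X \<mu> A"
proof (cases "A \<in> borel_sets X")
  case True
  interpret charge "topspace X" "borel_sets X" \<mu> by (rule signed_measure_charge[OF m])
  interpret p: charge "topspace X" "borel_sets X" "pos_part X \<mu>"
    by (rule signed_measure_charge[OF signed_measure_pos_part[OF m]])
  let ?\<P> = "{P. finite P \<and> P \<subseteq> borel_sets X \<and> disjoint P \<and> \<Union>P = A}"
  let ?v = "SUP P \<in> ?\<P>. \<Sum>E\<in>P. \<bar>\<mu> E\<bar>"
  have le: "(\<Sum>E\<in>P. \<bar>\<mu> E\<bar>) \<le> pos_part X \<mu> A + neg_part X \<mu> A" if P: "P \<in> ?\<P>" for P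
  proof -
    have "(\<Sum>E\<in>P. \<bar>\<mu> E\<bar>) \<le> (\<Sum>E\<in>P. 2 * pos_part X \<mu> E - \<mu> E)"
      using neg_part_eq[OF m] pos_part_nonneg[OF m] neg_part_nonneg[OF m]
      by (intro sum_mono) (smt (verit))
    also have "\<dots> = 2 * pos_part X \<mu> A - \<mu> A"
      using P finite_additive[of P] p.finite_additive[of P] by (auto simp: sum_subtractf sum_distrib_left[symmetric])
    finally show ?thesis by (simp add: neg_part_eq[OF m])
  qed
  have bdd: "bdd_above ((\<lambda>P. \<Sum>E\<in>P. \<bar>\<mu> E\<bar>) ` ?\<P>)" using le by (rule bdd_aboveI2)
  have "?v \<le> pos_part X \<mu> A + neg_part X \<mu> A"
  proof (rule cSUP_least[OF _ le])
    have "{A} \<in> ?\<P>" using True by (auto simp: pairwise_def)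
    then show "?\<P> \<noteq> {}" by blast
  qed
  moreover have "pos_part X \<mu> A \<le> (?v + \<mu> A) / 2"
    unfolding pos_part_eq[OF True]
  proof (rule upper_le)
    fix B assume B: "B \<in> borel_sets X" "B \<subseteq> A"
    have AB: "A - B \<in> borel_sets X" using True B by auto
    have "(\<Sum>E\<in>{B, A - B}. \<bar>\<mu> E\<bar>) \<le> ?v"
      using True B AB by (intro cSUP_upper bdd) (auto simp: pairwise_def disjnt_def)
    moreover have "(\<Sum>E\<in>{B, A - B}. \<bar>\<mu> E\<bar>) = \<bar>\<mu> B\<bar> + \<bar>\<mu> (A - B)\<bar>"
    \<comment> \<open>As a set, \<open>{B, A - B}\<close> loses a summand when its members coincide;
      this happens only if both are empty, and the lost summand is then 0.\<close>
    proof (cases "B = A - B")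
      case True
      then have "B = {}" by blast
      then show ?thesis using True by (simp add: empty)
    qed simp
    ultimately show "\<mu> B \<le> (?v + \<mu> A) / 2" using diff[OF True B] by auto
  qed
  ultimately show ?thesis using True by (simp add: variation_def neg_part_eq[OF m])
qed (simp add: variation_def neg_part_def pos_part_def)

lemma signed_measure_null: "signed_measure X \<mu> \<Longrightarrow> A \<notin> borel_sets X \<Longrightarrow> \<mu> A = 0"
  unfolding signed_measure_def by blast

lemma signed_measureI:
  assumes "\<And>A. A \<notin> borel_sets X \<Longrightarrow> \<mu> A = 0"
    and "\<And>A :: nat \<Rightarrow> _. range A \<subseteq> borel_sets X \<Longrightarrow> disjoint_family A \<Longrightarrow> (\<lambda>n. \<mu> (A n)) sums \<mu> (\<Union>n. A n)"
  shows "signed_measure X \<mu>"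
  unfolding signed_measure_def using assms by blast

lemma signed_measure_add:
  assumes m: "signed_measure X \<mu>" "signed_measure X \<nu>"
  shows "signed_measure X (\<lambda>A. \<mu> A + \<nu> A)"
proof (rule signed_measureI)
  fix A assume "A \<notin> borel_sets X"
  then show "\<mu> A + \<nu> A = 0" using m[THEN signed_measure_null] by simp
next
  fix A :: "nat \<Rightarrow> _" assume A: "range A \<subseteq> borel_sets X" "disjoint_family A"
  show "(\<lambda>n. \<mu> (A n) + \<nu> (A n)) sums (\<mu> (\<Union>n. A n) + \<nu> (\<Union>n. A n))"
    by (rule sums_add[OF signed_measure_sums[OF m(1) A] signed_measure_sums[OF m(2) A]])
qed

lemma signed_measure_diff:
  assumes m: "signed_measure X \<mu>" "signed_measure X \<nu>"
  shows "signed_measure X (\<lambda>A. \<mu> A - \<nu> A)"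
proof (rule signed_measureI)
  fix A assume "A \<notin> borel_sets X"
  then show "\<mu> A - \<nu> A = 0" using m[THEN signed_measure_null] by simp
next
  fix A :: "nat \<Rightarrow> _" assume A: "range A \<subseteq> borel_sets X" "disjoint_family A"
  show "(\<lambda>n. \<mu> (A n) - \<nu> (A n)) sums (\<mu> (\<Union>n. A n) - \<nu> (\<Union>n. A n))"
    by (rule sums_diff[OF signed_measure_sums[OF m(1) A] signed_measure_sums[OF m(2) A]])
qed

lemma signed_measure_variation: "signed_measure X \<mu> \<Longrightarrow> signed_measure X (variation X \<mu>)"
proof -
  assume m: "signed_measure X \<mu>"
  have "variation X \<mu> = (\<lambda>A. pos_part X \<mu> A + neg_part X \<mu> A)" using variation_eq[OF m] by blast
  then show ?thesis
    using signed_measure_add[OF signed_measure_pos_part[OF m] signed_measure_neg_part[OF m]] by simp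
qed

lemma abs_le_variation: "signed_measure X \<mu> \<Longrightarrow> \<bar>\<mu> A\<bar> \<le> variation X \<mu> A"
  using variation_eq[of X \<mu> A] neg_part_eq[of X \<mu> A] pos_part_nonneg[of X \<mu> A] neg_part_nonneg[of X \<mu> A]
  by linarith

lemma variation_nonneg: "signed_measure X \<mu> \<Longrightarrow> 0 \<le> variation X \<mu> A"
  using abs_le_variation[of X \<mu> A] by linarith

lemma variation_mono:
  assumes m: "signed_measure X \<mu>" and "A \<in> borel_sets X" "B \<in> borel_sets X" "A \<subseteq> B"
  shows "variation X \<mu> A \<le> variation X \<mu> B"
proof -
  have "variation X \<mu> B = variation X \<mu> A + variation X \<mu> (B - A)"
    using signed_measure_additive[OF signed_measure_variation[OF m] assms(2) borel_sets_diff[OF assms(3,2)]] assms(4)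
    by (metis Diff_disjoint Diff_partition)
  then show ?thesis using variation_nonneg[OF m, of "B - A"] by simp
qed

lemma variation_le_tv: "signed_measure X \<mu> \<Longrightarrow> variation X \<mu> A \<le> tv_norm X \<mu>"
  unfolding tv_norm_def
  using variation_mono[OF _ _ borel_sets_top borel_sets_subset, of X \<mu> A] variation_nonneg[of X \<mu> "topspace X"]
  by (cases "A \<in> borel_sets X") (simp_all only: variation_def[of X \<mu> A] if_False)

section \<open>Nonnegative set functions as measures of the library\<close>

definition to_measure :: "'a topology \<Rightarrow> ('a set \<Rightarrow> real) \<Rightarrow> 'a measure" where
  "to_measure X f = measure_of (topspace X) (borel_sets X) (\<lambda>A. ennreal (f A))"

lemma space_to_measure [simp]: "space (to_measure X f) = topspace X"
  and sets_to_measure [simp]: "sets (to_measure X f) = borel_sets X"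
proof -
  have sub: "borel_sets X \<subseteq> Pow (topspace X)" using borel_sets_subset by blast
  show "space (to_measure X f) = topspace X"
    unfolding to_measure_def by (rule space_measure_of[OF sub])
  show "sets (to_measure X f) = borel_sets X"
    unfolding to_measure_def by (rule sigma_algebra.sets_measure_of_eq[OF sigma_algebra_borel_sets])
qed

lemma emeasure_to_measure:
  assumes m: "signed_measure X f" and nn: "\<And>A. 0 \<le> f A" and A: "A \<in> borel_sets X"
  shows "emeasure (to_measure X f) A = ennreal (f A)"
  unfolding to_measure_def
proof (rule emeasure_measure_of_sigma[OF sigma_algebra_borel_sets _ _ A])
  show "positive (borel_sets X) (\<lambda>A. ennreal (f A))"
    by (simp add: positive_def signed_measure_empty[OF m])
  show "countably_additive (borel_sets X) (\<lambda>A. ennreal (f A))"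
    unfolding countably_additive_def
  proof (intro allI impI)
    fix A :: "nat \<Rightarrow> _" assume "range A \<subseteq> borel_sets X" "disjoint_family A"
    then have "(\<lambda>n. f (A n)) sums f (\<Union>n. A n)" by (rule signed_measure_sums[OF m])
    then show "(\<Sum>i. ennreal (f (A i))) = ennreal (f (\<Union>i. A i))"
      by (rule suminf_ennreal_eq[OF nn])
  qed
qed

lemma finite_measure_to_measure:
  assumes "signed_measure X f" "\<And>A. 0 \<le> f A"
  shows "finite_measure (to_measure X f)"
  using emeasure_to_measure[OF assms borel_sets_top] by (intro finite_measureI) simp

lemma measure_to_measure:
  assumes "signed_measure X f" "\<And>A. 0 \<le> f A" "A \<in> borel_sets X"
  shows "measure (to_measure X f) A = f A"
  using emeasure_to_measure[OF assms] assms(2) by (simp add: measure_def)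

lemma signed_integral_eq:
  "signed_integral X \<mu> f = integral\<^sup>L (to_measure X (pos_part X \<mu>)) f - integral\<^sup>L (to_measure X (neg_part X \<mu>)) f"
  by (simp add: signed_integral_def to_measure_def)

section \<open>Compact zero-dimensional spaces\<close>

definition clopens :: "'a topology \<Rightarrow> 'a set set" where
  "clopens X = {C. openin X C \<and> closedin X C}"

lemma algebra_clopens: "algebra (topspace X) (clopens X)"
  unfolding algebra_iff_Un
  by (auto simp: clopens_def dest: openin_subset intro: openin_diff closedin_diff)

lemma clopens_borel: "C \<in> clopens X \<Longrightarrow> C \<in> borel_sets X"
  by (simp add: clopens_def openin_borel)

lemma clopens_closedin: "C \<in> clopens X \<Longrightarrow> closedin X C"
  and clopens_openin: "C \<in> clopens X \<Longrightarrow> openin X C"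
  and clopens_top: "topspace X \<in> clopens X"
  and clopens_empty: "{} \<in> clopens X"
  and clopens_diff: "C \<in> clopens X \<Longrightarrow> D \<in> clopens X \<Longrightarrow> C - D \<in> clopens X"
  and clopens_Un: "C \<in> clopens X \<Longrightarrow> D \<in> clopens X \<Longrightarrow> C \<union> D \<in> clopens X"
  and clopens_Int: "C \<in> clopens X \<Longrightarrow> D \<in> clopens X \<Longrightarrow> C \<inter> D \<in> clopens X"
  by (auto simp: clopens_def)

lemma clopens_subset: "C \<in> clopens X \<Longrightarrow> C \<subseteq> topspace X"
  using clopens_openin openin_subset by blast

lemma closedin_UN_lessThan:
  assumes "\<And>n. closedin X (C n)" shows "closedin X (\<Union>i<(n::nat). C i)"
  using assms by (intro closedin_Union) auto

text \<open>Every space of countable rank is of this kind. Countability of the clopen algebra makes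
  the clopen sets generate the Borel sets, allows diagonal subsequences, and lets a measure be coded
  by a set of natural numbers.\<close>

locale boolean_space =
  fixes X :: "'a topology"
  assumes compact: "compact_space X"
    and countable_clopens: "countable (clopens X)"
    and clopen_base: "openin X U \<Longrightarrow> x \<in> U \<Longrightarrow> \<exists>C\<in>clopens X. x \<in> C \<and> C \<subseteq> U"
begin

lemma borel_sets_eq: "borel_sets X = sigma_sets (topspace X) (clopens X)"
proof
  show "sigma_sets (topspace X) (clopens X) \<subseteq> borel_sets X"
    unfolding borel_sets_def by (rule sigma_sets_mono') (auto simp: clopens_def)
  have "U \<in> sigma_sets (topspace X) (clopens X)" if U: "openin X U" for U
  proof -
    have "U = \<Union>{C\<in>clopens X. C \<subseteq> U}" using clopen_base[OF U] by blast
    moreover have "countable {C\<in>clopens X. C \<subseteq> U}" using countable_clopens by (rule countable_subset[rotated]) auto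
    ultimately show ?thesis
      by (metis (no_types, lifting) mem_Collect_eq sigma_sets.Basic sigma_sets_UNION)
  qed
  then show "borel_sets X \<subseteq> sigma_sets (topspace X) (clopens X)"
    unfolding borel_sets_def by (intro sigma_sets_mono) auto
qed

text \<open>Inner and outer approximation are proved together so that the claim is symmetric under
  complements, which makes the induction over the generated sigma-algebra possible.\<close>

lemma signed_measure_regular:
  assumes m: "signed_measure X \<mu>" and A: "A \<in> borel_sets X" and "\<epsilon> > 0"
  shows "\<exists>C U. closedin X C \<and> openin X U \<and> C \<subseteq> A \<and> A \<subseteq> U \<and> variation X \<mu> (U - C) < \<epsilon>"
  using A[unfolded borel_sets_eq] \<open>\<epsilon> > 0\<close>
proof (induction A arbitrary: \<epsilon> rule: sigma_sets.induct)
  case (Basic A)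
  then show ?case using signed_measure_empty[OF signed_measure_variation[OF m]]
    by (intro exI[of _ A]) (auto simp: clopens_def)
next
  case Empty
  then show ?case using signed_measure_empty[OF signed_measure_variation[OF m]]
    by (intro exI[of _ "{}"]) auto
next
  case (Compl A)
  obtain C U where CU: "closedin X C" "openin X U" "C \<subseteq> A" "A \<subseteq> U" "variation X \<mu> (U - C) < \<epsilon>"
    using Compl.IH[OF Compl.prems] by blast
  moreover have "topspace X - C - (topspace X - U) = U - C" using openin_subset[OF CU(2)] by blast
  ultimately show ?case
    by (intro exI[of _ "topspace X - U"] exI[of _ "topspace X - C"]) (auto intro: openin_diff closedin_diff)
next
  case (Union A)
  let ?M = "to_measure X (variation X \<mu>)"
  note v = signed_measure_variation[OF m] variation_nonneg[OF m]
  interpret finite_measure ?M by (rule finite_measure_to_measure[OF v])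
  have M: "B \<in> borel_sets X \<Longrightarrow> measure ?M B = variation X \<mu> B" for B by (rule measure_to_measure[OF v])
  \<comment> \<open>These errors add up to \<open>\<epsilon> / 2\<close>; the other half pays for
    replacing the infinite union \<open>D\<close> of closed sets by the finite union
    \<open>Cn n\<close>, which is still closed.\<close>
  define e where "e i = \<epsilon> / 4 * (1/2)^i" for i :: nat
  have e: "e sums (\<epsilon> / 2)"
    using sums_mult[OF geometric_sums[of "1/2::real"], of "\<epsilon>/4"] by (simp add: e_def[abs_def])
  have "e i > 0" for i using Union by (simp add: e_def)
  then have "\<exists>C U. closedin X C \<and> openin X U \<and> C \<subseteq> A i \<and> A i \<subseteq> U \<and> variation X \<mu> (U - C) < e i" for i
    using Union.IH by blast
  then obtain C U where CU: "closedin X (C i)" "openin X (U i)" "C i \<subseteq> A i" "A i \<subseteq> U i"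
      "variation X \<mu> (U i - C i) < e i" for i :: nat
    by metis
  have Cb: "C i \<in> borel_sets X" and Ub: "U i \<in> borel_sets X" for i
    by (rule closedin_borel[OF CU(1)] openin_borel[OF CU(2)])+
  have UCb: "U i - C i \<in> borel_sets X" for i using Cb Ub borel_sets_diff by blast
  define D where "D = (\<Union>i. C i)"
  have Db: "D \<in> borel_sets X" unfolding D_def using Cb by (intro borel_sets_UN) auto
  define Cn where "Cn n = (\<Union>i<n. C i)" for n :: nat
  have Cnc: "closedin X (Cn n)" for n unfolding Cn_def using CU(1) by (rule closedin_UN_lessThan)
  have Cnb: "Cn n \<in> borel_sets X" for n using Cnc by (rule closedin_borel)
  have lim: "(\<lambda>n. measure ?M (D - Cn n)) \<longlonglongrightarrow> measure ?M (\<Inter>n. D - Cn n)"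
  proof (rule finite_Lim_measure_decseq)
    show "range (\<lambda>n. D - Cn n) \<subseteq> sets ?M" using Db Cnb borel_sets_diff by auto
    show "decseq (\<lambda>n. D - Cn n)" by (rule decseq_SucI) (auto simp: Cn_def)
  qed
  have "(\<Inter>n. D - Cn n) = {}" by (auto simp: D_def Cn_def)
  from lim[unfolded this] have "(\<lambda>n. measure ?M (D - Cn n)) \<longlonglongrightarrow> 0" by simp
  then have "eventually (\<lambda>n. measure ?M (D - Cn n) < \<epsilon> / 2) sequentially"
    using Union.prems by (intro order_tendstoD) auto
  then obtain n where n: "measure ?M (D - Cn n) < \<epsilon> / 2" by (auto simp: eventually_sequentially)
  have le: "measure ?M (U i - C i) \<le> e i" for i using CU(5)[of i] M[OF UCb] by simp
  have sm: "summable (\<lambda>i. measure ?M (U i - C i))"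
  proof (rule summable_comparison_test'[OF sums_summable[OF e], of 0])
    show "norm (measure ?M (U i - C i)) \<le> e i" for i using le[of i] by simp
  qed
  have "measure ?M (\<Union>i. U i - C i) \<le> (\<Sum>i. measure ?M (U i - C i))"
    using UCb sm by (intro finite_measure_subadditive_countably) auto
  also have "\<dots> \<le> (\<Sum>i. e i)" by (rule suminf_le[OF le sm sums_summable[OF e]])
  also have "\<dots> = \<epsilon> / 2" using e by (rule sums_unique[symmetric])
  finally have h: "measure ?M (\<Union>i. U i - C i) \<le> \<epsilon> / 2" .
  have Uo: "openin X (\<Union>i. U i)" using CU(2) by blast
  have Bb: "(\<Union>i. U i - C i) \<in> borel_sets X" "D - Cn n \<in> borel_sets X"
    using UCb Db Cnb[of n] by (auto intro: borel_sets_UN borel_sets_diff)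
  have "measure ?M ((\<Union>i. U i) - Cn n) \<le> measure ?M ((\<Union>i. U i - C i) \<union> (D - Cn n))"
    using Bb borel_sets_Un[OF Bb] by (intro finite_measure_mono) (auto simp: D_def)
  also have "\<dots> \<le> measure ?M (\<Union>i. U i - C i) + measure ?M (D - Cn n)"
    using Bb by (intro measure_Un_le) auto
  also have "\<dots> < \<epsilon>" using n h by simp
  finally have "variation X \<mu> ((\<Union>i. U i) - Cn n) < \<epsilon>"
    by (simp add: M[OF borel_sets_diff[OF openin_borel[OF Uo] Cnb]])
  moreover have "Cn n \<subseteq> (\<Union>i. A i)" using CU(3) unfolding Cn_def by blast
  moreover have "(\<Union>i. A i) \<subseteq> (\<Union>i. U i)" using CU(4) by blast
  ultimately show ?case using Cnc Uo by (intro exI[of _ "Cn n"] exI[of _ "\<Union>i. U i"] conjI)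
qed

lemma signed_measure_radon:
  assumes m: "signed_measure X \<mu>"
  shows "\<mu> \<in> radon_measures X"
proof -
  have "\<exists>C\<in>borel_sets X. compactin X C \<and> C \<subseteq> A \<and> variation X \<mu> (A - C) < \<epsilon>"
    if A: "A \<in> borel_sets X" "\<epsilon> > 0" for A \<epsilon>
  proof -
    obtain C U where CU: "closedin X C" "openin X U" "C \<subseteq> A" "A \<subseteq> U" "variation X \<mu> (U - C) < \<epsilon>"
      using signed_measure_regular[OF m A] by blast
    have "variation X \<mu> (A - C) \<le> variation X \<mu> (U - C)"
      using CU A closedin_borel[OF CU(1)] openin_borel[OF CU(2)]
      by (intro variation_mono[OF m] borel_sets_diff) auto
    then show ?thesis using CU closedin_borel closedin_compact_space[OF compact] by (intro bexI[of _ C]) auto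
  qed
  then show ?thesis using m unfolding radon_measures_def signed_measure_def by blast
qed

lemma radon_iff: "\<mu> \<in> radon_measures X \<longleftrightarrow> signed_measure X \<mu>"
  using signed_measure_radon radon_imp_signed by blast

text \<open>The clopen sets generate the Borel sets and are stable under intersection, so Dynkin's
  argument applies. A measure is thus given by countably many reals.\<close>

lemma signed_measure_eqI:
  assumes m: "signed_measure X \<mu>" "signed_measure X \<nu>" and eq: "\<And>C. C \<in> clopens X \<Longrightarrow> \<mu> C = \<nu> C"
  shows "\<mu> = \<nu>"
proof
  fix A
  show "\<mu> A = \<nu> A"
  proof (cases "A \<in> borel_sets X")
    case True
    have "Int_stable (clopens X)" by (auto simp: Int_stable_def clopens_Int)
    moreover have "clopens X \<subseteq> Pow (topspace X)" using clopens_subset by blast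
    ultimately show ?thesis using True[unfolded borel_sets_eq]
    proof (induction A rule: sigma_sets_induct_disjoint)
      case (basic A) then show ?case by (rule eq)
    next
      case empty then show ?case using m by (simp add: signed_measure_empty)
    next
      case (compl A)
      then have A: "A \<in> borel_sets X" by (simp add: borel_sets_eq)
      have "\<rho> (topspace X - A) = \<rho> (topspace X) - \<rho> A" if "signed_measure X \<rho>" for \<rho>
        using charge.diff[OF signed_measure_charge[OF that] borel_sets_top A borel_sets_subset[OF A]] .
      from this[OF m(1)] this[OF m(2)] show ?case using compl.IH eq[OF clopens_top] by simp
    next
      case (union A)
      then have A: "range A \<subseteq> borel_sets X" "disjoint_family A" by (simp_all only: borel_sets_eq)
      show ?case
        using signed_measure_sums[OF m(1) A] signed_measure_sums[OF m(2) A] sums_unique2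
        unfolding union.IH by blast
    qed
  next
    case False
    then show ?thesis using m[THEN signed_measure_null] by simp
  qed
qed

end

section \<open>Push-forwards, Dirac measures and integrals of continuous functions\<close>

lemma borel_preimage:
  assumes f: "continuous_map X Y f" and B: "B \<in> borel_sets Y"
  shows "{x \<in> topspace X. f x \<in> B} \<in> borel_sets X"
proof -
  interpret sigma_algebra "topspace X" "borel_sets X" by (rule sigma_algebra_borel_sets)
  have ft: "x \<in> topspace X \<Longrightarrow> f x \<in> topspace Y" for x
    using continuous_map_image_subset_topspace[OF f] by blast
  show ?thesis using B unfolding borel_sets_def[of Y]
  proof (induction B rule: sigma_sets.induct)
    case (Basic B)
    then show ?case using openin_continuous_map_preimage[OF f] openin_borel by blast
  next
    case (Compl B)
    have "{x \<in> topspace X. f x \<in> topspace Y - B} = topspace X - {x \<in> topspace X. f x \<in> B}"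
      using ft by blast
    then show ?case using Compl.IH borel_sets_diff[OF borel_sets_top] by simp
  next
    case (Union B)
    have "{x \<in> topspace X. f x \<in> \<Union>(range B)} = (\<Union>i. {x \<in> topspace X. f x \<in> B i})" by blast
    moreover have "(\<Union>i. {x \<in> topspace X. f x \<in> B i}) \<in> borel_sets X"
      using Union.IH by (intro borel_sets_UN) blast
    ultimately show ?case by simp
  next
    case Empty
    show ?case using borel_sets_empty by simp
  qed
qed

lemma signed_measure_push_forward:
  assumes f: "continuous_map X Y f" and m: "signed_measure X \<mu>"
  shows "signed_measure Y (push_forward X Y f \<mu>)"
proof (rule signed_measureI)
  fix A :: "nat \<Rightarrow> _" assume A: "range A \<subseteq> borel_sets Y" "disjoint_family A"
  have "(\<lambda>n. \<mu> {x \<in> topspace X. f x \<in> A n}) sums \<mu> (\<Union>n. {x \<in> topspace X. f x \<in> A n})"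
  proof (rule signed_measure_sums[OF m])
    show "range (\<lambda>n. {x \<in> topspace X. f x \<in> A n}) \<subseteq> borel_sets X" using A borel_preimage[OF f] by blast
    show "disjoint_family (\<lambda>n. {x \<in> topspace X. f x \<in> A n})"
      using A(2) unfolding disjoint_family_on_def by blast
  qed
  moreover have "(\<Union>n. {x \<in> topspace X. f x \<in> A n}) = {x \<in> topspace X. f x \<in> (\<Union>n. A n)}" by blast
  moreover have "A n \<in> borel_sets Y" for n using A by blast
  moreover have "(\<Union>n. A n) \<in> borel_sets Y" using A(1) by (rule borel_sets_UN)
  ultimately show "(\<lambda>n. push_forward X Y f \<mu> (A n)) sums push_forward X Y f \<mu> (\<Union>n. A n)"
    by (simp add: push_forward_def)
qed (simp add: push_forward_def)

lemma variation_push_forward: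
  assumes f: "continuous_map X Y f" and m: "signed_measure X \<mu>" and B: "B \<in> borel_sets Y"
  shows "variation Y (push_forward X Y f \<mu>) B \<le> variation X \<mu> {x \<in> topspace X. f x \<in> B}"
proof -
  let ?A = "{x \<in> topspace X. f x \<in> B}"
  have A: "?A \<in> borel_sets X" by (rule borel_preimage[OF f B])
  have p: "pos_part Y (push_forward X Y f \<mu>) B \<le> pos_part X \<mu> ?A" if m: "signed_measure X \<mu>" for \<mu>
    unfolding pos_part_eq[OF A] pos_part_eq[OF B]
  proof (rule charge.upper_le[OF signed_measure_charge[OF signed_measure_push_forward[OF f m]]])
    fix E assume E: "E \<in> borel_sets Y" "E \<subseteq> B"
    then have "push_forward X Y f \<mu> E = \<mu> {x \<in> topspace X. f x \<in> E}" by (simp add: push_forward_def)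
    also have "\<dots> \<le> upper_part (borel_sets X) \<mu> ?A"
      using E by (intro charge.le_upper[OF signed_measure_charge[OF m]] borel_preimage[OF f]) auto
    finally show "push_forward X Y f \<mu> E \<le> upper_part (borel_sets X) \<mu> ?A" .
  qed
  have "push_forward X Y f (\<lambda>A. - \<mu> A) = (\<lambda>A. - push_forward X Y f \<mu> A)"
    by (auto simp: push_forward_def)
  then show ?thesis
    using p[OF m] p[OF signed_measure_uminus[OF m]]
    by (simp add: variation_eq[OF m] variation_eq[OF signed_measure_push_forward[OF f m]] neg_part_def)
qed

lemma push_forward_compose:
  assumes f: "continuous_map X Y f" and g: "continuous_map Y Z g"
  shows "push_forward Y Z g (push_forward X Y f \<mu>) = push_forward X Z (g \<circ> f) \<mu>"
proof
  fix A
  have "f x \<in> topspace Y" if "x \<in> topspace X" for x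
    using continuous_map_image_subset_topspace[OF f] that by blast
  then have "{x \<in> topspace X. f x \<in> {y \<in> topspace Y. g y \<in> A}} = {x \<in> topspace X. (g \<circ> f) x \<in> A}"
    by auto
  then show "push_forward Y Z g (push_forward X Y f \<mu>) A = push_forward X Z (g \<circ> f) \<mu> A"
    using borel_preimage[OF g, of A] by (simp add: push_forward_def)
qed

lemma push_forward_cong:
  "(\<And>x. x \<in> topspace X \<Longrightarrow> f x = g x) \<Longrightarrow> push_forward X Y f \<mu> = push_forward X Y g \<mu>"
  unfolding push_forward_def by (intro ext) (metis (no_types, lifting) Collect_cong)

definition dirac :: "'a topology \<Rightarrow> 'a \<Rightarrow> 'a set \<Rightarrow> real" where
  "dirac X x A = (if A \<in> borel_sets X \<and> x \<in> A then 1 else 0)"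

lemma signed_measure_dirac: "signed_measure X (dirac X x)"
proof (rule signed_measureI)
  fix A :: "nat \<Rightarrow> _" assume A: "range A \<subseteq> borel_sets X" "disjoint_family A"
  then have b: "A n \<in> borel_sets X" for n by auto
  show "(\<lambda>n. dirac X x (A n)) sums dirac X x (\<Union>n. A n)"
  proof (cases "\<exists>n. x \<in> A n")
    case True
    then obtain n where n: "x \<in> A n" by blast
    have "x \<in> A m \<longleftrightarrow> m = n" for m
      using disjoint_family_onD[OF A(2), of m n] n by blast
    then have "dirac X x (A m) = (if m = n then 1 else 0)" for m using b by (simp add: dirac_def)
    moreover have "dirac X x (\<Union>n. A n) = 1" using True borel_sets_UN[OF A(1)] by (auto simp: dirac_def)
    ultimately show ?thesis using sums_single[of n "\<lambda>_. 1::real"] by simp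
  next
    case False
    then show ?thesis by (simp add: dirac_def)
  qed
qed (simp add: dirac_def)

lemma dirac_eq: "A \<in> borel_sets X \<Longrightarrow> dirac X x A = (if x \<in> A then 1 else 0)"
  by (simp add: dirac_def)

lemma variation_nonneg_measure:
  assumes m: "signed_measure X \<mu>" and nn: "\<And>A. 0 \<le> \<mu> A"
  shows "variation X \<mu> = \<mu>" and "pos_part X \<mu> = \<mu>"
proof -
  have p: "pos_part X \<mu> A = \<mu> A" for A
  proof (cases "A \<in> borel_sets X")
    case True
    have "\<mu> B \<le> \<mu> A" if "B \<in> borel_sets X" "B \<subseteq> A" for B
      using charge.diff[OF signed_measure_charge[OF m] True that] nn[of "A - B"] by simp
    then have "upper_part (borel_sets X) \<mu> A \<le> \<mu> A"
      by (rule charge.upper_le[OF signed_measure_charge[OF m]])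
    moreover have "\<mu> A \<le> upper_part (borel_sets X) \<mu> A"
      using True by (intro charge.le_upper[OF signed_measure_charge[OF m]]) auto
    ultimately show ?thesis by (simp add: pos_part_eq[OF True])
  next
    case False
    then show ?thesis using signed_measure_null[OF m] by (simp add: pos_part_def)
  qed
  then show "pos_part X \<mu> = \<mu>" by blast
  show "variation X \<mu> = \<mu>"
    using p by (intro ext) (simp add: variation_eq[OF m] neg_part_eq[OF m])
qed

lemma dirac_nonneg: "0 \<le> dirac X x A"
  by (simp add: dirac_def)

lemma variation_dirac: "variation X (dirac X x) = dirac X x"
  and pos_part_dirac: "pos_part X (dirac X x) = dirac X x"
  by (rule variation_nonneg_measure[OF signed_measure_dirac dirac_nonneg])+

lemma tv_norm_dirac: "x \<in> topspace X \<Longrightarrow> tv_norm X (dirac X x) = 1"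
  by (simp add: tv_norm_def variation_dirac dirac_eq borel_sets_top)

lemma push_forward_dirac:
  assumes "continuous_map X Y f" "x \<in> topspace X"
  shows "push_forward X Y f (dirac X x) = dirac Y (f x)"
  using borel_preimage[OF assms(1)] assms(2) by (auto simp: push_forward_def dirac_def)

lemma continuous_measurable:
  assumes f: "continuous_map X euclideanreal f"
  shows "f \<in> borel_measurable (to_measure X g)"
proof (rule borel_measurableI)
  fix S :: "real set" assume "open S"
  then have "openin X {x \<in> topspace X. f x \<in> S}"
    using f by (intro openin_continuous_map_preimage) auto
  moreover have "f -` S \<inter> space (to_measure X g) = {x \<in> topspace X. f x \<in> S}" by auto
  ultimately show "f -` S \<inter> space (to_measure X g) \<in> sets (to_measure X g)"
    by (simp add: openin_borel)
qed

lemma continuous_integrable: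
  assumes X: "compact_space X" and f: "continuous_map X euclideanreal f"
    and m: "signed_measure X \<mu>" "\<And>A. 0 \<le> \<mu> A"
  shows "integrable (to_measure X \<mu>) f"
proof -
  have "compact (f ` topspace X)"
    using image_compactin[of X "topspace X" euclideanreal f] X f by (simp add: compact_space_def)
  then obtain K where K: "\<And>x. x \<in> topspace X \<Longrightarrow> norm (f x) \<le> K"
    using compact_imp_bounded bounded_iff by (metis imageI)
  interpret finite_measure "to_measure X \<mu>" using m by (rule finite_measure_to_measure)
  show ?thesis
    using K by (intro integrable_const_bound[where B=K] continuous_measurable[OF f] AE_I2) simp
qed

lemma continuous_indicator:
  assumes C: "C \<in> clopens X"
  shows "continuous_map X euclideanreal (indicator C)"
proof -
  have "openin X {x \<in> topspace X. indicator C x \<in> U}" for U :: "real set"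
  proof -
    have "{x \<in> topspace X. indicator C x \<in> U} =
      (if 1 \<in> U then C else {}) \<union> (if 0 \<in> U then topspace X - C else {})"
      using clopens_subset[OF C] by (auto simp: indicator_def)
    then show ?thesis using C by (auto simp: clopens_def)
  qed
  then show ?thesis by (simp add: continuous_map)
qed

text \<open>Stated for the addition of one multiple of an indicator because step functions are built
  up in this way in \<open>clopen_step_approximation\<close>.\<close>

lemma signed_integral_indicator_add:
  assumes X: "compact_space X" and f: "continuous_map X euclideanreal f"
    and m: "signed_measure X \<mu>" and C: "C \<in> clopens X"
  shows "signed_integral X \<mu> (\<lambda>x. f x + c * indicator C x) = signed_integral X \<mu> f + c * \<mu> C"
proof -
  have *: "integral\<^sup>L (to_measure X \<nu>) (\<lambda>x. f x + c * indicator C x) = integral\<^sup>L (to_measure X \<nu>) f + c * \<nu> C"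
    if n: "signed_measure X \<nu>" "\<And>A. 0 \<le> \<nu> A" for \<nu>
  proof -
    have i: "integrable (to_measure X \<nu>) f" "integrable (to_measure X \<nu>) (indicator C :: _ \<Rightarrow> real)"
      using continuous_integrable[OF X f n] continuous_integrable[OF X continuous_indicator[OF C] n] by auto
    have "C \<inter> topspace X = C" using clopens_subset[OF C] by blast
    then have "integral\<^sup>L (to_measure X \<nu>) (indicator C) = \<nu> C"
      using measure_to_measure[OF n clopens_borel[OF C]] by simp
    then show ?thesis using i by simp
  qed
  show ?thesis
    unfolding signed_integral_eq
    using *[OF signed_measure_pos_part[OF m] pos_part_nonneg[OF m]]
      *[OF signed_measure_neg_part[OF m] neg_part_nonneg[OF m]] neg_part_eq[OF m, of C]
    by (simp add: algebra_simps)
qed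

lemma signed_integral_indicator:
  assumes X: "compact_space X" and m: "signed_measure X \<mu>" and C: "C \<in> clopens X"
  shows "signed_integral X \<mu> (indicator C) = \<mu> C"
  using signed_integral_indicator_add[OF X _ m C, of "\<lambda>_. 0" 1]
  by (simp add: signed_integral_eq)

lemma signed_integral_bound:
  assumes X: "compact_space X" and f: "continuous_map X euclideanreal f"
    and g: "continuous_map X euclideanreal g"
    and m: "signed_measure X \<mu>" and e: "\<And>x. x \<in> topspace X \<Longrightarrow> \<bar>f x - g x\<bar> \<le> \<epsilon>"
  shows "\<bar>signed_integral X \<mu> f - signed_integral X \<mu> g\<bar> \<le> \<epsilon> * tv_norm X \<mu>"
proof -
  have *: "\<bar>integral\<^sup>L (to_measure X \<nu>) f - integral\<^sup>L (to_measure X \<nu>) g\<bar> \<le> \<epsilon> * \<nu> (topspace X)"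
    if n: "signed_measure X \<nu>" "\<And>A. 0 \<le> \<nu> A" for \<nu>
  proof -
    interpret finite_measure "to_measure X \<nu>" using n by (rule finite_measure_to_measure)
    have i: "integrable (to_measure X \<nu>) f" "integrable (to_measure X \<nu>) g"
      using continuous_integrable[OF X _ n] f g by auto
    then have "\<bar>integral\<^sup>L (to_measure X \<nu>) f - integral\<^sup>L (to_measure X \<nu>) g\<bar>
        = \<bar>\<integral>x. f x - g x \<partial>to_measure X \<nu>\<bar>" by simp
    also have "\<dots> \<le> (\<integral>x. \<bar>f x - g x\<bar> \<partial>to_measure X \<nu>)" by (rule integral_abs_bound)
    also have "\<dots> \<le> (\<integral>x. \<epsilon> \<partial>to_measure X \<nu>)" using i e by (intro integral_mono) auto
    also have "\<dots> = \<epsilon> * \<nu> (topspace X)"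
      using measure_to_measure[OF n borel_sets_top] by simp
    finally show ?thesis .
  qed
  show ?thesis
    unfolding signed_integral_eq tv_norm_def variation_eq[OF m]
    using *[OF signed_measure_pos_part[OF m] pos_part_nonneg[OF m]]
      *[OF signed_measure_neg_part[OF m] neg_part_nonneg[OF m]]
    by (simp add: algebra_simps)
qed

section \<open>From convergence on clopen sets to weak-star limits\<close>

context boolean_space
begin

lemma decreasing_clopens_empty:
  assumes A: "range A \<subseteq> clopens X" "decseq A" "(\<Inter>i. A i) = {}"
  shows "\<exists>n::nat. A n = {}"
proof (rule ccontr)
  assume "\<nexists>n. A n = {}"
  moreover have "closedin X (A n)" for n using A(1) clopens_closedin by blast
  ultimately show False using compact_space_imp_nest[OF compact _ _ A(2)] A(3) by blast
qed

text \<open>By compactness a decreasing sequence of clopen sets with empty intersection is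
  eventually empty. Continuity at the empty set is then automatic, and Caratheodory's theorem
  applies.\<close>

lemma extend_nonneg_charge:
  assumes c: "charge (topspace X) (clopens X) c" and nn: "\<And>A. A \<in> clopens X \<Longrightarrow> 0 \<le> c A"
  shows "\<exists>\<nu>. signed_measure X \<nu> \<and> (\<forall>A. 0 \<le> \<nu> A) \<and> (\<forall>A\<in>clopens X. \<nu> A = c A)"
proof -
  interpret charge "topspace X" "clopens X" c by (rule c)
  have "\<exists>\<mu> :: 'a set \<Rightarrow> ennreal. (\<forall>s\<in>clopens X. \<mu> s = ennreal (c s)) \<and>
      measure_space (topspace X) (sigma_sets (topspace X) (clopens X)) \<mu>"
  proof (rule caratheodory_empty_continuous)
    show "positive (clopens X) (\<lambda>s. ennreal (c s))" by (simp add: positive_def empty)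
    show "additive (clopens X) (\<lambda>s. ennreal (c s))"
      using additive nn by (auto simp: additive_def)
    show "ennreal (c A) \<noteq> \<infinity>" for A by simp
    fix A :: "nat \<Rightarrow> 'a set" assume A: "range A \<subseteq> clopens X" "decseq A" "(\<Inter>i. A i) = {}"
    then obtain n where n: "A n = {}" using decreasing_clopens_empty by blast
    have "ennreal (c (A i)) = 0" if "i \<ge> n" for i
      using decseqD[OF A(2) that] n by (simp add: empty)
    then show "(\<lambda>i. ennreal (c (A i))) \<longlonglongrightarrow> 0"
      by (intro tendsto_eventually) (auto simp: eventually_sequentially)
  qed
  then obtain \<mu> :: "'a set \<Rightarrow> ennreal" where \<mu>: "\<And>s. s \<in> clopens X \<Longrightarrow> \<mu> s = ennreal (c s)"
      and ms: "measure_space (topspace X) (borel_sets X) \<mu>"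
    unfolding borel_sets_eq by blast
  define M where "M = measure_of (topspace X) (borel_sets X) \<mu>"
  have space: "space M = topspace X" and sets: "sets M = borel_sets X"
    unfolding M_def
    by (rule space_measure_of_conv, rule sigma_algebra.sets_measure_of_eq[OF sigma_algebra_borel_sets])
  have em: "emeasure M A = \<mu> A" if "A \<in> borel_sets X" for A
    using ms that unfolding M_def measure_space_def by (intro emeasure_measure_of_sigma) auto
  interpret M: finite_measure M
    using em[OF borel_sets_top] \<mu>[OF clopens_top] space by (intro finite_measureI) simp
  have "signed_measure X (measure M)"
    by (rule signed_measureI) (simp_all add: measure_notin_sets sets M.finite_measure_UNION)
  moreover have "measure M A = c A" if "A \<in> clopens X" for A
    using em[OF clopens_borel[OF that]] \<mu>[OF that] nn[OF that] by (simp add: measure_def)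
  ultimately show ?thesis using measure_nonneg by blast
qed

text \<open>The Jordan decomposition is carried out inside the clopen algebra, and its two
  nonnegative parts are extended separately.\<close>

lemma extend_charge:
  assumes c: "charge (topspace X) (clopens X) c"
  shows "\<exists>\<mu>. signed_measure X \<mu> \<and> (\<forall>A\<in>clopens X. \<mu> A = c A)"
proof -
  interpret charge "topspace X" "clopens X" c by (rule c)
  let ?p = "upper_part (clopens X) c"
  have up: "charge (topspace X) (clopens X) (upper_part (clopens X) c)" if "charge (topspace X) (clopens X) c" for c
  proof -
    interpret charge "topspace X" "clopens X" c by (rule that)
    have "\<bar>upper_part (clopens X) c A\<bar> \<le> upper_part (clopens X) c (topspace X)" if "A \<in> clopens X" for A
      using upper_nonneg[of A] upper_mono[OF clopens_subset[OF that]] by simp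
    then show "charge (topspace X) (clopens X) (upper_part (clopens X) c)"
      by unfold_locales (auto simp: upper_additive)
  qed
  let ?n = "upper_part (clopens X) (\<lambda>A. - c A)"
  obtain \<nu> where \<nu>: "signed_measure X \<nu>" "\<And>A. A \<in> clopens X \<Longrightarrow> \<nu> A = ?p A"
    using extend_nonneg_charge[OF up[OF c]] upper_nonneg by blast
  obtain \<nu>' where \<nu>': "signed_measure X \<nu>'" "\<And>A. A \<in> clopens X \<Longrightarrow> \<nu>' A = ?n A"
    using extend_nonneg_charge[OF up[OF uminus]] charge.upper_nonneg[OF uminus] by blast
  have "\<nu> A - \<nu>' A = c A" if "A \<in> clopens X" for A
    using \<nu>(2)[OF that] \<nu>'(2)[OF that] upper_minus[OF that] by simp
  then show ?thesis using signed_measure_diff[OF \<nu>(1) \<nu>'(1)] by blast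
qed

text \<open>The predicate \<open>conv\<close> replaces an explicit representation of step functions:
  whatever holds of 0 and survives adding a multiple of a clopen indicator holds of some uniform
  approximation of \<open>f\<close>. Clopen sets on which \<open>f\<close> is nearly constant cover
  the space, and finitely many suffice.\<close>

lemma clopen_step_approximation:
  fixes f :: "'a \<Rightarrow> real" and conv :: "('a \<Rightarrow> real) \<Rightarrow> bool"
  assumes conv0: "conv (\<lambda>_. 0)"
    and conv_add: "\<And>g c C. continuous_map X euclideanreal g \<Longrightarrow> conv g \<Longrightarrow> C \<in> clopens X \<Longrightarrow>
      conv (\<lambda>x. g x + c * indicator C x)"
    and f: "continuous_map X euclideanreal f" and \<epsilon>: "\<epsilon> > 0"
  shows "\<exists>g. continuous_map X euclideanreal g \<and> conv g \<and> (\<forall>x\<in>topspace X. \<bar>f x - g x\<bar> \<le> \<epsilon>)"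
proof -
  define small where "small = {C \<in> clopens X. \<exists>r. \<forall>x\<in>C. \<bar>f x - r\<bar> \<le> \<epsilon>}"
  \<comment> \<open>That \<open>g\<close> vanishes off the sets treated so far is carried along,
    because the next set \<open>C\<close> then needs only its constant added on the uncovered part
    of \<open>C\<close>.\<close>
  have step: "\<exists>g. continuous_map X euclideanreal g \<and> conv g \<and> (\<forall>x\<in>\<Union>\<C>. \<bar>f x - g x\<bar> \<le> \<epsilon>) \<and>
      (\<forall>x\<in>topspace X - \<Union>\<C>. g x = 0)" if "finite \<C>" "\<C> \<subseteq> small" for \<C>
    using that
  proof (induction \<C> rule: finite_induct)
    case empty
    show ?case using conv0 by (intro exI[of _ "\<lambda>_. 0"]) auto
  next
    case (insert C \<C>)
    then have "\<C> \<subseteq> small" by blast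
    from insert.IH[OF this] obtain g where g: "continuous_map X euclideanreal g" "conv g"
      "\<And>x. x \<in> \<Union>\<C> \<Longrightarrow> \<bar>f x - g x\<bar> \<le> \<epsilon>" "\<And>x. x \<in> topspace X - \<Union>\<C> \<Longrightarrow> g x = 0" by blast
    obtain r where C: "C \<in> clopens X" and r: "\<And>x. x \<in> C \<Longrightarrow> \<bar>f x - r\<bar> \<le> \<epsilon>"
      using insert.prems by (auto simp: small_def)
    have un: "\<Union>\<C> \<in> clopens X"
      using insert.hyps(1) insert.prems unfolding small_def clopens_def
      by (auto intro!: openin_Union closedin_Union)
    have D: "C - \<Union>\<C> \<in> clopens X" using C un by (rule clopens_diff)
    let ?g = "\<lambda>x. g x + r * indicator (C - \<Union>\<C>) x"
    have "continuous_map X euclideanreal ?g"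
      using g(1) continuous_indicator[OF D]
      by (intro continuous_map_add continuous_map_real_mult_left) auto
    moreover have "conv ?g" using g D by (intro conv_add) auto
    moreover have "\<bar>f x - ?g x\<bar> \<le> \<epsilon>" if "x \<in> \<Union>(insert C \<C>)" for x
    proof (cases "x \<in> \<Union>\<C>")
      case True
      then show ?thesis using g(3)[of x] by (simp add: indicator_def)
    next
      case False
      then have "x \<in> C" using that by blast
      moreover have "g x = 0" using False clopens_subset[OF C] \<open>x \<in> C\<close> by (intro g(4)) blast
      ultimately show ?thesis using False r by (simp add: indicator_def)
    qed
    moreover have "?g x = 0" if "x \<in> topspace X - \<Union>(insert C \<C>)" for x
      using g(4)[of x] that by (auto simp: indicator_def)
    ultimately show ?case by blast
  qed
  have "topspace X \<subseteq> \<Union>small"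
  proof
    fix x assume x: "x \<in> topspace X"
    have "openin X {y \<in> topspace X. f y \<in> ball (f x) \<epsilon>}"
      using f by (intro openin_continuous_map_preimage) auto
    then obtain C where C: "C \<in> clopens X" "x \<in> C" "C \<subseteq> {y \<in> topspace X. f y \<in> ball (f x) \<epsilon>}"
      using clopen_base[of _ x] x \<epsilon> by force
    then have "C \<in> small" by (auto simp: small_def dist_real_def intro!: exI[of _ "f x"])
    then show "x \<in> \<Union>small" using C by blast
  qed
  moreover have "openin X C" if "C \<in> small" for C using that by (simp add: small_def clopens_def)
  ultimately obtain \<C> where \<C>: "finite \<C>" "\<C> \<subseteq> small" "topspace X \<subseteq> \<Union>\<C>"
    using compact unfolding compact_space_def by (meson compactinD)
  then show ?thesis using step[OF \<C>(1,2)] by blast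
qed

text \<open>The pointwise limits on clopen sets form a bounded finitely additive function, which
  extends to a measure. Since all norms are at most 1, uniform approximation by clopen step
  functions carries the convergence to all continuous functions.\<close>

lemma weak_star_exists:
  assumes F: "\<F> \<noteq> bot" and m: "\<And>n. signed_measure X (\<mu> n)" and b: "\<And>n. tv_norm X (\<mu> n) \<le> 1"
    and lim: "\<And>C. C \<in> clopens X \<Longrightarrow> \<exists>l. ((\<lambda>n. \<mu> n C) \<longlongrightarrow> l) \<F>"
  shows "\<exists>\<mu>'\<in>radon_measures X. weak_star_limit X \<mu> \<mu>' \<F>"
proof -
  define c where "c C = Lim \<F> (\<lambda>n. \<mu> n C)" for C
  have c: "((\<lambda>n. \<mu> n C) \<longlongrightarrow> c C) \<F>" if "C \<in> clopens X" for C
    using lim[OF that] tendsto_Lim[OF F] unfolding c_def by blast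
  interpret algebra "topspace X" "clopens X" by (rule algebra_clopens)
  have ch: "charge (topspace X) (clopens X) c"
  proof unfold_locales
    fix A B assume AB: "A \<in> clopens X" "B \<in> clopens X" "A \<inter> B = {}"
    have "((\<lambda>n. \<mu> n A + \<mu> n B) \<longlongrightarrow> c (A \<union> B)) \<F>"
      using c[OF Un[OF AB(1,2)]] signed_measure_additive[OF m clopens_borel clopens_borel] AB by simp
    then show "c (A \<union> B) = c A + c B"
      by (rule tendsto_unique[OF F _ tendsto_add[OF c[OF AB(1)] c[OF AB(2)]]])
  next
    have "\<bar>c A\<bar> \<le> 1" if A: "A \<in> clopens X" for A
    proof (rule tendsto_upperbound[OF tendsto_rabs[OF c[OF A]] always_eventually F])
      show "\<forall>n. \<bar>\<mu> n A\<bar> \<le> 1"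
        by (intro allI order_trans[OF order_trans[OF abs_le_variation[OF m] variation_le_tv[OF m]] b])
    qed
    then show "\<exists>K. \<forall>A\<in>clopens X. \<bar>c A\<bar> \<le> K" by blast
  qed
  obtain \<mu>' where m': "signed_measure X \<mu>'" and \<mu>': "\<And>A. A \<in> clopens X \<Longrightarrow> \<mu>' A = c A"
    using extend_charge[OF ch] by blast
  let ?K = "tv_norm X \<mu>'"
  have K: "0 \<le> ?K" unfolding tv_norm_def by (rule variation_nonneg[OF m'])
  have "weak_star_limit X \<mu> \<mu>' \<F>"
    unfolding weak_star_limit_def
  proof (intro allI impI tendstoI)
    fix f and e :: real assume f: "continuous_map X euclideanreal f" and e: "e > 0"
    let ?conv = "\<lambda>g. ((\<lambda>n. signed_integral X (\<mu> n) g) \<longlongrightarrow> signed_integral X \<mu>' g) \<F>"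
    \<comment> \<open>Replacing \<open>f\<close> by \<open>g\<close> costs at most
      \<open>\<epsilon>\<close> under \<open>\<mu> n\<close> and \<open>\<epsilon> * ?K\<close>
      under the limit, together \<open>e / 2\<close>.\<close>
    define \<epsilon> where "\<epsilon> = e / (2 * (1 + ?K))"
    have \<epsilon>: "\<epsilon> > 0" "\<epsilon> * (1 + ?K) = e / 2" using e K by (auto simp: \<epsilon>_def field_simps)
    have "?conv (\<lambda>x. g x + r * indicator C x)"
      if g: "continuous_map X euclideanreal g" "?conv g" and C: "C \<in> clopens X" for g r C
      using tendsto_add[OF g(2) tendsto_mult_left[OF c[OF C]], of r]
      by (simp add: signed_integral_indicator_add[OF compact g(1) m C]
          signed_integral_indicator_add[OF compact g(1) m' C] \<mu>'[OF C])
    moreover have "?conv (\<lambda>_. 0)" by (simp add: signed_integral_eq)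
    ultimately obtain g where g: "continuous_map X euclideanreal g" "?conv g"
      "\<And>x. x \<in> topspace X \<Longrightarrow> \<bar>f x - g x\<bar> \<le> \<epsilon>"
      using clopen_step_approximation[of ?conv, OF _ _ f \<epsilon>(1)] by blast
    have "eventually (\<lambda>n. dist (signed_integral X (\<mu> n) g) (signed_integral X \<mu>' g) < e / 2) \<F>"
      using g(2) e by (intro tendstoD) auto
    then show "eventually (\<lambda>n. dist (signed_integral X (\<mu> n) f) (signed_integral X \<mu>' f) < e) \<F>"
    proof eventually_elim
      case (elim n)
      have "\<bar>signed_integral X (\<mu> n) f - signed_integral X (\<mu> n) g\<bar> \<le> \<epsilon> * tv_norm X (\<mu> n)"
        by (rule signed_integral_bound[OF compact f g(1) m g(3)])
      also have "\<dots> \<le> \<epsilon> * 1" using b \<epsilon> by (intro mult_left_mono) auto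
      finally have 1: "\<bar>signed_integral X (\<mu> n) f - signed_integral X (\<mu> n) g\<bar> \<le> \<epsilon>" by simp
      have "\<bar>signed_integral X \<mu>' f - signed_integral X \<mu>' g\<bar> \<le> \<epsilon> * ?K"
        by (rule signed_integral_bound[OF compact f g(1) m' g(3)])
      moreover have "\<epsilon> + \<epsilon> * ?K = e / 2" using \<epsilon>(2) by (simp add: algebra_simps)
      ultimately show ?case using 1 elim unfolding dist_real_def by linarith
    qed
  qed
  then show ?thesis using signed_measure_radon[OF m'] by blast
qed

lemma weak_star_limit_clopen:
  assumes "weak_star_limit X \<mu> \<mu>' \<F>" "\<And>n. signed_measure X (\<mu> n)" "signed_measure X \<mu>'" "C \<in> clopens X"
  shows "((\<lambda>n. \<mu> n C) \<longlongrightarrow> \<mu>' C) \<F>"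
  using assms(1) continuous_indicator[OF assms(4)]
  unfolding weak_star_limit_def
  by (auto simp: signed_integral_indicator[OF compact _ assms(4)] assms(2,3) dest: spec[of _ "indicator C"])

end

lemma signed_measure_incseq:
  assumes m: "signed_measure X \<mu>" and A: "range A \<subseteq> borel_sets X" "incseq A"
  shows "(\<lambda>n. \<mu> (A n)) \<longlonglongrightarrow> \<mu> (\<Union>n. A n)"
proof -
  have *: "(\<lambda>n. \<nu> (A n)) \<longlonglongrightarrow> \<nu> (\<Union>n. A n)" if n: "signed_measure X \<nu>" "\<And>A. 0 \<le> \<nu> A" for \<nu>
  proof -
    interpret finite_measure "to_measure X \<nu>" using n by (rule finite_measure_to_measure)
    have "A n \<in> borel_sets X" for n using A by blast
    then show ?thesis
      using finite_Lim_measure_incseq[of A] A borel_sets_UN[OF A(1)] by (simp add: measure_to_measure[OF n])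
  qed
  have "\<mu> A = pos_part X \<mu> A - neg_part X \<mu> A" for A using neg_part_eq[OF m] by simp
  then show ?thesis
    using tendsto_diff[OF *[OF signed_measure_pos_part[OF m] pos_part_nonneg[OF m]]
        *[OF signed_measure_neg_part[OF m] neg_part_nonneg[OF m]]] by simp
qed

section \<open>Cantor cubes\<close>

lemma topspace_cube: "topspace (cube A) = A \<rightarrow>\<^sub>E UNIV"
  by (simp add: cube_def)

lemma Hausdorff_cube: "Hausdorff_space (cube A)"
  by (simp add: cube_def Hausdorff_space_product_topology Hausdorff_space_discrete_topology)

lemma continuous_coordinate: "d \<in> A \<Longrightarrow> continuous_map (cube A) (discrete_topology UNIV) (\<lambda>t. t d)"
  unfolding cube_def by (rule continuous_map_product_projection)

lemma coordinate_clopen: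
  assumes S: "S \<subseteq> topspace (cube A)" and d: "d \<in> A"
  shows "{t \<in> S. Q (t d)} \<in> clopens (subtopology (cube A) S)"
proof -
  let ?X = "subtopology (cube A) S"
  have f: "continuous_map ?X (discrete_topology UNIV) (\<lambda>t. t d)"
    by (rule continuous_map_from_subtopology[OF continuous_coordinate[OF d]])
  have "topspace ?X = S" using S by (auto simp: topspace_subtopology)
  then show ?thesis
    using openin_continuous_map_preimage[OF f, of "Collect Q"] closedin_continuous_map_preimage[OF f, of "Collect Q"]
    by (simp add: clopens_def)
qed

lemma cylinder_clopen:
  assumes S: "S \<subseteq> topspace (cube A)" and D: "finite D" "D \<subseteq> A"
  shows "{t \<in> S. \<forall>d\<in>D. t d = x d} \<in> clopens (subtopology (cube A) S)"
  using D
proof (induction D rule: finite_induct)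
  case empty
  have "topspace (subtopology (cube A) S) = S" using S by (auto simp: topspace_subtopology)
  then show ?case using clopens_top[of "subtopology (cube A) S"] by simp
next
  case (insert d D)
  have "{t \<in> S. \<forall>d\<in>insert d D. t d = x d} = {t \<in> S. t d = x d} \<inter> {t \<in> S. \<forall>d\<in>D. t d = x d}" by auto
  then show ?case using insert coordinate_clopen[OF S, of d "\<lambda>b. b = x d"]
    by (simp add: clopens_Int)
qed

lemma cylinder_base:
  assumes "openin (cube A) U" "x \<in> U"
  shows "\<exists>D. finite D \<and> D \<subseteq> A \<and> (\<forall>t\<in>topspace (cube A). (\<forall>d\<in>D. t d = x d) \<longrightarrow> t \<in> U)"
proof -
  obtain V where V: "finite {i \<in> A. V i \<noteq> UNIV}" "x \<in> Pi\<^sub>E A V" "Pi\<^sub>E A V \<subseteq> U"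
    using assms unfolding cube_def openin_product_topology_alt by auto
  show ?thesis
  proof (intro exI conjI ballI impI)
    fix t assume t: "t \<in> topspace (cube A)" "\<forall>d\<in>{i \<in> A. V i \<noteq> UNIV}. t d = x d"
    have "t i \<in> V i" if "i \<in> A" for i using V(2) t(2) that by (cases "V i = UNIV") auto
    then have "t \<in> Pi\<^sub>E A V" using t(1) by (auto simp: PiE_iff topspace_cube)
    then show "t \<in> U" using V(3) by blast
  qed (use V(1) in auto)
qed

text \<open>Each point of \<open>S\<close> has a cylinder that misses \<open>S'\<close>; finitely
  many of them cover \<open>S\<close>, and their finite supports together form \<open>D\<close>.
  With \<open>A = UNIV\<close> this brings a separation in the final cube down to a countable
  rank.\<close>

lemma compact_cube_separation:
  assumes S: "compactin (cube A) S" and S': "compactin (cube A) S'" and "S \<inter> S' = {}"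
  shows "\<exists>D. finite D \<and> D \<subseteq> A \<and> (\<forall>t\<in>S. \<forall>t'\<in>S'. \<exists>d\<in>D. t d \<noteq> t' d)"
proof -
  let ?T = "topspace (cube A)"
  have T: "S \<subseteq> ?T" "S' \<subseteq> ?T" by (rule compactin_subset_topspace[OF S] compactin_subset_topspace[OF S'])+
  have op: "openin (cube A) (?T - S')"
    using compactin_imp_closedin[OF Hausdorff_cube S'] by (simp add: openin_diff)
  have "\<exists>D. finite D \<and> D \<subseteq> A \<and> (\<forall>t\<in>?T. (\<forall>d\<in>D. t d = x d) \<longrightarrow> t \<in> ?T - S')" if "x \<in> S" for x
    using that assms(3) T by (intro cylinder_base[OF op]) auto
  then obtain D where D: "\<And>x. x \<in> S \<Longrightarrow> finite (D x)" "\<And>x. x \<in> S \<Longrightarrow> D x \<subseteq> A"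
    "\<And>x t. x \<in> S \<Longrightarrow> t \<in> ?T \<Longrightarrow> (\<forall>d\<in>D x. t d = x d) \<Longrightarrow> t \<in> ?T - S'"
    by metis
  define c where "c x = {t \<in> ?T. \<forall>d\<in>D x. t d = x d}" for x
  have "openin (cube A) (c x)" if "x \<in> S" for x
    using cylinder_clopen[OF order_refl D(1,2)[OF that], of x] by (simp add: c_def clopens_def)
  moreover have "S \<subseteq> \<Union>(c ` S)" using T by (auto simp: c_def)
  ultimately obtain \<F> where \<F>: "finite \<F>" "\<F> \<subseteq> c ` S" "S \<subseteq> \<Union>\<F>"
    using compactinD[OF S, of "c ` S"] by auto
  then obtain P where P: "finite P" "P \<subseteq> S" "S \<subseteq> \<Union>(c ` P)"
    by (metis finite_subset_image)
  have "\<exists>d\<in>\<Union>(D ` P). t d \<noteq> t' d" if t: "t \<in> S" "t' \<in> S'" for t t'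
  proof (rule ccontr)
    assume n: "\<not> (\<exists>d\<in>\<Union>(D ` P). t d \<noteq> t' d)"
    obtain x where x: "x \<in> P" "t \<in> c x" using P(3) t(1) by blast
    have "t' \<in> ?T - S'"
    proof (rule D(3))
      show "x \<in> S" using x P by blast
      show "t' \<in> ?T" using t T by blast
      show "\<forall>d\<in>D x. t' d = x d" using x n unfolding c_def by auto
    qed
    then show False using t by blast
  qed
  moreover have "finite (\<Union>(D ` P))" using P(1,2) D(1) by auto
  moreover have "\<Union>(D ` P) \<subseteq> A" using P(2) D(2) by blast
  ultimately show ?thesis by blast
qed

lemma clopen_finite_support:
  assumes S: "compactin (cube A) S" and C: "C \<in> clopens (subtopology (cube A) S)"
  shows "\<exists>D. finite D \<and> D \<subseteq> A \<and> (\<forall>t\<in>S. \<forall>t'\<in>S. (\<forall>d\<in>D. t d = t' d) \<longrightarrow> (t \<in> C \<longleftrightarrow> t' \<in> C))"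
proof -
  let ?X = "subtopology (cube A) S"
  have X: "compact_space ?X" "topspace ?X = S"
    using S compactin_subset_topspace[OF S] by (auto simp: compact_space_subtopology topspace_subtopology)
  have CS: "C \<subseteq> S" using clopens_subset[OF C] X by simp
  have "S - C \<in> clopens ?X" using clopens_diff[OF clopens_top C] X by simp
  then have "compactin (cube A) C" "compactin (cube A) (S - C)"
    using C closedin_compact_space[OF X(1)] clopens_closedin compactin_subtopology by metis+
  then obtain D where D: "finite D" "D \<subseteq> A" "\<forall>t\<in>C. \<forall>t'\<in>S - C. \<exists>d\<in>D. t d \<noteq> t' d"
    using compact_cube_separation[of A C "S - C"] by blast
  have "t \<in> C \<longleftrightarrow> t' \<in> C" if "t \<in> S" "t' \<in> S" "\<forall>d\<in>D. t d = t' d" for t t'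
    using D(3) that by (metis DiffI)
  then show ?thesis using D by blast
qed

text \<open>A clopen set is a finite set \<open>D\<close> of coordinates together with a set of
  patterns on \<open>D\<close>. For countable \<open>A\<close> there are only countably many such
  choices.\<close>

lemma boolean_space_cube:
  assumes A: "countable A" and S: "compactin (cube A) S"
  shows "boolean_space (subtopology (cube A) S)"
proof
  let ?X = "subtopology (cube A) S"
  have ST: "S \<subseteq> topspace (cube A)" by (rule compactin_subset_topspace[OF S])
  have X: "topspace ?X = S" using ST by (auto simp: topspace_subtopology)
  show "compact_space ?X" using S by (simp add: compact_space_subtopology)
  define pat where "pat D P = {t \<in> S. restrict t D \<in> P}" for D and P :: "point set"
  have "clopens ?X \<subseteq> (\<Union>D\<in>{D. finite D \<and> D \<subseteq> A}. pat D ` Pow (D \<rightarrow>\<^sub>E UNIV))"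
  proof
    fix C assume C: "C \<in> clopens ?X"
    obtain D where D: "finite D" "D \<subseteq> A" "\<forall>t\<in>S. \<forall>t'\<in>S. (\<forall>d\<in>D. t d = t' d) \<longrightarrow> (t \<in> C \<longleftrightarrow> t' \<in> C)"
      using clopen_finite_support[OF S C] by blast
    have CS: "C \<subseteq> S" using clopens_subset[OF C] X by simp
    have "t \<in> C" if t: "t \<in> S" "restrict t D \<in> (\<lambda>t. restrict t D) ` C" for t
    proof -
      obtain t' where t': "t' \<in> C" "restrict t D = restrict t' D" using t by blast
      then have "\<forall>d\<in>D. t d = t' d" by (metis restrict_apply')
      moreover have "t' \<in> S" using t' CS by blast
      ultimately show ?thesis using D(3) t(1) t'(1) by blast
    qed
    then have "C = pat D ((\<lambda>t. restrict t D) ` C)" using CS by (auto simp: pat_def)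
    moreover have "(\<lambda>t. restrict t D) ` C \<in> Pow (D \<rightarrow>\<^sub>E UNIV)" by auto
    ultimately show "C \<in> (\<Union>D\<in>{D. finite D \<and> D \<subseteq> A}. pat D ` Pow (D \<rightarrow>\<^sub>E UNIV))"
      using D(1,2) by blast
  qed
  moreover have "countable (\<Union>D\<in>{D. finite D \<and> D \<subseteq> A}. pat D ` Pow (D \<rightarrow>\<^sub>E (UNIV :: bool set)))"
    by (intro countable_UN countable_Collect_finite_subset[OF A] countable_image countable_finite)
      (auto intro: finite_PiE)
  ultimately show "countable (clopens ?X)" by (rule countable_subset)
  fix U x assume U: "openin ?X U" "x \<in> U"
  then obtain V where V: "openin (cube A) V" "U = V \<inter> S" by (auto simp: openin_subtopology)
  then obtain D where D: "finite D" "D \<subseteq> A" "\<forall>t\<in>topspace (cube A). (\<forall>d\<in>D. t d = x d) \<longrightarrow> t \<in> V"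
    using cylinder_base[OF V(1), of x] U(2) by blast
  show "\<exists>C\<in>clopens ?X. x \<in> C \<and> C \<subseteq> U"
    using cylinder_clopen[OF ST D(1,2), of x] U V D(3) ST by (intro bexI) auto
qed

section \<open>Lifts of measures along the inverse system\<close>

lemma less_osucc_iff: "\<beta> < osucc \<alpha> \<longleftrightarrow> \<beta> \<le> \<alpha>"
proof
  assume "\<beta> < osucc \<alpha>"
  then show "\<beta> \<le> \<alpha>" unfolding osucc_def by (meson not_le not_less_Least)
next
  assume "\<beta> \<le> \<alpha>"
  then show "\<beta> < osucc \<alpha>" using less_osucc by (rule le_less_trans)
qed

lemma osucc_le_iff: "osucc \<alpha> \<le> \<beta> \<longleftrightarrow> \<alpha> < \<beta>"
  using less_osucc_iff[of \<beta> \<alpha>] by (simp add: not_less[symmetric])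

lemma le_osucc_iff: "\<beta> \<le> osucc \<alpha> \<longleftrightarrow> \<beta> \<le> \<alpha> \<or> \<beta> = osucc \<alpha>"
  using less_osucc_iff[of \<beta> \<alpha>] by (auto simp: le_less)

lemma lessThan_osucc: "{..<osucc \<alpha>} = insert \<alpha> {..<\<alpha>}"
  by (auto simp: less_osucc_iff)

lemma not_limit_osucc: "\<not> limit_ordinal (osucc \<alpha>)"
  by (auto simp: limit_ordinal_def)

lemma omega_neq_osucc: "omega \<noteq> osucc \<alpha>"
  using limit_ordinal_omega not_limit_osucc by metis

lemma \<pi>_\<pi>: "\<theta> \<le> \<beta> \<Longrightarrow> \<pi> \<theta> (\<pi> \<beta> t) = \<pi> \<theta> t"
  by (auto simp: \<pi>_def restrict_def fun_eq_iff)

lemma \<pi>_apply: "b < \<beta> \<Longrightarrow> \<pi> \<beta> t b = t b"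
  by (simp add: \<pi>_def)

lemma \<pi>_id: "t \<in> topspace (cube {..<\<beta>}) \<Longrightarrow> \<pi> \<beta> t = t"
  by (simp add: \<pi>_def topspace_cube PiE_restrict)

lemma continuous_\<pi>:
  assumes "{..<\<theta>} \<subseteq> A" shows "continuous_map (cube A) (cube {..<\<theta>}) (\<pi> \<theta>)"
  unfolding cube_def[of "{..<\<theta>}"] continuous_map_componentwise
proof (intro conjI ballI)
  show "\<pi> \<theta> ` topspace (cube A) \<subseteq> extensional {..<\<theta>}" by (auto simp: \<pi>_def)
  fix d assume d: "d \<in> {..<\<theta>}"
  then show "continuous_map (cube A) (discrete_topology UNIV) (\<lambda>x. \<pi> \<theta> x d)"
    using assms continuous_coordinate[of d A] by (auto simp: \<pi>_def)
qed

lemma eventually_along: "eventually Q (along J) \<longleftrightarrow> (\<exists>m. \<forall>n\<ge>m. n \<in> J \<longrightarrow> Q n)"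
  by (simp add: along_def eventually_inf_principal eventually_sequentially)

lemma along_neq_bot:
  assumes "infinite J" shows "along J \<noteq> bot"
proof -
  have "\<exists>n\<ge>m. n \<in> J" for m using assms by (auto simp: infinite_nat_iff_unbounded_le)
  then show ?thesis by (simp add: trivial_limit_def eventually_along)
qed

lemma along_mono: "finite (J' - J) \<Longrightarrow> along J' \<le> along J"
proof (rule filter_leI)
  fix Q assume f: "finite (J' - J)" and "eventually Q (along J)"
  then obtain m where m: "\<forall>n\<ge>m. n \<in> J \<longrightarrow> Q n" by (auto simp: eventually_along)
  obtain k where k: "\<forall>n\<in>J' - J. n < k" using f finite_nat_set_iff_bounded by blast
  show "eventually Q (along J')"
    unfolding eventually_along
  proof (intro exI[of _ "max m k"] allI impI)
    fix n assume n: "max m k \<le> n" "n \<in> J'"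
    have "\<not> n < k" using n by simp
    then have "n \<in> J" using k n(2) by blast
    then show "Q n" using n m by simp
  qed
qed

section \<open>The inverse system of spaces and the lifts of measures along it\<close>

locale partial_spaces =
  fixes \<alpha> :: omega1 and R :: realisation
  assumes spaces: "spaces_upto \<alpha> R"
begin

lemma compactin_spc: "omega \<le> \<beta> \<Longrightarrow> \<beta> \<le> \<alpha> \<Longrightarrow> compactin (cube {..<\<beta>}) (spc R \<beta>)"
  using spaces by (simp add: spaces_upto_def)

lemma spc_subset: "omega \<le> \<beta> \<Longrightarrow> \<beta> \<le> \<alpha> \<Longrightarrow> spc R \<beta> \<subseteq> topspace (cube {..<\<beta>})"
  using compactin_spc compactin_subset_topspace by blast

lemma topspace_at: "omega \<le> \<beta> \<Longrightarrow> \<beta> \<le> \<alpha> \<Longrightarrow> topspace (top_at R \<beta>) = spc R \<beta>"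
  using spc_subset by (auto simp: top_at_def topspace_subtopology)

lemma boolean_at: "omega \<le> \<beta> \<Longrightarrow> \<beta> \<le> \<alpha> \<Longrightarrow> boolean_space (top_at R \<beta>)"
  unfolding top_at_def by (intro boolean_space_cube compactin_spc countable_lessThan_omega1)

lemma \<pi>_spc:
  assumes "omega \<le> \<theta>" "\<theta> \<le> \<beta>" "\<beta> \<le> \<alpha>" "t \<in> spc R \<beta>"
  shows "\<pi> \<theta> t \<in> spc R \<theta>"
  using assms(2-4)
proof (induction \<beta> arbitrary: t rule: less_induct)
  case (less \<beta>)
  show ?case
  proof (cases "\<theta> = \<beta>")
    case True
    then show ?thesis using less.prems assms(1) \<pi>_id[of t \<beta>] spc_subset[of \<beta>] by auto
  next
    case False
    then have lt: "\<theta> < \<beta>" using less.prems by simp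
    show ?thesis
    proof (cases "limit_ordinal \<beta>")
      case True
      have "omega < \<beta>" using lt assms(1) by simp
      then have "spc R \<beta> = {t \<in> topspace (cube {..<\<beta>}). \<forall>\<gamma>. omega \<le> \<gamma> \<and> \<gamma> < \<beta> \<longrightarrow> \<pi> \<gamma> t \<in> spc R \<gamma>}"
        using spaces True less.prems(2) by (simp add: spaces_upto_def)
      then show ?thesis using less.prems lt assms(1) by blast
    next
      case False
      then obtain \<gamma> where \<gamma>: "\<beta> = osucc \<gamma>" using lt by (auto simp: limit_ordinal_def)
      then have \<gamma>': "\<theta> \<le> \<gamma>" "\<gamma> < \<beta>" "\<gamma> \<le> \<alpha>" "\<gamma> < \<alpha>" using lt less.prems less_osucc[of \<gamma>] by (auto simp: less_osucc_iff osucc_le_iff)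
      have g: "omega \<le> \<gamma>" using assms(1) \<gamma>'(1) by simp
      have e: "spc R \<beta> = append_bit \<gamma> (lower R \<gamma>) False \<union> append_bit \<gamma> (upper R \<gamma>) True"
        and u: "lower R \<gamma> \<union> upper R \<gamma> = spc R \<gamma>"
        using spaces g \<gamma>'(4) \<gamma> by (auto simp: spaces_upto_def)
      obtain s b where s: "s \<in> spc R \<gamma>" "t = s(\<gamma> := b)"
        using less.prems(3) u unfolding e append_bit_def by blast
      have "\<pi> \<theta> t = \<pi> \<theta> s" using \<gamma>'(1) s(2) by (auto simp: \<pi>_def restrict_def fun_eq_iff)
      then show ?thesis using less.IH[OF \<gamma>'(2,1,3) s(1)] by simp
    qed
  qed
qed

lemma continuous_\<pi>_at:
  assumes "omega \<le> \<theta>" "\<theta> \<le> \<beta>" "\<beta> \<le> \<alpha>"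
  shows "continuous_map (top_at R \<beta>) (top_at R \<theta>) (\<pi> \<theta>)"
proof -
  have o: "omega \<le> \<beta>" using assms by simp
  have "\<pi> \<theta> ` topspace (top_at R \<beta>) \<subseteq> spc R \<theta>"
    using \<pi>_spc[OF assms] topspace_at[OF o assms(3)] by auto
  moreover have "continuous_map (top_at R \<beta>) (cube {..<\<theta>}) (\<pi> \<theta>)"
    unfolding top_at_def using assms(2) by (intro continuous_map_from_subtopology continuous_\<pi>) auto
  ultimately show ?thesis
    unfolding top_at_def[of R \<theta>] by (auto simp: continuous_map_in_subtopology)
qed

lemma Hausdorff_at: "Hausdorff_space (top_at R \<beta>)"
  unfolding top_at_def by (intro Hausdorff_space_subtopology Hausdorff_cube)

lemma cylinder_at:
  assumes "omega \<le> \<beta>" "\<beta> \<le> \<alpha>" "finite D" "D \<subseteq> {..<\<beta>}"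
  shows "{t \<in> spc R \<beta>. \<forall>d\<in>D. t d = x d} \<in> clopens (top_at R \<beta>)"
  unfolding top_at_def using assms spc_subset by (intro cylinder_clopen) auto

lemma clopen_support_at:
  assumes "omega \<le> \<beta>" "\<beta> \<le> \<alpha>" "C \<in> clopens (top_at R \<beta>)"
  shows "\<exists>D. finite D \<and> D \<subseteq> {..<\<beta>} \<and> (\<forall>t\<in>spc R \<beta>. \<forall>t'\<in>spc R \<beta>. (\<forall>d\<in>D. t d = t' d) \<longrightarrow> (t \<in> C \<longleftrightarrow> t' \<in> C))"
  using assms(3) unfolding top_at_def by (intro clopen_finite_support compactin_spc assms)

end

text \<open>Condition (E) makes every clopen set fibrewise for large \<open>n\<close> in \<open>I\<close>, and then all lifts of \<open>\<nu>\<^sub>n\<close>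
  take the same value on it. So (F) is a statement about countably many real sequences.\<close>

definition fibrewise :: "realisation \<Rightarrow> nat \<Rightarrow> omega1 \<Rightarrow> omega1 \<Rightarrow> point set \<Rightarrow> bool" where
  "fibrewise R n \<theta> \<beta> C \<longleftrightarrow>
     (\<forall>t\<in>Vset R n \<theta> \<beta>. \<forall>t'\<in>Vset R n \<theta> \<beta>. \<pi> \<theta> t = \<pi> \<theta> t' \<longrightarrow> (t \<in> C \<longleftrightarrow> t' \<in> C))"

definition fibre_value :: "realisation \<Rightarrow> nat \<Rightarrow> omega1 \<Rightarrow> omega1 \<Rightarrow> omega1 \<Rightarrow> point set \<Rightarrow> real" where
  "fibre_value R n \<theta> \<delta> \<beta> C = meas R \<theta> \<delta> n (\<pi> \<theta> ` (C \<inter> Vset R n \<theta> \<beta>))"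

text \<open>\<open>b\<close> and \<open>c\<close> name the sequence of clopen sets behind the sets
  V_n of base level \<open>\<theta>\<close>. The locale is instantiated both with the given
  realisation and with its extension by one rank.\<close>

locale stage = partial_spaces +
  fixes \<theta> b c :: omega1
  assumes base: "omega \<le> \<theta>" "\<theta> \<le> \<alpha>" and sched: "sched R \<theta> = (b, c)" "omega \<le> b" "b \<le> \<theta>"
    and clop: "clop R b c \<in> clopen_sequences R b"
begin

lemma Vset_eq:
  assumes "\<theta> \<le> \<beta>" "\<beta> \<le> \<alpha>"
  shows "Vset R n \<theta> \<beta> = {t \<in> spc R \<beta>. \<pi> \<theta> t \<in> Vset R n \<theta> \<theta>}"
  using \<pi>_spc[OF base(1) assms] \<pi>_\<pi>[OF sched(3)] by (auto simp: Vset_def sched(1))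

lemma Vset_clopen:
  assumes "\<theta> \<le> \<beta>" "\<beta> \<le> \<alpha>"
  shows "Vset R n \<theta> \<beta> \<in> clopens (top_at R \<beta>)"
proof -
  have bb: "b \<le> \<beta>" "omega \<le> \<beta>" using assms base sched by auto
  have u: "openin (top_at R b) (clop R b c n)" "closedin (top_at R b) (clop R b c n)"
    using clop by (auto simp: clopen_sequences_def)
  show ?thesis
    using openin_continuous_map_preimage[OF continuous_\<pi>_at[OF sched(2) bb(1) assms(2)] u(1)]
      closedin_continuous_map_preimage[OF continuous_\<pi>_at[OF sched(2) bb(1) assms(2)] u(2)]
    by (simp add: Vset_def sched(1) clopens_def topspace_at[OF bb(2) assms(2)])
qed

lemma Vset_disjoint: "n \<noteq> m \<Longrightarrow> Vset R n \<theta> \<beta> \<inter> Vset R m \<theta> \<beta> = {}"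
  using clop unfolding clopen_sequences_def disjoint_family_on_def Vset_def sched(1) by blast

lemma Bset_signed: "\<mu> \<in> Bset R n \<theta> \<delta> \<beta> \<Longrightarrow> signed_measure (top_at R \<beta>) \<mu>"
  by (auto simp: Bset_def radon_imp_signed)

text \<open>Push-forward does not increase the norm. The intermediate norm lies between the norm of
  the lift and that of the base measure, and both are 1.\<close>

lemma Bset_push:
  assumes \<beta>: "\<theta> \<le> \<beta>" "\<beta> \<le> \<beta>'" "\<beta>' \<le> \<alpha>" and \<mu>: "\<mu> \<in> Bset R n \<theta> \<delta> \<beta>'"
    and nu: "tv_norm (top_at R \<theta>) (meas R \<theta> \<delta> n) = 1"
  shows "push_forward (top_at R \<beta>') (top_at R \<beta>) (\<pi> \<beta>) \<mu> \<in> Bset R n \<theta> \<delta> \<beta>"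
proof -
  let ?X = "top_at R \<beta>" and ?X' = "top_at R \<beta>'" and ?Y = "top_at R \<theta>"
  let ?\<rho> = "push_forward ?X' ?X (\<pi> \<beta>) \<mu>"
  have o: "omega \<le> \<beta>" "\<beta> \<le> \<alpha>" "omega \<le> \<beta>'" using base \<beta> by auto
  note m = Bset_signed[OF \<mu>]
  have c1: "continuous_map ?X' ?X (\<pi> \<beta>)" by (intro continuous_\<pi>_at o \<beta>)
  have c2: "continuous_map ?X ?Y (\<pi> \<theta>)" by (intro continuous_\<pi>_at o \<beta> base)
  have s: "signed_measure ?X ?\<rho>" by (rule signed_measure_push_forward[OF c1 m])
  have "push_forward ?X ?Y (\<pi> \<theta>) ?\<rho> = push_forward ?X' ?Y (\<pi> \<theta> \<circ> \<pi> \<beta>) \<mu>"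
    by (rule push_forward_compose[OF c1 c2])
  also have "\<dots> = push_forward ?X' ?Y (\<pi> \<theta>) \<mu>"
    by (rule push_forward_cong) (simp add: \<pi>_\<pi>[OF \<beta>(1)])
  also have "\<dots> = meas R \<theta> \<delta> n" using \<mu> by (simp add: Bset_def)
  finally have p: "push_forward ?X ?Y (\<pi> \<theta>) ?\<rho> = meas R \<theta> \<delta> n" .
  have le: "tv_norm Y (push_forward X Y f \<nu>) \<le> tv_norm X \<nu>" if "continuous_map X Y f" "signed_measure X \<nu>"
    for X Y :: "point topology" and f \<nu>
    unfolding tv_norm_def[of Y]
    by (rule order_trans[OF variation_push_forward[OF that borel_sets_top] variation_le_tv[OF that(2)]])
  have "tv_norm ?X ?\<rho> = 1"
    using le[OF c1 m] le[OF c2 s] nu p \<mu> by (simp add: Bset_def)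
  then show ?thesis
    using p boolean_space.signed_measure_radon[OF boolean_at[OF o(1,2)] s] by (simp add: Bset_def)
qed

context
  fixes \<beta> \<delta> n \<mu>
  assumes \<beta>: "\<theta> \<le> \<beta>" "\<beta> \<le> \<alpha>" and \<mu>: "\<mu> \<in> Bset R n \<theta> \<delta> \<beta>"
    and conc: "variation (top_at R \<theta>) (meas R \<theta> \<delta> n) (Vset R n \<theta> \<theta>) = 1"
begin

lemma Bset_image: "push_forward (top_at R \<beta>) (top_at R \<theta>) (\<pi> \<theta>) \<mu> = meas R \<theta> \<delta> n"
  using \<mu> by (simp add: Bset_def)

text \<open>The base measure has variation 1 on V_n, and push-forward cannot increase variation. So
  the preimage of V_n already carries the whole norm of the lift, and nothing is left
  outside.\<close>

lemma Bset_concentrated: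
  assumes E: "E \<in> borel_sets (top_at R \<beta>)" "E \<inter> Vset R n \<theta> \<beta> = {}"
  shows "\<mu> E = 0"
proof -
  let ?X = "top_at R \<beta>" and ?V = "Vset R n \<theta> \<beta>"
  note m = Bset_signed[OF \<mu>]
  have o: "omega \<le> \<beta>" using base \<beta> by simp
  have "Vset R n \<theta> \<theta> \<in> borel_sets (top_at R \<theta>)" using Vset_clopen[OF order_refl base(2)] clopens_borel by blast
  then have "1 \<le> variation ?X \<mu> {x \<in> topspace ?X. \<pi> \<theta> x \<in> Vset R n \<theta> \<theta>}"
    using variation_push_forward[OF continuous_\<pi>_at[OF base(1) \<beta>] m, of "Vset R n \<theta> \<theta>", unfolded Bset_image]
    by (simp add: conc)
  then have 1: "1 \<le> variation ?X \<mu> ?V" by (simp add: Vset_eq[OF \<beta>] topspace_at[OF o \<beta>(2)])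
  have "variation ?X \<mu> (?V \<union> E) = variation ?X \<mu> ?V + variation ?X \<mu> E"
    using E clopens_borel[OF Vset_clopen[OF \<beta>]]
    by (intro signed_measure_additive[OF signed_measure_variation[OF m]]) auto
  moreover have "variation ?X \<mu> (?V \<union> E) \<le> 1"
    using variation_le_tv[OF m, of "?V \<union> E"] \<mu> by (simp add: Bset_def)
  ultimately show ?thesis using 1 abs_le_variation[OF m, of E] by simp
qed

text \<open>A fibrewise \<open>C\<close> meets V_n in the full preimage of its image at level
  \<open>\<theta>\<close>, and the image is compact, hence Borel. The value on this part is thus
  prescribed by the base measure; the rest of \<open>C\<close> is null because the lift is
  concentrated on V_n.\<close>

lemma Bset_value:
  assumes C: "C \<in> clopens (top_at R \<beta>)" and fib: "fibrewise R n \<theta> \<beta> C"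
  shows "\<mu> C = fibre_value R n \<theta> \<delta> \<beta> C"
proof -
  let ?X = "top_at R \<beta>" and ?V = "Vset R n \<theta> \<beta>" and ?D = "\<pi> \<theta> ` (C \<inter> Vset R n \<theta> \<beta>)"
  note m = Bset_signed[OF \<mu>]
  have o: "omega \<le> \<beta>" using base \<beta> by simp
  interpret X: boolean_space ?X by (rule boolean_at[OF o \<beta>(2)])
  have V: "?V \<in> clopens ?X" by (rule Vset_clopen[OF \<beta>])
  have CV: "C \<inter> ?V \<in> clopens ?X" "C - ?V \<in> clopens ?X" using C V by (auto intro: clopens_Int clopens_diff)
  have "compactin (top_at R \<theta>) ?D"
    by (rule image_compactin[OF closedin_compact_space[OF X.compact clopens_closedin[OF CV(1)]]
          continuous_\<pi>_at[OF base(1) \<beta>]])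
  then have D: "?D \<in> borel_sets (top_at R \<theta>)"
    using compactin_imp_closedin[OF Hausdorff_at] closedin_borel by blast
  have "{x \<in> topspace ?X. \<pi> \<theta> x \<in> ?D} = C \<inter> ?V"
  proof (intro equalityI subsetI)
    fix x assume x: "x \<in> {x \<in> topspace ?X. \<pi> \<theta> x \<in> ?D}"
    then obtain y where y: "y \<in> C" "y \<in> ?V" "\<pi> \<theta> x = \<pi> \<theta> y" by blast
    then have "x \<in> ?V" using x Vset_eq[OF \<beta>, of n] topspace_at[OF o \<beta>(2)] by auto
    then show "x \<in> C \<inter> ?V" using fib y unfolding fibrewise_def by blast
  qed (use clopens_subset[OF CV(1)] in auto)
  then have "meas R \<theta> \<delta> n ?D = \<mu> (C \<inter> ?V)"
    unfolding Bset_image[symmetric] push_forward_def using D by simp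
  moreover have "\<mu> ((C \<inter> ?V) \<union> (C - ?V)) = \<mu> (C \<inter> ?V) + \<mu> (C - ?V)"
    using CV clopens_borel by (intro signed_measure_additive[OF m]) auto
  moreover have "\<mu> (C - ?V) = 0" using CV clopens_borel by (intro Bset_concentrated) auto
  moreover have "(C \<inter> ?V) \<union> (C - ?V) = C" by blast
  ultimately show ?thesis by (simp add: fibre_value_def)
qed

end

text \<open>A clopen set depends on finitely many coordinates. Those below \<open>\<theta>\<close>
  are fixed by the projection, each of the others by (E) for large \<open>n\<close>. The instances
  of (E) are hypotheses for a free set \<open>I\<close>, so that the lemma applies to the new rank
  while its conditions are still being proved.\<close>

lemma eventually_fibrewise:
  assumes \<beta>: "\<theta> \<le> \<beta>" "\<beta> \<le> \<alpha>"
    and E: "\<And>\<gamma>. \<theta> \<le> \<gamma> \<Longrightarrow> \<gamma> < \<beta> \<Longrightarrow> \<exists>m. \<forall>n\<in>I. n \<ge> m \<longrightarrow>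
        (\<forall>t\<in>Vset R n \<theta> \<beta>. \<forall>t'\<in>Vset R n \<theta> \<beta>. \<pi> \<theta> t = \<pi> \<theta> t' \<longrightarrow> t \<gamma> = t' \<gamma>)"
    and C: "C \<in> clopens (top_at R \<beta>)"
  shows "eventually (\<lambda>n. fibrewise R n \<theta> \<beta> C) (along I)"
proof -
  have o: "omega \<le> \<beta>" using base \<beta> by simp
  obtain D where D: "finite D" "D \<subseteq> {..<\<beta>}"
    "\<forall>t\<in>spc R \<beta>. \<forall>t'\<in>spc R \<beta>. (\<forall>d\<in>D. t d = t' d) \<longrightarrow> (t \<in> C \<longleftrightarrow> t' \<in> C)"
    using clopen_support_at[OF o \<beta>(2) C] by blast
  have "eventually (\<lambda>n. \<forall>t\<in>Vset R n \<theta> \<beta>. \<forall>t'\<in>Vset R n \<theta> \<beta>. \<pi> \<theta> t = \<pi> \<theta> t' \<longrightarrow> t d = t' d) (along I)"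
    if "d \<in> D" for d
  proof (cases "d < \<theta>")
    case True
    then show ?thesis using \<pi>_apply by (intro always_eventually) metis
  next
    case False
    moreover have "d < \<beta>" using that D(2) by blast
    ultimately obtain m where "\<forall>n\<in>I. n \<ge> m \<longrightarrow> (\<forall>t\<in>Vset R n \<theta> \<beta>. \<forall>t'\<in>Vset R n \<theta> \<beta>. \<pi> \<theta> t = \<pi> \<theta> t' \<longrightarrow> t d = t' d)"
      using E[OF leI] by blast
    then show ?thesis unfolding eventually_along by blast
  qed
  then have "eventually (\<lambda>n. \<forall>d\<in>D. \<forall>t\<in>Vset R n \<theta> \<beta>. \<forall>t'\<in>Vset R n \<theta> \<beta>. \<pi> \<theta> t = \<pi> \<theta> t' \<longrightarrow> t d = t' d) (along I)"
    using D(1) by (simp add: eventually_ball_finite)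
  then show ?thesis
  proof eventually_elim
    case (elim n)
    show ?case
      unfolding fibrewise_def
    proof (intro ballI impI)
      fix t t' assume t: "t \<in> Vset R n \<theta> \<beta>" "t' \<in> Vset R n \<theta> \<beta>" "\<pi> \<theta> t = \<pi> \<theta> t'"
      then have "\<forall>d\<in>D. t d = t' d" using elim by blast
      moreover have "t \<in> spc R \<beta>" "t' \<in> spc R \<beta>" using t by (auto simp: Vset_def sched(1))
      ultimately show "t \<in> C \<longleftrightarrow> t' \<in> C" using D(3) by blast
    qed
  qed
qed

lemma weak_star_criterion:
  assumes \<beta>: "\<theta> \<le> \<beta>" "\<beta> \<le> \<alpha>" and J: "infinite J" and \<mu>: "\<And>n. \<mu> n \<in> Bset R n \<theta> \<delta> \<beta>"
    and lim: "\<And>C. C \<in> clopens (top_at R \<beta>) \<Longrightarrow> \<exists>l. ((\<lambda>n. \<mu> n C) \<longlongrightarrow> l) (along J)"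
  shows "\<exists>\<mu>'\<in>radon_measures (top_at R \<beta>). weak_star_limit (top_at R \<beta>) \<mu> \<mu>' (along J)"
proof -
  have "omega \<le> \<beta>" using base \<beta> by simp
  then interpret X: boolean_space "top_at R \<beta>" using \<beta>(2) by (rule boolean_at)
  show ?thesis
    using \<mu> by (intro X.weak_star_exists along_neq_bot J lim) (auto simp: Bset_def radon_imp_signed)
qed

end

section \<open>Enumerations, subsequences and sparse sequences\<close>

lemma osucc_less_omega: "\<beta> < omega \<Longrightarrow> osucc \<beta> < omega"
  using osucc_le_iff[of \<beta> omega] omega_neq_osucc[of \<beta>] by (simp add: le_less)

lemma ex_nat_embedding: "\<exists>g :: nat \<Rightarrow> omega1. inj g \<and> (\<forall>n. g n < omega)"
proof -
  obtain z where z: "z < omega" using limit_ordinal_omega by (auto simp: limit_ordinal_def)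
  define g where "g n = (osucc ^^ n) z" for n
  have "g n < omega" for n
    unfolding g_def by (induction n) (simp_all add: z osucc_less_omega)
  moreover have "strict_mono g" by (simp add: strict_mono_Suc_iff g_def less_osucc)
  ultimately show ?thesis using strict_mono_imp_inj_on by blast
qed

lemma stationary_unbounded:
  assumes "stationary S" shows "\<exists>a\<in>S. \<xi> < a"
proof -
  have "club {\<gamma>. \<xi> < \<gamma>}"
    unfolding club_def
  proof (intro conjI allI impI)
    fix \<zeta> :: omega1
    show "\<exists>\<gamma>\<in>{\<gamma>. \<xi> < \<gamma>}. \<zeta> < \<gamma>"
      using less_osucc[of "max \<xi> \<zeta>"] by (intro bexI[of _ "osucc (max \<xi> \<zeta>)"]) auto
  next
    fix \<rho> assume \<rho>: "limit_ordinal \<rho> \<and> (\<forall>\<zeta><\<rho>. \<exists>\<gamma>\<in>{\<gamma>. \<xi> < \<gamma>}. \<zeta> < \<gamma> \<and> \<gamma> < \<rho>)"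
    then obtain \<zeta> where "\<zeta> < \<rho>" by (auto simp: limit_ordinal_def)
    then obtain \<gamma> where "\<xi> < \<gamma>" "\<gamma> < \<rho>" using \<rho> by blast
    then show "\<rho> \<in> {\<gamma>. \<xi> < \<gamma>}" by simp
  qed
  then show ?thesis using assms unfolding stationary_def by blast
qed

text \<open>Subsets of the natural numbers are copied below \<open>omega\<close> and guessed by the
  diamond at arbitrarily late stages. Besides the continuum hypothesis this gives cofinal
  repetition, which leaves room to prescribe an initial segment of an enumeration.\<close>

lemma diamond_enumerates_reals:
  assumes "diamond S"
  shows "\<exists>f :: omega1 \<Rightarrow> nat set. \<forall>A \<xi>. \<exists>a>\<xi>. f a = A"
proof -
  obtain g :: "nat \<Rightarrow> omega1" where g: "inj g" "\<And>n. g n < omega" using ex_nat_embedding by blast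
  obtain D where D: "\<And>A. stationary {\<alpha>\<in>S. D \<alpha> = A \<inter> {..<\<alpha>}}"
    using assms unfolding diamond_def by blast
  have "\<exists>a>\<xi>. {n. g n \<in> D a} = A" for A \<xi>
  proof -
    obtain a where a: "D a = g ` A \<inter> {..<a}" "max \<xi> omega < a"
      using stationary_unbounded[OF D[of "g ` A"], of "max \<xi> omega"] by blast
    have "g n < a" for n using g(2)[of n] a(2) by (meson max.strict_boundedE order.strict_trans)
    then have "{n. g n \<in> D a} = A" using a(1) g(1) by (auto simp: inj_image_mem_iff)
    then show ?thesis using a(2) by auto
  qed
  then show ?thesis by (intro exI[of _ "\<lambda>a. {n. g n \<in> D a}"]) blast
qed

text \<open>Used with \<open>\<xi> = \<alpha>\<close>: the conditions at rank \<alpha> + 1 speak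
  about all pairs (\<alpha>, \<delta>) with \<delta> \<le> \<alpha>, so one chosen sequence occupies
  all these indices and everything else is enumerated later.\<close>

lemma diamond_enumeration:
  fixes code :: "'b \<Rightarrow> nat set"
  assumes "diamond S" "inj_on code X" "x0 \<in> X"
  shows "\<exists>E :: omega1 \<Rightarrow> 'b. range E = X \<and> (\<forall>\<delta>\<le>\<xi>. E \<delta> = x0)"
proof -
  obtain f :: "omega1 \<Rightarrow> nat set" where f: "\<And>A \<xi>. \<exists>a>\<xi>. f a = A"
    using diamond_enumerates_reals[OF assms(1)] by blast
  define E where "E \<delta> = (if \<delta> \<le> \<xi> \<or> f \<delta> \<notin> code ` X then x0 else the_inv_into X code (f \<delta>))" for \<delta>
  have "E \<delta> \<in> X" for \<delta>
    using assms(3) the_inv_into_into[OF assms(2) _ order_refl] by (auto simp: E_def)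
  moreover have "x \<in> range E" if x: "x \<in> X" for x
  proof -
    obtain a where a: "\<xi> < a" "f a = code x" using f by blast
    then have "E a = x" using x the_inv_into_f_f[OF assms(2) x] by (auto simp: E_def)
    then show ?thesis by blast
  qed
  moreover have "\<forall>\<delta>\<le>\<xi>. E \<delta> = x0" by (simp add: E_def)
  ultimately show ?thesis by blast
qed

lemma ex_code_clopen_sequences:
  assumes "countable K"
  shows "\<exists>code :: (nat \<Rightarrow> 'a set) \<Rightarrow> nat set. inj_on code {u. \<forall>n. u n \<in> K}"
proof -
  define code where "code u = range (\<lambda>n. to_nat (n, to_nat_on K (u n)))" for u :: "nat \<Rightarrow> 'a set"
  have "u = v" if uv: "\<And>n. u n \<in> K" "\<And>n. v n \<in> K" "code u = code v" for u v
  proof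
    fix n
    have "to_nat (n, to_nat_on K (u n)) \<in> code v" using uv(3) by (auto simp: code_def)
    then have "to_nat_on K (u n) = to_nat_on K (v n)" by (auto simp: code_def)
    then show "u n = v n" using uv(1,2) inj_on_to_nat_on[OF assms] by (auto dest: inj_onD)
  qed
  then have "inj_on code {u. \<forall>n. u n \<in> K}" by (auto intro!: inj_onI)
  then show ?thesis by blast
qed

text \<open>Each value on a clopen set is stored as its lower rational cut; the values on clopen
  sets determine the measures.\<close>

lemma (in boolean_space) ex_code_measures:
  "\<exists>code :: (nat \<Rightarrow> 'a set \<Rightarrow> real) \<Rightarrow> nat set. inj_on code {\<nu>. \<forall>n. signed_measure X (\<nu> n)}"
proof -
  define code where "code \<nu> = {to_nat (n, to_nat_on (clopens X) C, r) | n C r. C \<in> clopens X \<and> real_of_rat r < \<nu> n C}"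
    for \<nu> :: "nat \<Rightarrow> 'a set \<Rightarrow> real"
  have le: "\<nu> n C \<le> \<nu>' n C" if "code \<nu> = code \<nu>'" "C \<in> clopens X" for \<nu> \<nu>' n C
  proof (rule ccontr)
    assume "\<not> \<nu> n C \<le> \<nu>' n C"
    then obtain r where r: "\<nu>' n C < real_of_rat r" "real_of_rat r < \<nu> n C"
      using of_rat_dense[of "\<nu>' n C" "\<nu> n C"] by auto
    have "to_nat (n, to_nat_on (clopens X) C, r) \<in> code \<nu>'"
      unfolding that(1)[symmetric] using that(2) r(2) by (auto simp: code_def)
    then obtain C' where C': "C' \<in> clopens X" "to_nat_on (clopens X) C = to_nat_on (clopens X) C'" "real_of_rat r < \<nu>' n C'"
      by (auto simp: code_def)
    then have "C = C'" using that(2) inj_on_to_nat_on[OF countable_clopens] by (auto dest: inj_onD)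
    then show False using C'(3) r(1) by simp
  qed
  have "\<nu> = \<nu>'" if "\<forall>n. signed_measure X (\<nu> n)" "\<forall>n. signed_measure X (\<nu>' n)" "code \<nu> = code \<nu>'" for \<nu> \<nu>'
  proof
    fix n
    show "\<nu> n = \<nu>' n"
      using that le[OF that(3)] le[OF that(3)[symmetric]] by (intro signed_measure_eqI antisym) auto
  qed
  then have "inj_on code {\<nu>. \<forall>n. signed_measure X (\<nu> n)}" by (auto intro!: inj_onI)
  then show ?thesis by blast
qed

lemma tendsto_along_range:
  assumes r: "strict_mono (r :: nat \<Rightarrow> nat)" and l: "(\<lambda>n. x (r n)) \<longlonglongrightarrow> l"
  shows "(x \<longlongrightarrow> l) (along (range r))"
proof (rule topological_tendstoI)
  fix S assume "open S" "l \<in> S"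
  then obtain m where m: "\<And>n. n \<ge> m \<Longrightarrow> x (r n) \<in> S"
    using topological_tendstoD[OF l] by (auto simp: eventually_sequentially)
  show "eventually (\<lambda>n. x n \<in> S) (along (range r))"
    unfolding eventually_along using m strict_mono_less_eq[OF r] by (intro exI[of _ "r m"]) auto
qed

lemma diagonal_subsequence:
  fixes a :: "'c \<Rightarrow> nat \<Rightarrow> real"
  assumes K: "countable K" and I: "infinite I" and b: "\<And>C n. C \<in> K \<Longrightarrow> \<bar>a C n\<bar> \<le> 1"
  shows "\<exists>J\<subseteq>I. infinite J \<and> (\<forall>C\<in>K. \<exists>l. (a C \<longlongrightarrow> l) (along J))"
proof -
  define e where "e = enumerate I"
  have e: "strict_mono e" "range e = I" using I range_enumerate strict_mono_enumerate by (auto simp: e_def)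
  obtain k :: "nat \<Rightarrow> nat" where k: "strict_mono k" "\<And>C. C \<in> K \<Longrightarrow> \<exists>l. (\<lambda>n. a C (e (k n))) \<longlonglongrightarrow> l"
    using function_convergent_subsequence[OF K, of "\<lambda>n C. a C (e n)" 1] b by auto
  have m: "strict_mono (e \<circ> k)" using e(1) k(1) by (rule strict_mono_o)
  have "\<exists>l. (a C \<longlongrightarrow> l) (along (range (e \<circ> k)))" if "C \<in> K" for C
    using k(2)[OF that] tendsto_along_range[OF m, of "a C"] by auto
  moreover have "range (e \<circ> k) \<subseteq> I" using e(2) by auto
  moreover have "infinite (range (e \<circ> k))" using strict_mono_imp_inj_on[OF m] by (rule range_inj_infinite)
  ultimately show ?thesis by blast
qed

text \<open>A recursion whose state is the current annulus, the kept index and the union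
  \<open>A\<close> of the earlier annuli. The index \<open>n i\<close> is chosen for
  \<open>A\<close> before the next annulus; this annulus then starts so deep that it and all its
  successors miss \<open>V i (n i)\<close>.\<close>

lemma sparse_sequences:
  fixes C :: "nat \<Rightarrow> 'a set" and good :: "nat \<Rightarrow> 'a set \<Rightarrow> nat \<Rightarrow> bool"
  assumes C: "decseq C"
    and good: "\<And>i A. A \<in> \<A> \<Longrightarrow> \<exists>n. good i A n \<and> (\<exists>a. C a \<inter> V i n = {})"
    and \<A>: "{} \<in> \<A>" "\<And>A a b. A \<in> \<A> \<Longrightarrow> A \<union> (C a - C b) \<in> \<A>"
    and acc: "\<And>k. \<exists>l>k. F \<inter> (C k - C l) \<noteq> {}"
  shows "\<exists>a b n. (\<forall>i. a i < b i \<and> b i < a (Suc i) \<and> k0 \<le> a i \<and>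
      F \<inter> (C (a i) - C (b i)) \<noteq> {} \<and> F \<inter> (C (b i) - C (a (Suc i))) \<noteq> {} \<and>
      good i (\<Union>j<i. C (a j) - C (b j)) (n i) \<and> C (a i) \<inter> V i (n i) = {})"
proof -
  define inv where "inv i s = (case s of (a, b, n, A) \<Rightarrow> A \<in> \<A> \<and> (i = 0 \<longrightarrow> A = {}) \<and> a < b \<and> k0 \<le> a \<and>
      F \<inter> (C a - C b) \<noteq> {} \<and> good i A n \<and> C a \<inter> V i n = {})" for i :: nat and s :: "nat \<times> nat \<times> nat \<times> 'a set"
  define nxt where "nxt s s' = (case (s, s') of ((a, b, n, A), (a', b', n', A')) \<Rightarrow>
      A' = A \<union> (C a - C b) \<and> b < a' \<and> F \<inter> (C b - C a') \<noteq> {})"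
    for s s' :: "nat \<times> nat \<times> nat \<times> 'a set"
  \<comment> \<open>Points of \<open>F\<close> are demanded both in the annulus from
    \<open>a\<close> to \<open>b\<close> and in the gap from \<open>l\<close> to \<open>a\<close>:
    they become the points x_j with even and with odd \<open>j\<close>.\<close>
  have ext: "\<exists>a b n. l < a \<and> a < b \<and> k0 \<le> a \<and> F \<inter> (C a - C b) \<noteq> {} \<and> good i A n \<and> C a \<inter> V i n = {} \<and> F \<inter> (C l - C a) \<noteq> {}"
    if A: "A \<in> \<A>" for i A l
  proof -
    obtain n a where n: "good i A n" "C a \<inter> V i n = {}" using good[OF A] by blast
    obtain m where m: "m > l" "F \<inter> (C l - C m) \<noteq> {}" using acc by blast
    \<comment> \<open>Beyond \<open>a\<close> the set \<open>V i n\<close> is missed, beyond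
      \<open>m\<close> the gap contains a point of \<open>F\<close>, and beyond \<open>k0\<close>
      the annuli stay in the prescribed neighbourhood.\<close>
    define a' where "a' = max (max a m) k0"
    have sub: "C a' \<subseteq> C a" "C a' \<subseteq> C m" using decseqD[OF C] by (auto simp: a'_def)
    obtain b where b: "b > a'" "F \<inter> (C a' - C b) \<noteq> {}" using acc by blast
    have "l < a'" "k0 \<le> a'" using m(1) by (auto simp: a'_def)
    moreover have "C a' \<inter> V i n = {}" "F \<inter> (C l - C a') \<noteq> {}" using n(2) m(2) sub by blast+
    ultimately show ?thesis using n(1) b by blast
  qed
  have "\<exists>s. inv 0 s"
  proof -
    obtain a b n where "a < b \<and> k0 \<le> a \<and> F \<inter> (C a - C b) \<noteq> {} \<and> good 0 {} n \<and> C a \<inter> V 0 n = {}"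
      using ext[OF \<A>(1), of 0 0] by blast
    then show ?thesis using \<A>(1) unfolding inv_def by (intro exI[of _ "(a, b, n, {})"]) simp
  qed
  moreover have "\<exists>s'. inv (Suc i) s' \<and> nxt s s'" if s: "inv i s" for i s
  proof -
    obtain a b n A where e: "s = (a, b, n, A)" by (metis prod_cases4)
    have A': "A \<union> (C a - C b) \<in> \<A>" using s \<A>(2) unfolding e inv_def by auto
    obtain a' b' n' where "b < a' \<and> a' < b' \<and> k0 \<le> a' \<and> F \<inter> (C a' - C b') \<noteq> {} \<and> good (Suc i) (A \<union> (C a - C b)) n' \<and>
        C a' \<inter> V (Suc i) n' = {} \<and> F \<inter> (C b - C a') \<noteq> {}"
      using ext[OF A', of b "Suc i"] by blast
    then show ?thesis using A' unfolding e inv_def nxt_def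
      by (intro exI[of _ "(a', b', n', A \<union> (C a - C b))"]) simp
  qed
  ultimately have "\<exists>s. \<forall>i. inv i (s i) \<and> nxt (s i) (s (Suc i))"
    by (intro dependent_nat_choice) auto
  then obtain s where s: "\<And>i. inv i (s i)" "\<And>i. nxt (s i) (s (Suc i))" by blast
  define a where "a i = fst (s i)" for i
  define b where "b i = fst (snd (s i))" for i
  define n where "n i = fst (snd (snd (s i)))" for i
  define A where "A i = snd (snd (snd (s i)))" for i
  have i: "A i \<in> \<A> \<and> a i < b i \<and> k0 \<le> a i \<and> F \<inter> (C (a i) - C (b i)) \<noteq> {} \<and> good i (A i) (n i) \<and> C (a i) \<inter> V i (n i) = {}"
    and x: "A (Suc i) = A i \<union> (C (a i) - C (b i)) \<and> b i < a (Suc i) \<and> F \<inter> (C (b i) - C (a (Suc i))) \<noteq> {}" for i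
    using s(1)[of i] s(2)[of i] unfolding inv_def nxt_def a_def b_def n_def A_def
    by (simp_all add: case_prod_beta)
  have "A 0 = {}" using s(1)[of 0] unfolding inv_def A_def by (simp add: case_prod_beta)
  then have A: "A i = (\<Union>j<i. C (a j) - C (b j))" for i
    by (induction i) (use x in \<open>auto simp: lessThan_Suc\<close>)
  show ?thesis
    by (intro exI[of _ a] exI[of _ b] exI[of _ n] allI) (use i x in \<open>simp add: A[symmetric]\<close>)
qed

section \<open>Splitting a space at a single point\<close>

locale split_space = partial_spaces "osucc \<alpha>" R for \<alpha> R +
  fixes p
  assumes \<alpha>: "omega \<le> \<alpha>" and p: "lower R \<alpha> \<inter> upper R \<alpha> = {p}"
begin

lemma le_succ: "\<alpha> \<le> osucc \<alpha>" and omega_succ: "omega \<le> osucc \<alpha>"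
  using less_osucc[of \<alpha>] \<alpha> by auto

lemma spc_succ: "spc R (osucc \<alpha>) = append_bit \<alpha> (lower R \<alpha>) False \<union> append_bit \<alpha> (upper R \<alpha>) True"
  and lower_upper: "lower R \<alpha> \<union> upper R \<alpha> = spc R \<alpha>"
  using spaces \<alpha> less_osucc[of \<alpha>] by (auto simp: spaces_upto_def)

lemma spc_extensional: "s \<in> spc R \<alpha> \<Longrightarrow> \<pi> \<alpha> (s(\<alpha> := x)) = s"
proof -
  assume "s \<in> spc R \<alpha>"
  then have "\<pi> \<alpha> s = s" using \<pi>_id spc_subset[OF \<alpha> le_succ] by blast
  moreover have "\<pi> \<alpha> (s(\<alpha> := x)) = \<pi> \<alpha> s" by (auto simp: \<pi>_def restrict_def fun_eq_iff)
  ultimately show ?thesis by simp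
qed

lemma mem_spc_succ:
  "t \<in> spc R (osucc \<alpha>) \<longleftrightarrow> t = (\<pi> \<alpha> t)(\<alpha> := t \<alpha>) \<and> \<pi> \<alpha> t \<in> (if t \<alpha> then upper R \<alpha> else lower R \<alpha>)"
proof
  assume "t \<in> spc R (osucc \<alpha>)"
  then obtain s where "s \<in> lower R \<alpha> \<and> t = s(\<alpha> := False) \<or> s \<in> upper R \<alpha> \<and> t = s(\<alpha> := True)"
    unfolding spc_succ append_bit_def by blast
  then show "t = (\<pi> \<alpha> t)(\<alpha> := t \<alpha>) \<and> \<pi> \<alpha> t \<in> (if t \<alpha> then upper R \<alpha> else lower R \<alpha>)"
    using spc_extensional[of s False] spc_extensional[of s True] lower_upper by (elim disjE conjE) force+
next
  assume t: "t = (\<pi> \<alpha> t)(\<alpha> := t \<alpha>) \<and> \<pi> \<alpha> t \<in> (if t \<alpha> then upper R \<alpha> else lower R \<alpha>)"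
  show "t \<in> spc R (osucc \<alpha>)"
  proof (cases "t \<alpha>")
    case True
    then have "t = (\<pi> \<alpha> t)(\<alpha> := True)" "\<pi> \<alpha> t \<in> upper R \<alpha>" using t by simp_all
    then show ?thesis unfolding spc_succ append_bit_def by (intro UnI2 image_eqI)
  next
    case False
    then have "t = (\<pi> \<alpha> t)(\<alpha> := False)" "\<pi> \<alpha> t \<in> lower R \<alpha>" using t by simp_all
    then show ?thesis unfolding spc_succ append_bit_def by (intro UnI1 image_eqI)
  qed
qed

lemma succ_eqI:
  assumes "t \<in> spc R (osucc \<alpha>)" "t' \<in> spc R (osucc \<alpha>)" "\<pi> \<alpha> t = \<pi> \<alpha> t'" "t \<alpha> = t' \<alpha>"
  shows "t = t'"
proof -
  have "t = (\<pi> \<alpha> t)(\<alpha> := t \<alpha>)" "t' = (\<pi> \<alpha> t')(\<alpha> := t' \<alpha>)" using assms(1,2) mem_spc_succ by blast+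
  then show ?thesis using assms(3,4) by simp
qed

lemma succ_upper: "t \<in> spc R (osucc \<alpha>) \<Longrightarrow> t \<alpha> \<Longrightarrow> \<pi> \<alpha> t \<in> upper R \<alpha>"
  and succ_lower: "t \<in> spc R (osucc \<alpha>) \<Longrightarrow> \<not> t \<alpha> \<Longrightarrow> \<pi> \<alpha> t \<in> lower R \<alpha>"
  unfolding mem_spc_succ by presburger+

abbreviation Z1 :: "point set" where "Z1 \<equiv> append_bit \<alpha> (upper R \<alpha>) True"

lemma Z1_eq: "Z1 = {t \<in> spc R (osucc \<alpha>). t \<alpha>}"
  unfolding spc_succ append_bit_def by auto

lemma Z1_clopen: "Z1 \<in> clopens (top_at R (osucc \<alpha>))"
  unfolding Z1_eq top_at_def using coordinate_clopen[OF spc_subset[OF omega_succ order_refl], of \<alpha> "\<lambda>b. b"]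
  by (simp add: less_osucc)

lemma fibre_unique:
  assumes "t \<in> spc R (osucc \<alpha>)" "t' \<in> spc R (osucc \<alpha>)" "\<pi> \<alpha> t = \<pi> \<alpha> t'" "\<pi> \<alpha> t \<noteq> p"
  shows "t = t'"
proof -
  have "t \<alpha> = t' \<alpha>"
    using succ_upper[OF assms(1)] succ_lower[OF assms(1)] succ_upper[OF assms(2)] succ_lower[OF assms(2)] assms(3,4) p
    by auto
  then show ?thesis using succ_eqI assms by blast
qed

lemma p_lifts: "p(\<alpha> := x) \<in> spc R (osucc \<alpha>)" "\<pi> \<alpha> (p(\<alpha> := x)) = p"
proof -
  have pm: "p \<in> lower R \<alpha>" "p \<in> upper R \<alpha>" using p by auto
  then show "\<pi> \<alpha> (p(\<alpha> := x)) = p" using spc_extensional lower_upper by auto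
  then show "p(\<alpha> := x) \<in> spc R (osucc \<alpha>)" using pm by (simp add: mem_spc_succ)
qed

lemma \<pi>_surj: "\<pi> \<alpha> ` spc R (osucc \<alpha>) = spc R \<alpha>"
proof
  show "\<pi> \<alpha> ` spc R (osucc \<alpha>) \<subseteq> spc R \<alpha>"
    using \<pi>_spc[OF \<alpha> le_succ order_refl] by blast
  show "spc R \<alpha> \<subseteq> \<pi> \<alpha> ` spc R (osucc \<alpha>)"
  proof
    fix s assume s: "s \<in> spc R \<alpha>"
    then obtain x where "s(\<alpha> := x) \<in> spc R (osucc \<alpha>)"
      using lower_upper unfolding spc_succ append_bit_def by blast
    then show "s \<in> \<pi> \<alpha> ` spc R (osucc \<alpha>)" using spc_extensional[OF s] by (metis image_eqI)
  qed
qed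

text \<open>Only the fibre over \<open>p\<close> has more than one point, so a set that does not
  separate the two lifts of \<open>p\<close> is a union of fibres. The images of it and of its
  complement are closed by compactness and complementary, hence clopen.\<close>

lemma unsplit_clopen:
  assumes C: "C \<in> clopens (top_at R (osucc \<alpha>))" and eq: "p(\<alpha> := True) \<in> C \<longleftrightarrow> p(\<alpha> := False) \<in> C"
  shows "\<exists>C0\<in>clopens (top_at R \<alpha>). C = {t \<in> spc R (osucc \<alpha>). \<pi> \<alpha> t \<in> C0}"
proof -
  let ?X = "top_at R (osucc \<alpha>)" and ?K = "spc R (osucc \<alpha>)"
  interpret X: boolean_space ?X by (rule boolean_at[OF omega_succ order_refl])
  have top: "topspace ?X = ?K" "topspace (top_at R \<alpha>) = spc R \<alpha>"
    by (rule topspace_at[OF omega_succ order_refl], rule topspace_at[OF \<alpha> le_succ])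
  have CK: "C \<subseteq> ?K" using clopens_subset[OF C] top by simp
  have cl: "closedin (top_at R \<alpha>) (\<pi> \<alpha> ` D)" if "D \<in> clopens ?X" for D
    by (rule compactin_imp_closedin[OF Hausdorff_at image_compactin[OF closedin_compact_space[OF X.compact
            clopens_closedin[OF that]] continuous_\<pi>_at[OF \<alpha> le_succ order_refl]]])
  have sep: "t \<in> C \<longleftrightarrow> t' \<in> C" if "t \<in> ?K" "t' \<in> ?K" "\<pi> \<alpha> t = \<pi> \<alpha> t'" for t t'
  proof (cases "\<pi> \<alpha> t = p")
    case True
    then have "t = p(\<alpha> := t \<alpha>)" "t' = p(\<alpha> := t' \<alpha>)" using that mem_spc_succ by metis+
    then show ?thesis using eq by (cases "t \<alpha>"; cases "t' \<alpha>") auto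
  next
    case False
    then show ?thesis using fibre_unique that by blast
  qed
  have K: "\<pi> \<alpha> ` (?K - C) = spc R \<alpha> - \<pi> \<alpha> ` C"
    unfolding \<pi>_surj[symmetric] using sep CK by blast
  have "closedin (top_at R \<alpha>) (spc R \<alpha> - \<pi> \<alpha> ` C)"
    unfolding K[symmetric] using clopens_diff[OF clopens_top C] top by (intro cl) simp
  then have "openin (top_at R \<alpha>) (\<pi> \<alpha> ` C)"
    using openin_diff[OF openin_topspace, of "top_at R \<alpha>"] top CK \<pi>_surj
    by (metis double_diff image_mono subset_refl)
  then have "\<pi> \<alpha> ` C \<in> clopens (top_at R \<alpha>)" using cl[OF C] by (simp add: clopens_def)
  moreover have "C = {t \<in> ?K. \<pi> \<alpha> t \<in> \<pi> \<alpha> ` C}" using sep CK by blast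
  ultimately show ?thesis by blast
qed

text \<open>\<open>Z1\<close> is the only new generator of the clopen algebra. If \<open>C\<close>
  contains the same single lift of \<open>p\<close> as \<open>Z1\<close>, then \<open>C - Z1\<close>
  and \<open>Z1 - C\<close> contain neither lift and so come from clopen sets below; if it contains
  the other one, its complement is used.\<close>

lemma convergence_succ:
  assumes m: "\<And>n. signed_measure (top_at R (osucc \<alpha>)) (\<mu> n)"
    and base: "\<And>C. C \<in> clopens (top_at R \<alpha>) \<Longrightarrow> \<exists>l. ((\<lambda>n. \<mu> n {t \<in> spc R (osucc \<alpha>). \<pi> \<alpha> t \<in> C}) \<longlongrightarrow> l) \<F>"
    and Z: "\<exists>l. ((\<lambda>n. \<mu> n Z1) \<longlongrightarrow> l) \<F>"
    and C: "C \<in> clopens (top_at R (osucc \<alpha>))"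
  shows "\<exists>l. ((\<lambda>n. \<mu> n C) \<longlongrightarrow> l) \<F>"
proof -
  let ?X = "top_at R (osucc \<alpha>)" and ?K = "spc R (osucc \<alpha>)"
  let ?s0 = "p(\<alpha> := False)" and ?s1 = "p(\<alpha> := True)"
  let ?cv = "\<lambda>C. \<exists>l. ((\<lambda>n. \<mu> n C) \<longlongrightarrow> l) \<F>"
  have unsplit: "?cv C" if "C \<in> clopens ?X" "?s1 \<in> C \<longleftrightarrow> ?s0 \<in> C" for C
    using unsplit_clopen[OF that] base by blast
  have df: "\<mu> n (A - B) = \<mu> n A - \<mu> n B" if "A \<in> clopens ?X" "B \<in> clopens ?X" "B \<subseteq> A" for A B n
    using charge.diff[OF signed_measure_charge[OF m]] that clopens_borel by blast
  have split: "?cv C" if C: "C \<in> clopens ?X" "?s1 \<in> C" "?s0 \<notin> C" for C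
  proof -
    have s: "?s1 \<in> Z1" "?s0 \<notin> Z1" using p_lifts by (auto simp: Z1_eq)
    have cz: "C - Z1 \<in> clopens ?X" "Z1 - C \<in> clopens ?X" "C \<inter> Z1 \<in> clopens ?X"
      using C Z1_clopen by (auto intro: clopens_diff clopens_Int)
    have "C - C \<inter> Z1 = C - Z1" "Z1 - C \<inter> Z1 = Z1 - C" by auto
    then have eq: "\<mu> n C = \<mu> n (C - Z1) + \<mu> n Z1 - \<mu> n (Z1 - C)" for n
      using df[OF C(1) cz(3)] df[OF Z1_clopen cz(3)] by simp
    obtain l1 l2 l3 where "((\<lambda>n. \<mu> n (C - Z1)) \<longlongrightarrow> l1) \<F>" "((\<lambda>n. \<mu> n Z1) \<longlongrightarrow> l2) \<F>" "((\<lambda>n. \<mu> n (Z1 - C)) \<longlongrightarrow> l3) \<F>"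
      using unsplit[OF cz(1)] unsplit[OF cz(2)] Z C s by blast
    then show ?thesis unfolding eq by (intro exI[of _ "l1 + l2 - l3"] tendsto_intros)
  qed
  show ?thesis
  proof (cases "?s1 \<in> C \<longleftrightarrow> ?s0 \<in> C")
    case True
    then show ?thesis using unsplit C by blast
  next
    case False
    have K: "?K \<in> clopens ?X" using clopens_top[of ?X] topspace_at[OF omega_succ order_refl] by simp
    show ?thesis
    proof (cases "?s1 \<in> C")
      case True
      then show ?thesis using split[OF C] False by blast
    next
      case nC: False
      have D: "?K - C \<in> clopens ?X" using K C by (rule clopens_diff)
      have CK: "C \<subseteq> ?K" using clopens_subset[OF C] topspace_at[OF omega_succ order_refl] by simp
      have "?K - (?K - C) = C" using CK by blast
      then have eq: "\<mu> n C = \<mu> n ?K - \<mu> n (?K - C)" for n using df[OF K D] by simp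
      have "?s1 \<in> ?K - C" "?s0 \<notin> ?K - C" using p_lifts nC False by auto
      from split[OF D this] unsplit[OF K] p_lifts
      obtain l1 l2 where "((\<lambda>n. \<mu> n ?K) \<longlongrightarrow> l1) \<F>" "((\<lambda>n. \<mu> n (?K - C)) \<longlongrightarrow> l2) \<F>" by blast
      then show ?thesis unfolding eq by (intro exI[of _ "l1 - l2"] tendsto_intros)
    qed
  qed
qed

end

section \<open>The successor stage\<close>

locale realised =
  fixes \<alpha> P
  assumes \<alpha>: "omega \<le> \<alpha>" and P: "partial_realisation \<alpha> P"

sublocale realised \<subseteq> partial_spaces \<alpha> P
  using P by unfold_locales (simp add: partial_realisation_def)

context realised
begin

lemma sched_bounds:
  assumes "omega \<le> \<theta>" "\<theta> < \<alpha>" "sched P \<theta> = (b, c)" shows "omega \<le> b" "b \<le> \<theta>" "c \<le> \<theta>"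
proof -
  have "schedule_upto \<alpha> P" using P by (simp add: partial_realisation_def)
  then have "omega \<le> b \<and> b \<le> \<theta> \<and> c \<le> \<theta>" using assms unfolding schedule_upto_def by blast
  then show "omega \<le> b" "b \<le> \<theta>" "c \<le> \<theta>" by blast+
qed

lemma clop_range: "omega \<le> b \<Longrightarrow> b < \<alpha> \<Longrightarrow> range (clop P b) = clopen_sequences P b"
  and meas_range: "omega \<le> b \<Longrightarrow> b < \<alpha> \<Longrightarrow> range (meas P b) = admissible_sequences P b"
  using P by (auto simp: partial_realisation_def enumerations_upto_def)

lemma stage_old:
  assumes "omega \<le> \<theta>" "\<theta> < \<alpha>" shows "stage \<alpha> P \<theta> (fst (sched P \<theta>)) (snd (sched P \<theta>))"
proof -
  obtain b c where bc: "sched P \<theta> = (b, c)" by force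
  note b = sched_bounds[OF assms bc]
  have "clop P b c \<in> clopen_sequences P b"
    using clop_range[OF b(1) le_less_trans[OF b(2) assms(2)]] by blast
  then show ?thesis using assms b bc spaces
    by (intro stage.intro stage_axioms.intro partial_spaces.intro) simp_all
qed

lemma meas_admissible:
  assumes "omega \<le> \<theta>" "\<theta> < \<alpha>"
  shows "tv_norm (top_at P \<theta>) (meas P \<theta> \<delta> n) = 1"
    and "variation (top_at P \<theta>) (meas P \<theta> \<delta> n) (Vset P n \<theta> \<theta>) = 1"
proof -
  have "meas P \<theta> \<delta> \<in> admissible_sequences P \<theta>" using meas_range[OF assms] by blast
  then show "tv_norm (top_at P \<theta>) (meas P \<theta> \<delta> n) = 1"
    "variation (top_at P \<theta>) (meas P \<theta> \<delta> n) (Vset P n \<theta> \<theta>) = 1"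
    unfolding admissible_sequences_def by blast+
qed

lemma J_subset: "omega \<le> \<theta> \<Longrightarrow> \<theta> < \<alpha> \<Longrightarrow> \<delta> < \<alpha> \<Longrightarrow> Jset P \<theta> \<delta> \<alpha> \<subseteq> Iset P \<theta> \<alpha>"
  using P unfolding partial_realisation_def condA_def by blast

lemma J_infinite:
  assumes "omega \<le> \<theta>" "\<theta> < \<alpha>" "\<delta> < \<alpha>"
  shows "infinite (Jset P \<theta> \<delta> \<alpha> \<inter> N0set P \<theta> \<delta>)" "infinite (Jset P \<theta> \<delta> \<alpha> \<inter> N1set P \<theta> \<delta>)"
    "infinite (Jset P \<theta> \<delta> \<alpha>)"
proof -
  show "infinite (Jset P \<theta> \<delta> \<alpha> \<inter> N0set P \<theta> \<delta>)" "infinite (Jset P \<theta> \<delta> \<alpha> \<inter> N1set P \<theta> \<delta>)"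
    using P assms unfolding partial_realisation_def condC_def by blast+
  then show "infinite (Jset P \<theta> \<delta> \<alpha>)" by blast
qed

lemma fibrewise_old:
  assumes "omega \<le> \<theta>" "\<theta> < \<alpha>" "C \<in> clopens (top_at P \<alpha>)"
  shows "eventually (\<lambda>n. fibrewise P n \<theta> \<alpha> C) (along (Iset P \<theta> \<alpha>))"
proof (rule stage.eventually_fibrewise[OF stage_old[OF assms(1,2)] less_imp_le[OF assms(2)] order_refl _ assms(3)])
  fix \<gamma> assume \<gamma>: "\<theta> \<le> \<gamma>" "\<gamma> < \<alpha>"
  have "condE \<alpha> P" using P by (simp add: partial_realisation_def)
  then show "\<exists>m. \<forall>n\<in>Iset P \<theta> \<alpha>. m \<le> n \<longrightarrow>
      (\<forall>t\<in>Vset P n \<theta> \<alpha>. \<forall>t'\<in>Vset P n \<theta> \<alpha>. \<pi> \<theta> t = \<pi> \<theta> t' \<longrightarrow> t \<gamma> = t' \<gamma>)"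
    using \<gamma> assms(1) unfolding condE_def by simp
qed

text \<open>By (E), \<open>\<rho> n\<close> and \<open>fibre_value\<close> agree on any given clopen
  set for all large \<open>n\<close> in \<open>J\<close>. The fibre values do not mention
  \<open>\<rho>\<close>, so their limits can be referred to before lifts are given.\<close>

lemma limit_old:
  assumes \<theta>: "omega \<le> \<theta>" "\<theta> < \<alpha>" "\<delta> < \<alpha>" and \<rho>: "\<And>n. \<rho> n \<in> Bset P n \<theta> \<delta> \<alpha>"
  shows "\<exists>\<mu>. signed_measure (top_at P \<alpha>) \<mu> \<and> (\<forall>C\<in>clopens (top_at P \<alpha>).
    ((\<lambda>n. \<rho> n C) \<longlongrightarrow> \<mu> C) (along (Jset P \<theta> \<delta> \<alpha>)) \<and>
    ((\<lambda>n. fibre_value P n \<theta> \<delta> \<alpha> C) \<longlongrightarrow> \<mu> C) (along (Jset P \<theta> \<delta> \<alpha>)))"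
proof -
  let ?X = "top_at P \<alpha>" and ?J = "along (Jset P \<theta> \<delta> \<alpha>)"
  interpret X: boolean_space ?X by (rule boolean_at[OF \<alpha> order_refl])
  interpret stage \<alpha> P \<theta> "fst (sched P \<theta>)" "snd (sched P \<theta>)" by (rule stage_old[OF \<theta>(1,2)])
  have "condF \<alpha> P" using P by (simp add: partial_realisation_def)
  then have "(\<forall>n. \<rho> n \<in> Bset P n \<theta> \<delta> \<alpha>) \<longrightarrow> (\<exists>\<mu>\<in>radon_measures ?X. weak_star_limit ?X \<rho> \<mu> ?J)"
    using \<theta> unfolding condF_def by simp
  then obtain \<mu> where \<mu>: "\<mu> \<in> radon_measures ?X" "weak_star_limit ?X \<rho> \<mu> ?J"
    using \<rho> by blast
  note m = radon_imp_signed[OF \<mu>(1)]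
  have "((\<lambda>n. \<rho> n C) \<longlongrightarrow> \<mu> C) ?J \<and> ((\<lambda>n. fibre_value P n \<theta> \<delta> \<alpha> C) \<longlongrightarrow> \<mu> C) ?J"
    if C: "C \<in> clopens ?X" for C
  proof
    show l: "((\<lambda>n. \<rho> n C) \<longlongrightarrow> \<mu> C) ?J"
      by (rule X.weak_star_limit_clopen[OF \<mu>(2) Bset_signed[OF \<rho>] m C])
    have "eventually (\<lambda>n. fibrewise P n \<theta> \<alpha> C) ?J"
      by (rule filter_leD[OF along_mono fibrewise_old[OF \<theta>(1,2) C]])
        (use J_subset[OF \<theta>] in \<open>simp add: Diff_eq_empty_iff[THEN iffD2]\<close>)
    then have "eventually (\<lambda>n. \<rho> n C = fibre_value P n \<theta> \<delta> \<alpha> C) ?J"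
    proof eventually_elim
      case (elim n)
      then show ?case
        by (intro Bset_value[OF less_imp_le[OF \<theta>(2)] order_refl \<rho> meas_admissible(2)[OF \<theta>(1,2)] C])
    qed
    then show "((\<lambda>n. fibre_value P n \<theta> \<delta> \<alpha> C) \<longlongrightarrow> \<mu> C) ?J"
      using l by (rule Lim_transform_eventually[rotated])
  qed
  then show ?thesis using m by blast
qed

text \<open>The bit says whether the kept index is to lie in N_0 or in N_1, so that (C) survives for
  both.\<close>

definition tasks :: "(omega1 \<times> omega1 \<times> bool) set" where
  "tasks = {(\<theta>, \<delta>, e). omega \<le> \<theta> \<and> \<theta> < \<alpha> \<and> \<delta> < \<alpha>}"

definition Nset :: "bool \<Rightarrow> omega1 \<Rightarrow> omega1 \<Rightarrow> nat set" where
  "Nset e \<theta> \<delta> = (if e then N1set P \<theta> \<delta> else N0set P \<theta> \<delta>)"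

text \<open>The estimate is phrased with \<open>fibre_value\<close> because the index is chosen
  before any lifts are known. It is conditional since the limit is guaranteed by (F) only if lifts
  exist for every index; otherwise (F) is vacuous. The clause \<open>i \<le> n\<close> keeps the set
  of chosen indices infinite.\<close>

definition approximates :: "nat \<Rightarrow> point \<Rightarrow> omega1 \<Rightarrow> omega1 \<Rightarrow> bool \<Rightarrow> point set \<Rightarrow> nat \<Rightarrow> bool" where
  "approximates i p \<theta> \<delta> e A n \<longleftrightarrow> n \<in> Jset P \<theta> \<delta> \<alpha> \<inter> Nset e \<theta> \<delta> \<and> i \<le> n \<and>
     p \<notin> Vset P n \<theta> \<alpha> \<and> fibrewise P n \<theta> \<alpha> A \<and>
     ((\<forall>k. Bset P k \<theta> \<delta> \<alpha> \<noteq> {}) \<longrightarrow>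
       \<bar>fibre_value P n \<theta> \<delta> \<alpha> A - Lim (along (Jset P \<theta> \<delta> \<alpha>)) (\<lambda>k. fibre_value P k \<theta> \<delta> \<alpha> A)\<bar> < 1 / Suc i)"

text \<open>Every clause of \<open>approximates\<close> holds for all large indices in the infinite
  set \<open>?JN\<close>, hence all of them hold together for some index.\<close>

lemma ex_approximates:
  assumes \<tau>: "(\<theta>, \<delta>, e) \<in> tasks" and A: "A \<in> clopens (top_at P \<alpha>)"
  shows "\<exists>n. approximates i p \<theta> \<delta> e A n"
proof -
  have \<theta>: "omega \<le> \<theta>" "\<theta> < \<alpha>" "\<delta> < \<alpha>" using \<tau> by (auto simp: tasks_def)
  interpret stage \<alpha> P \<theta> "fst (sched P \<theta>)" "snd (sched P \<theta>)" by (rule stage_old[OF \<theta>(1,2)])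
  let ?J = "Jset P \<theta> \<delta> \<alpha>" and ?JN = "Jset P \<theta> \<delta> \<alpha> \<inter> Nset e \<theta> \<delta>"
  let ?f = "\<lambda>n. fibre_value P n \<theta> \<delta> \<alpha> A"
  have inf: "infinite ?JN" using J_infinite[OF \<theta>] by (simp add: Nset_def)
  have JNJ: "along ?JN \<le> along ?J" by (rule along_mono) (simp add: Diff_eq_empty_iff[THEN iffD2])
  have "eventually (\<lambda>n. n \<in> ?JN) (along ?JN)" "eventually (\<lambda>n. i \<le> n) (along ?JN)"
    by (auto simp: eventually_along)
  moreover have "eventually (\<lambda>n. p \<notin> Vset P n \<theta> \<alpha>) (along ?JN)"
  proof (cases "\<exists>k. p \<in> Vset P k \<theta> \<alpha>")
    case True
    then obtain k where "p \<in> Vset P k \<theta> \<alpha>" by blast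
    then have "p \<notin> Vset P n \<theta> \<alpha>" if "n \<ge> Suc k" for n using Vset_disjoint[of n k \<alpha>] that by auto
    then show ?thesis unfolding eventually_along by blast
  qed simp
  moreover have "eventually (\<lambda>n. fibrewise P n \<theta> \<alpha> A) (along ?JN)"
    by (rule filter_leD[OF along_mono fibrewise_old[OF \<theta>(1,2) A]])
      (use J_subset[OF \<theta>] in \<open>simp add: Diff_eq_empty_iff[THEN iffD2] le_infI1\<close>)
  moreover have "eventually (\<lambda>n. (\<forall>k. Bset P k \<theta> \<delta> \<alpha> \<noteq> {}) \<longrightarrow> \<bar>?f n - Lim (along ?J) ?f\<bar> < 1 / Suc i) (along ?JN)"
  proof (cases "\<forall>k. Bset P k \<theta> \<delta> \<alpha> \<noteq> {}")
    case True
    then have "\<forall>k. \<exists>\<mu>. \<mu> \<in> Bset P k \<theta> \<delta> \<alpha>" by blast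
    then obtain \<rho> where \<rho>: "\<And>k. \<rho> k \<in> Bset P k \<theta> \<delta> \<alpha>" by metis
    obtain \<mu> where \<mu>: "(?f \<longlongrightarrow> \<mu> A) (along ?J)" using limit_old[OF \<theta> \<rho>] A by blast
    have "(?f \<longlongrightarrow> Lim (along ?J) ?f) (along ?J)"
      using tendsto_Lim[OF along_neq_bot[OF J_infinite(3)[OF \<theta>]] \<mu>] \<mu> by simp
    then have "eventually (\<lambda>n. dist (?f n) (Lim (along ?J) ?f) < 1 / Suc i) (along ?J)"
      by (rule tendstoD) simp
    then show ?thesis using filter_leD[OF JNJ] by (simp add: dist_real_def eventually_mono)
  next
    case False
    then show ?thesis by (intro always_eventually) blast
  qed
  ultimately have "eventually (\<lambda>n. approximates i p \<theta> \<delta> e A n) (along ?JN)"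
    unfolding approximates_def by eventually_elim blast
  then show ?thesis using eventually_happens'[OF along_neq_bot[OF inf]] by blast
qed

end

text \<open>The data chosen at stage \<open>\<alpha>\<close>: \<open>W\<close> is $Z_\alpha \setminus \{p\}$, and \<open>k i\<close> is the index kept in
  $I(\theta, \alpha + 1)$ and $J(\theta, \delta, \alpha + 1)$ at step \<open>i\<close> of the construction of \<open>W\<close>, for the pair
  scheduled by \<open>task i\<close>. Taking $\eta(\alpha) = (\alpha, \alpha)$ makes \<open>U\<close> the sequence $V_n(\alpha, \alpha)$ and the
  Dirac measures at \<open>z n\<close> the sequence to which (G) applies.\<close>

locale extension = realised +
  fixes p :: point and A :: "nat \<Rightarrow> point set" and W :: "point set"
    and task :: "nat \<Rightarrow> omega1 \<times> omega1 \<times> bool" and k :: "nat \<Rightarrow> nat"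
    and U :: "nat \<Rightarrow> point set" and z :: "nat \<Rightarrow> point" and q :: point
    and EU :: "omega1 \<Rightarrow> nat \<Rightarrow> point set" and EM :: "omega1 \<Rightarrow> nat \<Rightarrow> point set \<Rightarrow> real"
  assumes p: "p \<in> spc P \<alpha>" "p \<notin> W"
    and closed_upper: "closedin (top_at P \<alpha>) (insert p W)"
    and closed_lower: "closedin (top_at P \<alpha>) (spc P \<alpha> - W)"
    and A: "incseq A" "\<And>i. A i \<in> clopens (top_at P \<alpha>)" "(\<Union>i. A i) = W"
    and task: "\<And>\<tau>. \<tau> \<in> tasks \<Longrightarrow> infinite {i. task i = \<tau>}"
    and k: "\<And>i \<theta> \<delta> e. task i = (\<theta>, \<delta>, e) \<Longrightarrow> task i \<in> tasks \<Longrightarrow> approximates i p \<theta> \<delta> e (A i) (k i)"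
    and AV: "\<And>i \<theta> \<delta> e. task i = (\<theta>, \<delta>, e) \<Longrightarrow> task i \<in> tasks \<Longrightarrow>
      W \<inter> Vset P (k i) \<theta> \<alpha> = A i \<inter> Vset P (k i) \<theta> \<alpha>"
    and U: "U \<in> clopen_sequences P \<alpha>" "\<And>n. p \<notin> U n" "\<And>n. z n \<in> U n"
    and zW: "infinite {n. z n \<in> W}" "infinite {n. z n \<notin> W}" "\<And>n. z (2 * n) \<notin> W"
    and q: "q \<in> spc P \<alpha> - W" "\<And>d. d < \<alpha> \<Longrightarrow> eventually (\<lambda>n. z (2 * n) d = q d) sequentially"
    and EU: "range EU = clopen_sequences P \<alpha>" "EU \<alpha> = U"
    and EM: "range EM = {\<nu>. \<forall>n. \<nu> n \<in> radon_measures (top_at P \<alpha>) \<and> tv_norm (top_at P \<alpha>) (\<nu> n) = 1 \<and>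
        variation (top_at P \<alpha>) (\<nu> n) (U n) = 1 \<and>
        tv_norm (top_at P \<alpha>) (pos_part (top_at P \<alpha>) (\<nu> n)) \<ge> 1/2}"
      "\<And>\<delta>. \<delta> \<le> \<alpha> \<Longrightarrow> EM \<delta> = (\<lambda>n. dirac (top_at P \<alpha>) (z n))"
begin

text \<open>The index sets are left as in \<open>P\<close> here: the sets J for the pairs (\<theta>,
  \<alpha>) come from subsequences along which lifts to the new space converge, so this space has to
  exist first.\<close>

definition P1 :: realisation where
  "P1 = P\<lparr>spc := (spc P)(osucc \<alpha> := append_bit \<alpha> (spc P \<alpha> - W) False \<union> append_bit \<alpha> (insert p W) True),
     lower := (lower P)(\<alpha> := spc P \<alpha> - W), upper := (upper P)(\<alpha> := insert p W),
     sched := (sched P)(\<alpha> := (\<alpha>, \<alpha>)), clop := (clop P)(\<alpha> := EU), meas := (meas P)(\<alpha> := EM)\<rparr>"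

lemma spc_P1: "\<beta> \<le> \<alpha> \<Longrightarrow> spc P1 \<beta> = spc P \<beta>"
  using less_osucc[of \<alpha>] by (auto simp: P1_def)

lemma top_P1: "\<beta> \<le> \<alpha> \<Longrightarrow> top_at P1 \<beta> = top_at P \<beta>"
  by (simp add: top_at_def spc_P1)

lemma P1_simps:
  "spc P1 (osucc \<alpha>) = append_bit \<alpha> (spc P \<alpha> - W) False \<union> append_bit \<alpha> (insert p W) True"
  "lower P1 \<alpha> = spc P \<alpha> - W" "upper P1 \<alpha> = insert p W" "sched P1 \<alpha> = (\<alpha>, \<alpha>)" "clop P1 \<alpha> = EU" "meas P1 \<alpha> = EM"
  "\<beta> < \<alpha> \<Longrightarrow> lower P1 \<beta> = lower P \<beta>" "\<beta> < \<alpha> \<Longrightarrow> upper P1 \<beta> = upper P \<beta>" "\<beta> < \<alpha> \<Longrightarrow> sched P1 \<beta> = sched P \<beta>"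
  "\<beta> < \<alpha> \<Longrightarrow> clop P1 \<beta> = clop P \<beta>" "\<beta> < \<alpha> \<Longrightarrow> meas P1 \<beta> = meas P \<beta>"
  by (auto simp: P1_def)

lemma Vset_P1: "omega \<le> \<theta> \<Longrightarrow> \<theta> < \<alpha> \<Longrightarrow> \<beta> \<le> \<alpha> \<Longrightarrow> Vset P1 n \<theta> \<beta> = Vset P n \<theta> \<beta>"
proof -
  assume \<theta>: "omega \<le> \<theta>" "\<theta> < \<alpha>" "\<beta> \<le> \<alpha>"
  obtain b c where bc: "sched P \<theta> = (b, c)" by force
  have "b < \<alpha>" using sched_bounds(2)[OF \<theta>(1,2) bc] \<theta>(2) by simp
  then show ?thesis using \<theta> bc by (simp add: Vset_def P1_simps spc_P1)
qed

lemma Bset_P1: "\<theta> < \<alpha> \<Longrightarrow> \<beta> \<le> \<alpha> \<Longrightarrow> Bset P1 n \<theta> \<delta> \<beta> = Bset P n \<theta> \<delta> \<beta>"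
  by (simp add: Bset_def top_P1 P1_simps)

lemma append_continuous:
  "continuous_map (cube {..<\<alpha>}) (cube {..<osucc \<alpha>}) (\<lambda>t. t(\<alpha> := b))"
  unfolding cube_def[of "{..<osucc \<alpha>}"] continuous_map_componentwise
proof (intro conjI ballI)
  show "(\<lambda>t. t(\<alpha> := b)) ` topspace (cube {..<\<alpha>}) \<subseteq> extensional {..<osucc \<alpha>}"
    by (auto simp: topspace_cube lessThan_osucc extensional_def PiE_def)
  fix d assume "d \<in> {..<osucc \<alpha>}"
  then have "d = \<alpha> \<or> d \<noteq> \<alpha> \<and> d \<in> {..<\<alpha>}" by (auto simp: lessThan_osucc)
  then show "continuous_map (cube {..<\<alpha>}) (discrete_topology UNIV) (\<lambda>x. (x(\<alpha> := b)) d)"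
    using continuous_coordinate[of d "{..<\<alpha>}"] by auto
qed

lemma compactin_append:
  assumes "closedin (top_at P \<alpha>) Y"
  shows "compactin (cube {..<osucc \<alpha>}) (append_bit \<alpha> Y b)"
proof -
  have "compactin (top_at P \<alpha>) Y"
    using closedin_compact_space[OF boolean_space.compact[OF boolean_at[OF \<alpha> order_refl]] assms] .
  then have "compactin (cube {..<\<alpha>}) Y" by (simp add: top_at_def compactin_subtopology)
  then show ?thesis unfolding append_bit_def using append_continuous by (rule image_compactin)
qed

lemma W_subset: "W \<subseteq> spc P \<alpha>"
  using closedin_subset[OF closed_upper] topspace_at[OF \<alpha> order_refl] by simp

lemma spaces_P1: "spaces_upto (osucc \<alpha>) P1"
  unfolding spaces_upto_def
proof (intro conjI allI impI)
  fix \<beta> assume \<beta>: "omega \<le> \<beta> \<and> \<beta> \<le> osucc \<alpha>"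
  show "compactin (cube {..<\<beta>}) (spc P1 \<beta>)"
  proof (cases "\<beta> = osucc \<alpha>")
    case True
    then show ?thesis
      by (simp add: P1_simps compactin_Un compactin_append closed_lower closed_upper)
  next
    case False
    then have "\<beta> \<le> \<alpha>" using \<beta> le_osucc_iff by blast
    then show ?thesis using compactin_spc \<beta> spc_P1 by simp
  qed
next
  show "spc P1 omega = topspace (cube {..<omega})"
    using spaces spc_P1[OF \<alpha>] by (simp add: spaces_upto_def)
next
  fix \<beta> assume \<beta>: "omega \<le> \<beta> \<and> \<beta> < osucc \<alpha>"
  then have le: "\<beta> \<le> \<alpha>" by (simp add: less_osucc_iff)
  have "closedin (top_at P1 \<beta>) (lower P1 \<beta>) \<and> closedin (top_at P1 \<beta>) (upper P1 \<beta>) \<and>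
      lower P1 \<beta> \<union> upper P1 \<beta> = spc P1 \<beta> \<and>
      spc P1 (osucc \<beta>) = append_bit \<beta> (lower P1 \<beta>) False \<union> append_bit \<beta> (upper P1 \<beta>) True"
  proof (cases "\<beta> = \<alpha>")
    case True
    then show ?thesis using closed_lower closed_upper p W_subset
      by (auto simp: P1_simps top_P1 spc_P1)
  next
    case False
    then have lt: "\<beta> < \<alpha>" using le by simp
    then have "spc P1 (osucc \<beta>) = spc P (osucc \<beta>)" by (intro spc_P1) (simp add: osucc_le_iff)
    then show ?thesis using spaces \<beta> lt le by (auto simp: spaces_upto_def P1_simps top_P1 spc_P1)
  qed
  then show "closedin (top_at P1 \<beta>) (lower P1 \<beta>)" "closedin (top_at P1 \<beta>) (upper P1 \<beta>)"
    "lower P1 \<beta> \<union> upper P1 \<beta> = spc P1 \<beta>"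
    "spc P1 (osucc \<beta>) = append_bit \<beta> (lower P1 \<beta>) False \<union> append_bit \<beta> (upper P1 \<beta>) True" by blast+
next
  fix \<rho> assume \<rho>: "limit_ordinal \<rho> \<and> omega < \<rho> \<and> \<rho> \<le> osucc \<alpha>"
  then have "\<rho> \<noteq> osucc \<alpha>" using not_limit_osucc by blast
  then have le: "\<rho> \<le> \<alpha>" using \<rho> le_osucc_iff by blast
  then have "spc P1 \<rho> = {t \<in> topspace (cube {..<\<rho>}). \<forall>\<beta>. omega \<le> \<beta> \<and> \<beta> < \<rho> \<longrightarrow> \<pi> \<beta> t \<in> spc P \<beta>}"
    using spaces \<rho> spc_P1 by (simp add: spaces_upto_def)
  then show "spc P1 \<rho> = {t \<in> topspace (cube {..<\<rho>}). \<forall>\<beta>. omega \<le> \<beta> \<and> \<beta> < \<rho> \<longrightarrow> \<pi> \<beta> t \<in> spc P1 \<beta>}"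
    using le spc_P1 by force
qed

end

sublocale extension \<subseteq> Q: split_space \<alpha> P1 p
  using spaces_P1 \<alpha> p W_subset by unfold_locales (auto simp: P1_simps)

context extension
begin

lemma stage_P1:
  assumes \<theta>: "omega \<le> \<theta>" "\<theta> \<le> \<alpha>"
  shows "stage (osucc \<alpha>) P1 \<theta> (fst (sched P1 \<theta>)) (snd (sched P1 \<theta>))"
proof -
  obtain b c where bc: "sched P1 \<theta> = (b, c)" by force
  have b: "omega \<le> b \<and> b \<le> \<theta> \<and> clop P1 b c \<in> clopen_sequences P1 b"
  proof (cases "\<theta> = \<alpha>")
    case True
    then have "b = \<alpha>" "c = \<alpha>" using bc by (auto simp: P1_simps)
    then show ?thesis using True \<alpha> EU(1) by (auto simp: P1_simps clopen_sequences_def top_P1)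
  next
    case False
    then have lt: "\<theta> < \<alpha>" using \<theta> by simp
    then have bc': "sched P \<theta> = (b, c)" using bc by (simp add: P1_simps)
    note b = sched_bounds[OF \<theta>(1) lt bc']
    have "clop P b c \<in> clopen_sequences P b" using clop_range[OF b(1) le_less_trans[OF b(2) lt]] by blast
    then show ?thesis using b lt by (simp add: P1_simps clopen_sequences_def top_P1)
  qed
  then show ?thesis using \<theta> bc Q.le_succ spaces_P1
    by (intro stage.intro stage_axioms.intro partial_spaces.intro) (auto intro: order_trans)
qed

lemma Vset_top: "Vset P1 n \<alpha> \<alpha> = U n"
proof -
  have "U n \<subseteq> spc P \<alpha>"
    using U(1) openin_subset topspace_at[OF \<alpha> order_refl] by (fastforce simp: clopen_sequences_def)
  moreover have "\<pi> \<alpha> t = t" if "t \<in> spc P \<alpha>" for t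
    using \<pi>_id spc_subset[OF \<alpha> order_refl] that by blast
  ultimately show ?thesis by (auto simp: Vset_def P1_simps spc_P1 EU(2))
qed

lemma admissible_top: "range EM = admissible_sequences P1 \<alpha>"
  unfolding admissible_sequences_def EM(1) by (simp add: Vset_top top_P1)

lemma meas_P1:
  assumes \<theta>: "omega \<le> \<theta>" "\<theta> \<le> \<alpha>"
  shows "tv_norm (top_at P1 \<theta>) (meas P1 \<theta> \<delta> n) = 1"
    and "variation (top_at P1 \<theta>) (meas P1 \<theta> \<delta> n) (Vset P1 n \<theta> \<theta>) = 1"
proof -
  have "tv_norm (top_at P1 \<theta>) (meas P1 \<theta> \<delta> n) = 1 \<and>
    variation (top_at P1 \<theta>) (meas P1 \<theta> \<delta> n) (Vset P1 n \<theta> \<theta>) = 1"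
  proof (cases "\<theta> = \<alpha>")
    case True
    have "EM \<delta> \<in> admissible_sequences P1 \<alpha>" using admissible_top by blast
    then show ?thesis using True by (simp add: admissible_sequences_def P1_simps)
  next
    case False
    then have "\<theta> < \<alpha>" using \<theta> by simp
    then show ?thesis using meas_admissible[OF \<theta>(1)] \<theta> by (simp add: P1_simps top_P1 Vset_P1)
  qed
  then show "tv_norm (top_at P1 \<theta>) (meas P1 \<theta> \<delta> n) = 1"
    "variation (top_at P1 \<theta>) (meas P1 \<theta> \<delta> n) (Vset P1 n \<theta> \<theta>) = 1" by blast+
qed

text \<open>At \<open>\<theta> = \<alpha>\<close> no index need be dropped, since the sets
  \<open>U n\<close> avoid \<open>p\<close> and the fibres over them are single points. Below, one
  set collects the kept indices of all \<open>\<delta>\<close>, because I does not depend on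
  \<open>\<delta>\<close>.\<close>

definition I1 :: "omega1 \<Rightarrow> nat set" where
  "I1 \<theta> = (if \<theta> = \<alpha> then UNIV else {k i | i \<delta> e. task i = (\<theta>, \<delta>, e) \<and> task i \<in> tasks})"

lemma I1_cases:
  assumes "\<theta> < \<alpha>" "n \<in> I1 \<theta>"
  obtains i \<delta> e where "n = k i" "task i = (\<theta>, \<delta>, e)" "task i \<in> tasks"
  using assms unfolding I1_def by (auto split: if_splits)

definition J1 :: "omega1 \<Rightarrow> omega1 \<Rightarrow> nat set" where
  "J1 \<theta> \<delta> = {k i | i e. task i = (\<theta>, \<delta>, e) \<and> task i \<in> tasks}"

lemma J1_subset: "\<theta> < \<alpha> \<Longrightarrow> J1 \<theta> \<delta> \<subseteq> I1 \<theta>" "J1 \<theta> \<delta> \<subseteq> Jset P \<theta> \<delta> \<alpha>"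
  using k by (auto simp: J1_def I1_def approximates_def)

lemma I1_subset: "\<theta> < \<alpha> \<Longrightarrow> I1 \<theta> \<subseteq> Iset P \<theta> \<alpha>"
proof
  fix n assume "\<theta> < \<alpha>" "n \<in> I1 \<theta>"
  then obtain i \<delta> e where i: "n = k i" "task i = (\<theta>, \<delta>, e)" "task i \<in> tasks" by (rule I1_cases)
  then have "n \<in> Jset P \<theta> \<delta> \<alpha>" using k[OF i(2,3)] by (simp add: approximates_def)
  then show "n \<in> Iset P \<theta> \<alpha>" using J_subset i(2,3) by (auto simp: tasks_def)
qed

lemma J1_infinite:
  assumes \<theta>: "omega \<le> \<theta>" "\<theta> < \<alpha>" "\<delta> < \<alpha>"
  shows "infinite (J1 \<theta> \<delta> \<inter> Nset e \<theta> \<delta>)"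
  unfolding infinite_nat_iff_unbounded_le
proof
  fix m
  have \<tau>: "(\<theta>, \<delta>, e) \<in> tasks" using \<theta> by (simp add: tasks_def)
  then obtain i where i: "i \<ge> m" "task i = (\<theta>, \<delta>, e)"
    using task[OF \<tau>] by (auto simp: infinite_nat_iff_unbounded_le)
  then have "approximates i p \<theta> \<delta> e (A i) (k i)" using k \<tau> by simp
  then show "\<exists>n\<ge>m. n \<in> J1 \<theta> \<delta> \<inter> Nset e \<theta> \<delta>"
    using i \<tau> by (intro exI[of _ "k i"]) (auto simp: approximates_def J1_def)
qed

lemma Vset_succ:
  assumes "omega \<le> \<theta>" "\<theta> < \<alpha>" "t \<in> Vset P1 n \<theta> (osucc \<alpha>)"
  shows "\<pi> \<alpha> t \<in> Vset P n \<theta> \<alpha>" "t \<in> spc P1 (osucc \<alpha>)"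
proof -
  interpret stage "osucc \<alpha>" P1 \<theta> "fst (sched P1 \<theta>)" "snd (sched P1 \<theta>)"
    using assms by (intro stage_P1) auto
  have le: "\<theta> \<le> \<alpha>" "\<theta> \<le> osucc \<alpha>" using assms Q.le_succ by auto
  show t: "t \<in> spc P1 (osucc \<alpha>)" using assms(3) Vset_eq[OF le(2) order_refl] by blast
  have "\<pi> \<theta> t \<in> Vset P1 n \<theta> \<theta>" using assms(3) Vset_eq[OF le(2) order_refl] by blast
  moreover have "\<pi> \<alpha> t \<in> spc P1 \<alpha>" using Q.\<pi>_spc[OF \<alpha> Q.le_succ order_refl t] .
  ultimately have "\<pi> \<alpha> t \<in> Vset P1 n \<theta> \<alpha>"
    using Vset_eq[OF le(1) Q.le_succ] \<pi>_\<pi>[OF le(1)] by simp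
  then show "\<pi> \<alpha> t \<in> Vset P n \<theta> \<alpha>" using Vset_P1 assms by simp
qed

text \<open>Over this V_n the split point is absent and \<open>W\<close> coincides with the clopen
  set \<open>A i\<close>. So the new coordinate carries only information already present at level
  \<open>\<alpha>\<close>.\<close>

lemma top_bit:
  assumes i: "task i = (\<theta>, \<delta>, e)" "task i \<in> tasks" and t: "t \<in> Vset P1 (k i) \<theta> (osucc \<alpha>)"
  shows "t \<alpha> \<longleftrightarrow> \<pi> \<alpha> t \<in> A i"
proof -
  have \<theta>: "omega \<le> \<theta>" "\<theta> < \<alpha>" using i by (auto simp: tasks_def)
  note V = Vset_succ[OF \<theta> t]
  have "p \<notin> Vset P (k i) \<theta> \<alpha>" using k[OF i] by (simp add: approximates_def)
  then have "\<pi> \<alpha> t \<noteq> p" using V by blast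
  then have "t \<alpha> \<longleftrightarrow> \<pi> \<alpha> t \<in> W"
    using Q.succ_upper[OF V(2)] Q.succ_lower[OF V(2)] by (auto simp: P1_simps)
  then show ?thesis using AV[OF i] V by blast
qed

text \<open>For \<open>\<theta> = \<alpha>\<close> the fibres are single points. For
  \<open>\<theta> < \<alpha>\<close> the coordinates below \<open>\<alpha>\<close> inherit (E),
  while coordinate \<open>\<alpha>\<close> is membership in \<open>A i\<close>, and the kept index
  was chosen so that \<open>A i\<close> is fibrewise.\<close>

lemma E_new:
  assumes \<theta>: "omega \<le> \<theta>" "\<theta> \<le> \<alpha>" and \<gamma>: "\<theta> \<le> \<gamma>" "\<gamma> < osucc \<alpha>"
  shows "\<exists>m. \<forall>n\<in>I1 \<theta>. n \<ge> m \<longrightarrow>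
    (\<forall>t\<in>Vset P1 n \<theta> (osucc \<alpha>). \<forall>t'\<in>Vset P1 n \<theta> (osucc \<alpha>). \<pi> \<theta> t = \<pi> \<theta> t' \<longrightarrow> t \<gamma> = t' \<gamma>)"
proof (cases "\<theta> = \<alpha>")
  case True
  interpret stage "osucc \<alpha>" P1 \<theta> "fst (sched P1 \<theta>)" "snd (sched P1 \<theta>)" using \<theta> by (rule stage_P1)
  have "t = t'" if t: "t \<in> Vset P1 n \<theta> (osucc \<alpha>)" "t' \<in> Vset P1 n \<theta> (osucc \<alpha>)" "\<pi> \<theta> t = \<pi> \<theta> t'" for n t t'
  proof -
    have le: "\<theta> \<le> osucc \<alpha>" using \<theta> Q.le_succ by simp
    have "t \<in> spc P1 (osucc \<alpha>)" "t' \<in> spc P1 (osucc \<alpha>)" "\<pi> \<alpha> t \<in> U n"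
      using t Vset_eq[OF le order_refl] Vset_top True by auto
    then show ?thesis using Q.fibre_unique[of t t'] t(3) U(2) True by metis
  qed
  then show ?thesis by metis
next
  case False
  then have lt: "\<theta> < \<alpha>" using \<theta> by simp
  show ?thesis
  proof (cases "\<gamma> = \<alpha>")
    case True
    have "t \<gamma> = t' \<gamma>" if n: "n \<in> I1 \<theta>" and t: "t \<in> Vset P1 n \<theta> (osucc \<alpha>)" "t' \<in> Vset P1 n \<theta> (osucc \<alpha>)" "\<pi> \<theta> t = \<pi> \<theta> t'" for n t t'
    proof -
      obtain i \<delta> e where i: "n = k i" "task i = (\<theta>, \<delta>, e)" "task i \<in> tasks" using lt n by (rule I1_cases)
      have "fibrewise P n \<theta> \<alpha> (A i)" using k[OF i(2,3)] i(1) by (simp add: approximates_def)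
      moreover have "\<pi> \<theta> (\<pi> \<alpha> t) = \<pi> \<theta> (\<pi> \<alpha> t')" using t(3) \<pi>_\<pi>[OF \<theta>(2)] by simp
      ultimately have "\<pi> \<alpha> t \<in> A i \<longleftrightarrow> \<pi> \<alpha> t' \<in> A i"
        unfolding fibrewise_def using Vset_succ[OF \<theta>(1) lt] t by blast
      then show ?thesis using top_bit[OF i(2,3)] t i(1) True by blast
    qed
    then show ?thesis by blast
  next
    case False
    then have \<gamma>': "\<gamma> < \<alpha>" using \<gamma> by (simp add: less_osucc_iff)
    have "condE \<alpha> P" using P by (simp add: partial_realisation_def)
    then obtain m where m: "\<forall>n\<in>Iset P \<theta> \<alpha>. n \<ge> m \<longrightarrow>
      (\<forall>t\<in>Vset P n \<theta> \<alpha>. \<forall>t'\<in>Vset P n \<theta> \<alpha>. \<pi> \<theta> t = \<pi> \<theta> t' \<longrightarrow> t \<gamma> = t' \<gamma>)"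
      using \<theta> \<gamma> \<gamma>' unfolding condE_def by (metis order_refl)
    have "t \<gamma> = t' \<gamma>" if n: "n \<in> I1 \<theta>" "n \<ge> m" and t: "t \<in> Vset P1 n \<theta> (osucc \<alpha>)" "t' \<in> Vset P1 n \<theta> (osucc \<alpha>)" "\<pi> \<theta> t = \<pi> \<theta> t'" for n t t'
    proof -
      have "\<pi> \<theta> (\<pi> \<alpha> t) = \<pi> \<theta> (\<pi> \<alpha> t')" using t(3) \<pi>_\<pi>[OF \<theta>(2)] by simp
      then have "\<pi> \<alpha> t \<gamma> = \<pi> \<alpha> t' \<gamma>"
        using m n I1_subset[OF lt] Vset_succ[OF \<theta>(1) lt] t by blast
      then show ?thesis using \<pi>_apply[OF \<gamma>'] by simp
    qed
    then show ?thesis by blast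
  qed
qed

lemma fibrewise_new:
  assumes \<theta>: "omega \<le> \<theta>" "\<theta> \<le> \<alpha>" and C: "C \<in> clopens (top_at P1 (osucc \<alpha>))"
  shows "eventually (\<lambda>n. fibrewise P1 n \<theta> (osucc \<alpha>) C) (along (I1 \<theta>))"
  using \<theta> Q.le_succ C E_new[OF \<theta>] by (intro stage.eventually_fibrewise[OF stage_P1[OF \<theta>]]) auto

end

lemma split_infinite:
  assumes "infinite (J :: nat set)"
  shows "\<exists>A B. A \<inter> B = {} \<and> infinite (J \<inter> A) \<and> infinite (J \<inter> B)"
proof -
  obtain e :: "nat \<Rightarrow> nat" where e: "strict_mono e" "range e = J"
    using range_enumerate[OF assms] strict_mono_enumerate[OF assms] by blast
  have i: "inj e" using e(1) strict_mono_imp_inj_on by blast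
  let ?A = "e ` {n. even n}" and ?B = "e ` {n. odd n}"
  have "{n::nat. even n} = range (\<lambda>n. 2 * n)" "{n::nat. odd n} = range (\<lambda>n. 2 * n + 1)"
    by (auto elim: evenE oddE)
  moreover have "infinite (range (\<lambda>n::nat. 2 * n))" "infinite (range (\<lambda>n::nat. 2 * n + 1))"
    by (intro range_inj_infinite; simp add: inj_def)+
  ultimately have "infinite {n::nat. even n}" "infinite {n::nat. odd n}" by simp_all
  then have "infinite ?A" "infinite ?B"
    using finite_imageD[OF _ inj_on_subset[OF i subset_UNIV]] by blast+
  moreover have "J \<inter> ?A = ?A" "J \<inter> ?B = ?B" using e(2) by blast+
  moreover have "?A \<inter> ?B = e ` ({n. even n} \<inter> {n. odd n})" by (rule image_Int[OF i, symmetric])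
  then have "?A \<inter> ?B = {}" by auto
  ultimately show ?thesis by (intro exI[of _ ?A] exI[of _ ?B]) simp
qed

section \<open>Behaviour of the lifts at the new rank\<close>

context extension
begin

lemma Bset_old:
  assumes \<theta>: "omega \<le> \<theta>" "\<theta> < \<alpha>" and \<mu>: "\<mu> \<in> Bset P1 n \<theta> \<delta> (osucc \<alpha>)"
  shows "push_forward (top_at P1 (osucc \<alpha>)) (top_at P \<alpha>) (\<pi> \<alpha>) \<mu> \<in> Bset P n \<theta> \<delta> \<alpha>"
proof -
  have le: "\<theta> \<le> \<alpha>" using \<theta> by simp
  interpret stage "osucc \<alpha>" P1 \<theta> "fst (sched P1 \<theta>)" "snd (sched P1 \<theta>)" using \<theta>(1) le by (rule stage_P1)
  show ?thesis
    using Bset_push[OF le Q.le_succ order_refl \<mu> meas_P1(1)[OF \<theta>(1) le]]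
    by (simp add: top_P1 Bset_P1 \<theta>(2))
qed

text \<open>Clopen sets from below converge by the old (F), so only \<open>Q.Z1\<close> has to be
  treated. At the index kept in step \<open>i\<close> its mass is the old fibre value of
  \<open>A i\<close>, hence within 1/(i + 1) of \<open>\<nu> (A i)\<close>, and these tend to
  \<open>\<nu> W\<close> by continuity of \<open>\<nu>\<close> along the increasing sets
  \<open>A i\<close>.\<close>

lemma F_old:
  assumes \<theta>: "omega \<le> \<theta>" "\<theta> < \<alpha>" "\<delta> < \<alpha>" and \<mu>: "\<And>n. \<mu> n \<in> Bset P1 n \<theta> \<delta> (osucc \<alpha>)"
  shows "\<exists>\<mu>'\<in>radon_measures (top_at P1 (osucc \<alpha>)). weak_star_limit (top_at P1 (osucc \<alpha>)) \<mu> \<mu>' (along (J1 \<theta> \<delta>))"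
proof -
  let ?X = "top_at P \<alpha>" and ?X' = "top_at P1 (osucc \<alpha>)" and ?F = "along (J1 \<theta> \<delta>)"
  let ?f = "\<lambda>A n. fibre_value P n \<theta> \<delta> \<alpha> A"
  have le: "\<theta> \<le> \<alpha>" "\<theta> \<le> osucc \<alpha>" using \<theta> Q.le_succ by auto
  interpret stage "osucc \<alpha>" P1 \<theta> "fst (sched P1 \<theta>)" "snd (sched P1 \<theta>)" using \<theta>(1) le(1) by (rule stage_P1)
  interpret o: stage \<alpha> P \<theta> "fst (sched P \<theta>)" "snd (sched P \<theta>)" by (rule stage_old[OF \<theta>(1,2)])
  have J1inf: "infinite (J1 \<theta> \<delta>)" using J1_infinite[OF \<theta>] by blast
  have J1J: "?F \<le> along (Jset P \<theta> \<delta> \<alpha>)"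
    using J1_subset(2) by (intro along_mono) (simp add: Diff_eq_empty_iff[THEN iffD2])
  define \<rho> where "\<rho> n = push_forward ?X' ?X (\<pi> \<alpha>) (\<mu> n)" for n
  have \<rho>: "\<rho> n \<in> Bset P n \<theta> \<delta> \<alpha>" for n unfolding \<rho>_def by (rule Bset_old[OF \<theta>(1,2) \<mu>])
  have \<rho>_eq: "\<rho> n C = \<mu> n {t \<in> spc P1 (osucc \<alpha>). \<pi> \<alpha> t \<in> C}" if "C \<in> clopens ?X" for n C
    using clopens_borel[OF that] Q.topspace_at[OF Q.omega_succ order_refl] by (simp add: \<rho>_def push_forward_def)
  obtain \<nu> where \<nu>: "signed_measure ?X \<nu>"
    and l1: "\<And>C. C \<in> clopens ?X \<Longrightarrow> ((\<lambda>n. \<rho> n C) \<longlongrightarrow> \<nu> C) (along (Jset P \<theta> \<delta> \<alpha>))"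
    and l2: "\<And>C. C \<in> clopens ?X \<Longrightarrow> (?f C \<longlongrightarrow> \<nu> C) (along (Jset P \<theta> \<delta> \<alpha>))"
    using limit_old[OF \<theta> \<rho>] by blast
  have Lim: "Lim (along (Jset P \<theta> \<delta> \<alpha>)) (?f C) = \<nu> C" if "C \<in> clopens ?X" for C
    using tendsto_Lim[OF along_neq_bot[OF J_infinite(3)[OF \<theta>]] l2[OF that]] .
  have key: "\<bar>\<mu> (k i) Q.Z1 - \<nu> (A i)\<bar> < 1 / Suc i" if i: "task i = (\<theta>, \<delta>, e)" "task i \<in> tasks" for i e
  proof -
    let ?V = "Vset P1 (k i) \<theta> (osucc \<alpha>)" and ?P = "{t \<in> spc P1 (osucc \<alpha>). \<pi> \<alpha> t \<in> A i}"
    note m = Bset_signed[OF \<mu>]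
    have V: "?V \<in> clopens ?X'" by (rule Vset_clopen[OF le(2) order_refl])
    have Pc: "?P \<in> clopens ?X'"
    proof -
      have "openin ?X (A i)" "closedin ?X (A i)" using A(2)[of i] by (auto simp: clopens_def)
      then show ?thesis
        using openin_continuous_map_preimage[OF Q.continuous_\<pi>_at[OF \<alpha> Q.le_succ order_refl], of "A i"]
          closedin_continuous_map_preimage[OF Q.continuous_\<pi>_at[OF \<alpha> Q.le_succ order_refl], of "A i"]
        by (simp add: clopens_def top_P1 Q.topspace_at[OF Q.omega_succ order_refl])
    qed
    have conc: "\<mu> (k i) C = \<mu> (k i) (C \<inter> ?V)" if C: "C \<in> clopens ?X'" for C
    proof -
      have "\<mu> (k i) (C - ?V) = 0"
        using clopens_borel[OF clopens_diff[OF C V]]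
        by (intro Bset_concentrated[OF le(2) order_refl \<mu> meas_P1(2)[OF \<theta>(1) le(1)]]) auto
      moreover have "\<mu> (k i) ((C \<inter> ?V) \<union> (C - ?V)) = \<mu> (k i) (C \<inter> ?V) + \<mu> (k i) (C - ?V)"
        using C V by (intro signed_measure_additive[OF m] clopens_borel clopens_Int clopens_diff) auto
      moreover have "(C \<inter> ?V) \<union> (C - ?V) = C" by blast
      ultimately show ?thesis by simp
    qed
    \<comment> \<open>The two sets may differ elsewhere, but the lift is concentrated on
      \<open>?V\<close>.\<close>
    have "Q.Z1 \<inter> ?V = ?P \<inter> ?V"
      using top_bit[OF i] Vset_succ(2)[OF \<theta>(1,2)] unfolding Q.Z1_eq by blast
    then have "\<mu> (k i) Q.Z1 = \<mu> (k i) ?P" using conc[OF Q.Z1_clopen] conc[OF Pc] by simp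
    also have "\<dots> = \<rho> (k i) (A i)" using \<rho>_eq[OF A(2)] by simp
    also have "\<dots> = ?f (A i) (k i)"
      using k[OF i] by (intro o.Bset_value[OF le(1) order_refl \<rho> meas_admissible(2)[OF \<theta>(1,2)] A(2)])
        (simp add: approximates_def)
    finally have eq: "\<mu> (k i) Q.Z1 = ?f (A i) (k i)" .
    have "\<forall>n. Bset P n \<theta> \<delta> \<alpha> \<noteq> {}" using \<rho> by blast
    then show ?thesis using k[OF i] Lim[OF A(2)[of i]] unfolding eq approximates_def by simp
  qed
  have "((\<lambda>n. \<mu> n Q.Z1) \<longlongrightarrow> \<nu> W) ?F"
  proof (rule tendstoI)
    fix \<epsilon> :: real assume \<epsilon>: "\<epsilon> > 0"
    have "(\<lambda>i. \<nu> (A i)) \<longlonglongrightarrow> \<nu> W"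
      using signed_measure_incseq[OF \<nu> _ A(1)] A(2) clopens_borel unfolding A(3) by blast
    then obtain i1 where i1: "\<And>i. i \<ge> i1 \<Longrightarrow> dist (\<nu> (A i)) (\<nu> W) < \<epsilon> / 2"
      using \<epsilon> by (meson half_gt_zero metric_LIMSEQ_D)
    obtain i2 where i2: "1 / real (Suc i2) < \<epsilon> / 2" using nat_approx_posE[of "\<epsilon> / 2"] \<epsilon> by auto
    define i0 where "i0 = max i1 i2"
    \<comment> \<open>Past \<open>m\<close> no index was kept at a step up to \<open>i0\<close>. The
      map \<open>k\<close> need not be monotone, so a maximum over the early steps is taken.\<close>
    define m where "m = Suc (Max (k ` {..i0}))"
    have "dist (\<mu> n Q.Z1) (\<nu> W) < \<epsilon>" if n: "n \<ge> m" "n \<in> J1 \<theta> \<delta>" for n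
    proof -
      obtain i e where i: "n = k i" "task i = (\<theta>, \<delta>, e)" "task i \<in> tasks" using n(2) by (auto simp: J1_def)
      have "\<not> i \<le> i0"
      proof
        assume "i \<le> i0"
        then have "k i \<le> Max (k ` {..i0})" by (intro Max_ge) auto
        then show False using n(1) i(1) by (simp add: m_def)
      qed
      then have ii: "i \<ge> i1" "i \<ge> i2" by (auto simp: i0_def)
      have "1 / real (Suc i) \<le> 1 / real (Suc i2)" using ii(2) by (simp add: frac_le)
      then have "\<bar>\<mu> n Q.Z1 - \<nu> (A i)\<bar> < \<epsilon> / 2" using key[OF i(2,3)] i2 i(1) by simp
      then show ?thesis using i1[OF ii(1)] unfolding dist_real_def by linarith
    qed
    then show "eventually (\<lambda>n. dist (\<mu> n Q.Z1) (\<nu> W) < \<epsilon>) ?F" unfolding eventually_along by blast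
  qed
  then have Z: "\<exists>l. ((\<lambda>n. \<mu> n Q.Z1) \<longlongrightarrow> l) ?F" by blast
  show ?thesis
  proof (rule weak_star_criterion[OF le(2) order_refl J1inf \<mu>])
    fix C assume C: "C \<in> clopens ?X'"
    show "\<exists>l. ((\<lambda>n. \<mu> n C) \<longlongrightarrow> l) ?F"
    proof (rule Q.convergence_succ[OF Bset_signed[OF \<mu>] _ Z C])
      fix D assume "D \<in> clopens (top_at P1 \<alpha>)"
      then have D: "D \<in> clopens ?X" by (simp add: top_P1)
      show "\<exists>l. ((\<lambda>n. \<mu> n {t \<in> spc P1 (osucc \<alpha>). \<pi> \<alpha> t \<in> D}) \<longlongrightarrow> l) ?F"
        using tendsto_mono[OF J1J l1[OF D]] unfolding \<rho>_eq[OF D] by blast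
    qed
  qed
qed

text \<open>Pairs (\<theta>, \<alpha>) appear first at rank \<alpha> + 1, so any infinite subset of
  \<open>I1 \<theta>\<close> is allowed. It is chosen so that the fibre values converge on each of
  the countably many clopen sets, which handles all choices of lifts at once.\<close>

lemma F_diagonal:
  assumes \<theta>: "omega \<le> \<theta>" "\<theta> < \<alpha>"
  shows "\<exists>J\<subseteq>I1 \<theta>. infinite J \<and> (\<forall>\<mu>. (\<forall>n. \<mu> n \<in> Bset P1 n \<theta> \<alpha> (osucc \<alpha>)) \<longrightarrow>
    (\<exists>\<mu>'\<in>radon_measures (top_at P1 (osucc \<alpha>)). weak_star_limit (top_at P1 (osucc \<alpha>)) \<mu> \<mu>' (along J)))"
proof -
  let ?X' = "top_at P1 (osucc \<alpha>)"
  have le: "\<theta> \<le> \<alpha>" "\<theta> \<le> osucc \<alpha>" using \<theta> Q.le_succ by auto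
  interpret stage "osucc \<alpha>" P1 \<theta> "fst (sched P1 \<theta>)" "snd (sched P1 \<theta>)" using \<theta>(1) le(1) by (rule stage_P1)
  interpret X: boolean_space ?X' by (rule Q.boolean_at[OF Q.omega_succ order_refl])
  \<comment> \<open>Without a given lift there is no bound on the fibre values, hence the
    truncation. Whenever lifts exist their values lie in [-1, 1], and the truncation has no
    effect.\<close>
  define a where "a C n = max (-1) (min 1 (fibre_value P1 n \<theta> \<alpha> (osucc \<alpha>) C))" for C n
  \<comment> \<open>Some old pair is needed to see that \<open>I1 \<theta>\<close> is infinite;
    \<open>(\<theta>, \<theta>)\<close> is one because \<open>\<theta> < \<alpha>\<close>.\<close>
  have "infinite (J1 \<theta> \<theta> \<inter> Nset True \<theta> \<theta>)" by (rule J1_infinite[OF \<theta> \<theta>(2)])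
  then have "infinite (I1 \<theta>)" using J1_subset(1)[OF \<theta>(2)] by (meson Int_lower1 finite_subset order_trans)
  then obtain J where J: "J \<subseteq> I1 \<theta>" "infinite J" "\<And>C. C \<in> clopens ?X' \<Longrightarrow> \<exists>l. (a C \<longlongrightarrow> l) (along J)"
  proof -
    have "\<bar>a C n\<bar> \<le> 1" for C n by (simp add: a_def)
    then show ?thesis using diagonal_subsequence[OF X.countable_clopens \<open>infinite (I1 \<theta>)\<close>, of a] that by blast
  qed
  have "\<exists>\<mu>'\<in>radon_measures ?X'. weak_star_limit ?X' \<mu> \<mu>' (along J)"
    if \<mu>: "\<And>n. \<mu> n \<in> Bset P1 n \<theta> \<alpha> (osucc \<alpha>)" for \<mu>
  proof (rule weak_star_criterion[OF le(2) order_refl J(2) \<mu>])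
    fix C assume C: "C \<in> clopens ?X'"
    obtain l where l: "(a C \<longlongrightarrow> l) (along J)" using J(3)[OF C] by blast
    have JI: "along J \<le> along (I1 \<theta>)" using J(1) by (intro along_mono) (simp add: Diff_eq_empty_iff[THEN iffD2])
    have "eventually (\<lambda>n. a C n = \<mu> n C) (along J)"
      using filter_leD[OF JI fibrewise_new[OF \<theta>(1) le(1) C]]
    proof eventually_elim
      case (elim n)
      have "\<bar>\<mu> n C\<bar> \<le> 1"
        using abs_le_variation[OF Bset_signed[OF \<mu>], of n C] variation_le_tv[OF Bset_signed[OF \<mu>], of n C] \<mu>[of n]
        by (simp add: Bset_def)
      then show ?case
        using Bset_value[OF le(2) order_refl \<mu> meas_P1(2)[OF \<theta>(1) le(1)] C elim] by (simp add: a_def)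
    qed
    then have "((\<lambda>n. \<mu> n C) \<longlongrightarrow> l) (along J)" using l by (rule Lim_transform_eventually[rotated])
    then show "\<exists>l. ((\<lambda>n. \<mu> n C) \<longlongrightarrow> l) (along J)" by blast
  qed
  then show ?thesis using J(1,2) by blast
qed

text \<open>The set \<open>U n\<close> avoids the split point, so every fibre over it is a single
  point and every set is fibrewise. The lift of the Dirac measure at \<open>z n\<close> is then the
  Dirac measure at the unique lift \<open>t\<close>.\<close>

lemma Bset_top_value:
  assumes \<delta>: "\<delta> \<le> \<alpha>" and \<mu>: "\<mu> \<in> Bset P1 n \<alpha> \<delta> (osucc \<alpha>)"
    and t: "t \<in> spc P1 (osucc \<alpha>)" "\<pi> \<alpha> t = z n" and C: "C \<in> clopens (top_at P1 (osucc \<alpha>))"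
  shows "\<mu> C = (if t \<in> C then 1 else 0)"
proof -
  let ?X' = "top_at P1 (osucc \<alpha>)" and ?V = "Vset P1 n \<alpha> (osucc \<alpha>)"
  interpret stage "osucc \<alpha>" P1 \<alpha> "fst (sched P1 \<alpha>)" "snd (sched P1 \<alpha>)" using \<alpha> order_refl by (rule stage_P1)
  interpret X: boolean_space ?X' by (rule Q.boolean_at[OF Q.omega_succ order_refl])
  have V: "s \<in> ?V \<longleftrightarrow> s \<in> spc P1 (osucc \<alpha>) \<and> \<pi> \<alpha> s \<in> U n" for s
    using Vset_eq[OF Q.le_succ order_refl, of n] by (simp add: Vset_top)
  have uniq: "s = s'" if "s \<in> ?V" "s' \<in> ?V" "\<pi> \<alpha> s = \<pi> \<alpha> s'" for s s'
    using Q.fibre_unique[of s s'] that V U(2) by metis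
  have "fibrewise P1 n \<alpha> (osucc \<alpha>) C" unfolding fibrewise_def using uniq by metis
  then have "\<mu> C = dirac (top_at P \<alpha>) (z n) (\<pi> \<alpha> ` (C \<inter> ?V))"
    using Bset_value[OF Q.le_succ order_refl \<mu> meas_P1(2)[OF \<alpha> order_refl] C] EM(2)[OF \<delta>]
    by (simp add: fibre_value_def P1_simps)
  moreover have "\<pi> \<alpha> ` (C \<inter> ?V) \<in> borel_sets (top_at P \<alpha>)"
  proof -
    have "C \<inter> ?V \<in> clopens ?X'" using C Vset_clopen[OF Q.le_succ order_refl] by (rule clopens_Int)
    then have "compactin (top_at P1 \<alpha>) (\<pi> \<alpha> ` (C \<inter> ?V))"
      by (intro image_compactin[OF closedin_compact_space[OF X.compact] Q.continuous_\<pi>_at[OF \<alpha> Q.le_succ order_refl]]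
          clopens_closedin)
    then show ?thesis
      using closedin_borel[OF compactin_imp_closedin[OF Q.Hausdorff_at]] by (simp add: top_P1[symmetric])
  qed
  moreover have "z n \<in> \<pi> \<alpha> ` (C \<inter> ?V) \<longleftrightarrow> t \<in> C"
  proof
    have tV: "t \<in> ?V" using V t U(3) by simp
    show "t \<in> C" if "z n \<in> \<pi> \<alpha> ` (C \<inter> ?V)" using that uniq[OF tV] t(2) by auto
    show "z n \<in> \<pi> \<alpha> ` (C \<inter> ?V)" if "t \<in> C" using that tV t(2) by (metis IntI image_eqI)
  qed
  ultimately show ?thesis by (simp add: dirac_eq)
qed

lemma z_lift: "\<exists>t. t \<in> spc P1 (osucc \<alpha>) \<and> \<pi> \<alpha> t = z n \<and> (t \<alpha> \<longleftrightarrow> z n \<in> W)"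
proof -
  have "U n \<subseteq> spc P \<alpha>"
    using U(1) openin_subset topspace_at[OF \<alpha> order_refl] by (fastforce simp: clopen_sequences_def)
  then have "z n \<in> spc P \<alpha>" using U(3) by blast
  then have "z n \<in> \<pi> \<alpha> ` spc P1 (osucc \<alpha>)" using Q.\<pi>_surj by (simp add: spc_P1)
  then obtain t where t: "t \<in> spc P1 (osucc \<alpha>)" "\<pi> \<alpha> t = z n" by (metis imageE)
  have "z n \<noteq> p" using U(2,3) by metis
  then have "t \<alpha> \<longleftrightarrow> z n \<in> W" using Q.succ_upper[OF t(1)] Q.succ_lower[OF t(1)] t(2) by (auto simp: P1_simps)
  then show ?thesis using t by blast
qed

text \<open>Along even indices the points \<open>z n\<close> converge to \<open>q\<close> and lie
  outside \<open>W\<close>, so their lifts all have bit 0 at \<open>\<alpha>\<close> and converge to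
  a point. Their Dirac measures are eventually constant on each clopen set.\<close>

lemma F_top:
  assumes \<delta>: "\<delta> \<le> \<alpha>" and \<mu>: "\<And>n. \<mu> n \<in> Bset P1 n \<alpha> \<delta> (osucc \<alpha>)"
  shows "\<exists>\<mu>'\<in>radon_measures (top_at P1 (osucc \<alpha>)).
    weak_star_limit (top_at P1 (osucc \<alpha>)) \<mu> \<mu>' (along (range (\<lambda>n. 2 * n)))"
proof -
  let ?X' = "top_at P1 (osucc \<alpha>)"
  interpret stage "osucc \<alpha>" P1 \<alpha> "fst (sched P1 \<alpha>)" "snd (sched P1 \<alpha>)" using \<alpha> order_refl by (rule stage_P1)
  have mono: "strict_mono (\<lambda>n::nat. 2 * n)" by (simp add: strict_mono_def)
  obtain t where t: "\<And>n. t n \<in> spc P1 (osucc \<alpha>)" "\<And>n. \<pi> \<alpha> (t n) = z n" "\<And>n. t n \<alpha> \<longleftrightarrow> z n \<in> W"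
    using z_lift by metis
  have inf: "infinite (range (\<lambda>n::nat. 2 * n))" by (intro range_inj_infinite) (auto simp: inj_def)
  show ?thesis
  proof (rule weak_star_criterion[OF Q.le_succ order_refl inf \<mu>])
    fix C assume C: "C \<in> clopens ?X'"
    obtain D where D: "finite D" "D \<subseteq> {..<osucc \<alpha>}"
      "\<forall>t\<in>spc P1 (osucc \<alpha>). \<forall>t'\<in>spc P1 (osucc \<alpha>). (\<forall>d\<in>D. t d = t' d) \<longrightarrow> (t \<in> C \<longleftrightarrow> t' \<in> C)"
      using Q.clopen_support_at[OF Q.omega_succ order_refl C] by blast
    \<comment> \<open>The limit of the lifts: \<open>q\<close> is outside \<open>W\<close> and hence
      has a lift with bit 0.\<close>
    let ?q = "q(\<alpha> := False)"
    have qs: "?q \<in> spc P1 (osucc \<alpha>)" using q(1) by (auto simp: P1_simps append_bit_def)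
    have "eventually (\<lambda>n. t (2 * n) d = ?q d) sequentially" if "d \<in> D" for d
    proof (cases "d = \<alpha>")
      case True
      then show ?thesis using t(3) zW(3) by simp
    next
      case False
      then have d: "d < \<alpha>" using that D(2) by (auto simp: lessThan_osucc)
      have "t (2 * n) d = z (2 * n) d" for n using t(2)[of "2 * n"] \<pi>_apply[OF d] by metis
      then show ?thesis using q(2)[OF d] False by simp
    qed
    then have "eventually (\<lambda>n. \<forall>d\<in>D. t (2 * n) d = ?q d) sequentially"
      using D(1) by (simp add: eventually_ball_finite)
    then have "eventually (\<lambda>n. (if ?q \<in> C then 1 else 0) = \<mu> (2 * n) C) sequentially"
    proof eventually_elim
      case (elim n)
      have "t (2 * n) \<in> C \<longleftrightarrow> ?q \<in> C" using D(3) t(1) qs elim by blast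
      then show ?case using Bset_top_value[OF \<delta> \<mu> t(1,2) C, of "2 * n"] by simp
    qed
    then have "(\<lambda>n. \<mu> (2 * n) C) \<longlonglongrightarrow> (if ?q \<in> C then 1 else 0)"
      using tendsto_const by (rule Lim_transform_eventually[rotated])
    then show "\<exists>l. ((\<lambda>n. \<mu> n C) \<longlongrightarrow> l) (along (range (\<lambda>n. 2 * n)))"
      using tendsto_along_range[OF mono, of "\<lambda>n. \<mu> n C"] by blast
  qed
qed

text \<open>The lifts are Dirac measures, so the mass of \<open>Q.Z1\<close> is 1 or 0 according to
  \<open>z n \<in> W\<close>, and both cases occur infinitely often.\<close>

lemma G_top:
  assumes \<mu>: "\<And>n. \<mu> n \<in> Bset P1 n \<alpha> \<alpha> (osucc \<alpha>)"
  shows "infinite {n. \<mu> n Q.Z1 \<ge> 1/6}" "infinite {n. \<mu> n Q.Z1 = 0}"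
proof -
  have v: "\<mu> n Q.Z1 = (if z n \<in> W then 1 else 0)" for n
  proof -
    obtain t where t: "t \<in> spc P1 (osucc \<alpha>)" "\<pi> \<alpha> t = z n" "t \<alpha> \<longleftrightarrow> z n \<in> W" using z_lift by blast
    show ?thesis
      using Bset_top_value[OF order_refl \<mu> t(1,2) Q.Z1_clopen] t(1,3) by (simp add: Q.Z1_eq)
  qed
  show "infinite {n. \<mu> n Q.Z1 \<ge> 1/6}"
    by (rule infinite_super[OF _ zW(1)]) (auto simp: v)
  show "infinite {n. \<mu> n Q.Z1 = 0}"
    by (rule infinite_super[OF _ zW(2)]) (auto simp: v)
qed

end

section \<open>Assembly of the realisation at rank \<alpha> + 1\<close>

context extension
begin

text \<open>Besides the realisation itself, the claim records the stage data that the argument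
  against lifts uses. The set J at (\<alpha>, \<alpha>) consists of the even numbers n = 2j; the
  classes of 4n and 4n + 2 correspond to even and odd j.\<close>

lemma ex_realisation:
  "\<exists>P'. partial_realisation (osucc \<alpha>) P' \<and> agree_upto \<alpha> P P' \<and>
    lower P' \<alpha> = spc P \<alpha> - W \<and> upper P' \<alpha> = insert p W \<and> meas P' \<alpha> \<alpha> = (\<lambda>n. dirac (top_at P \<alpha>) (z n)) \<and>
    N0set P' \<alpha> \<alpha> = range (\<lambda>n. 4 * n) \<and> N1set P' \<alpha> \<alpha> = range (\<lambda>n. 4 * n + 2)"
proof -
  obtain Jd where Jd: "\<And>\<theta>. omega \<le> \<theta> \<Longrightarrow> \<theta> < \<alpha> \<Longrightarrow> Jd \<theta> \<subseteq> I1 \<theta> \<and> infinite (Jd \<theta>) \<and>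
      (\<forall>\<mu>. (\<forall>n. \<mu> n \<in> Bset P1 n \<theta> \<alpha> (osucc \<alpha>)) \<longrightarrow>
        (\<exists>\<mu>'\<in>radon_measures (top_at P1 (osucc \<alpha>)). weak_star_limit (top_at P1 (osucc \<alpha>)) \<mu> \<mu>' (along (Jd \<theta>))))"
    using F_diagonal by metis
  have "\<exists>M N. omega \<le> \<theta> \<longrightarrow> \<theta> < \<alpha> \<longrightarrow> M \<inter> N = {} \<and> infinite (Jd \<theta> \<inter> M) \<and> infinite (Jd \<theta> \<inter> N)" for \<theta>
    using split_infinite[of "Jd \<theta>"] Jd[of \<theta>] by blast
  then obtain M N where MN: "\<And>\<theta>. omega \<le> \<theta> \<Longrightarrow> \<theta> < \<alpha> \<Longrightarrow> M \<theta> \<inter> N \<theta> = {} \<and> infinite (Jd \<theta> \<inter> M \<theta>) \<and> infinite (Jd \<theta> \<inter> N \<theta>)"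
    by metis
  let ?E = "range (\<lambda>n::nat. 2 * n)" and ?M = "range (\<lambda>n::nat. 4 * n)" and ?N = "range (\<lambda>n::nat. 4 * n + 2)"
  \<comment> \<open>At the new rank there are three kinds of pairs: base level
    \<open>\<alpha>\<close>, where one J serves all \<open>\<delta> \<le> \<alpha>\<close> because
    their sequences coincide; an old level with the new index \<open>\<delta> = \<alpha>\<close>,
    served by the subsequence; and old pairs, thinned to the kept indices.\<close>
  define P' where "P' = P1\<lparr>Iset := \<lambda>\<theta> \<beta>. if \<beta> = osucc \<alpha> then I1 \<theta> else Iset P \<theta> \<beta>,
    Jset := \<lambda>\<theta> \<delta> \<beta>. if \<beta> = osucc \<alpha> then (if \<theta> = \<alpha> then ?E else if \<delta> = \<alpha> then Jd \<theta> else J1 \<theta> \<delta>) else Jset P \<theta> \<delta> \<beta>,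
    N0set := \<lambda>\<theta> \<delta>. if \<theta> = \<alpha> then ?M else if \<delta> = \<alpha> then M \<theta> else N0set P \<theta> \<delta>,
    N1set := \<lambda>\<theta> \<delta>. if \<theta> = \<alpha> then ?N else if \<delta> = \<alpha> then N \<theta> else N1set P \<theta> \<delta>\<rparr>"
  have P'_simps: "spc P' = spc P1" "lower P' = lower P1" "upper P' = upper P1" "sched P' = sched P1"
    "clop P' = clop P1" "meas P' = meas P1" by (simp_all add: P'_def)
  have P'I: "Iset P' \<theta> \<beta> = (if \<beta> = osucc \<alpha> then I1 \<theta> else Iset P \<theta> \<beta>)"
    and P'J: "Jset P' \<theta> \<delta> \<beta> = (if \<beta> = osucc \<alpha> then (if \<theta> = \<alpha> then ?E else if \<delta> = \<alpha> then Jd \<theta> else J1 \<theta> \<delta>) else Jset P \<theta> \<delta> \<beta>)"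
    and P'N: "N0set P' \<theta> \<delta> = (if \<theta> = \<alpha> then ?M else if \<delta> = \<alpha> then M \<theta> else N0set P \<theta> \<delta>)"
    "N1set P' \<theta> \<delta> = (if \<theta> = \<alpha> then ?N else if \<delta> = \<alpha> then N \<theta> else N1set P \<theta> \<delta>)"
    for \<theta> \<delta> \<beta> by (simp_all add: P'_def)
  have top: "top_at P' = top_at P1" by (simp add: top_at_def P'_simps fun_eq_iff)
  have V: "Vset P' = Vset P1" by (simp add: Vset_def P'_simps fun_eq_iff)
  have B: "Bset P' = Bset P1" by (simp add: Bset_def P'_simps top fun_eq_iff)
  have conds: "schedule_upto \<alpha> P" "enumerations_upto \<alpha> P" "condA \<alpha> P" "condB \<alpha> P" "condC \<alpha> P" "condD \<alpha> P"
    "condE \<alpha> P" "condF \<alpha> P" "condG \<alpha> P"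
    using P by (auto simp: partial_realisation_def)
  have ranks: "\<beta> = osucc \<alpha> \<or> \<beta> \<le> \<alpha> \<and> \<beta> \<noteq> osucc \<alpha>" if "\<beta> \<le> osucc \<alpha>" for \<beta>
    using that le_osucc_iff by blast
  have s: "spaces_upto (osucc \<alpha>) P'"
    using spaces_P1 by (simp add: spaces_upto_def P'_simps top)
  have sch: "schedule_upto (osucc \<alpha>) P'"
    unfolding schedule_upto_def
  proof (intro allI impI)
    fix \<beta> \<theta> \<delta> assume h: "omega \<le> \<beta> \<and> \<beta> < osucc \<alpha> \<and> sched P' \<beta> = (\<theta>, \<delta>)"
    show "omega \<le> \<theta> \<and> \<theta> \<le> \<beta> \<and> \<delta> \<le> \<beta>"
    proof (cases "\<beta> = \<alpha>")
      case True
      then show ?thesis using h \<alpha> by (auto simp: P'_simps P1_simps)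
    next
      case False
      then have "\<beta> < \<alpha>" using h by (auto simp: less_osucc_iff le_less)
      then have "sched P \<beta> = (\<theta>, \<delta>)" using h by (simp add: P'_simps P1_simps)
      then show ?thesis using sched_bounds[of \<beta> \<theta> \<delta>] h \<open>\<beta> < \<alpha>\<close> by blast
    qed
  qed
  have enum: "enumerations_upto (osucc \<alpha>) P'"
    unfolding enumerations_upto_def
  proof (intro allI impI)
    fix \<beta> assume h: "omega \<le> \<beta> \<and> \<beta> < osucc \<alpha>"
    show "range (clop P' \<beta>) = clopen_sequences P' \<beta> \<and> range (meas P' \<beta>) = admissible_sequences P' \<beta>"
    proof (cases "\<beta> = \<alpha>")
      case True
      have "admissible_sequences P' \<alpha> = admissible_sequences P1 \<alpha>" by (simp add: admissible_sequences_def top V)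
      moreover have "clopen_sequences P' \<alpha> = clopen_sequences P \<alpha>" by (simp add: clopen_sequences_def top top_P1)
      ultimately show ?thesis using True EU(1) admissible_top by (simp add: P'_simps P1_simps)
    next
      case False
      then have lt: "\<beta> < \<alpha>" using h by (auto simp: less_osucc_iff le_less)
      have "admissible_sequences P' \<beta> = admissible_sequences P \<beta>"
        using lt h by (simp add: admissible_sequences_def top V top_P1 Vset_P1)
      moreover have "clopen_sequences P' \<beta> = clopen_sequences P \<beta>"
        using lt by (simp add: clopen_sequences_def top top_P1)
      ultimately show ?thesis
        using clop_range meas_range h lt by (simp add: P'_simps P1_simps)
    qed
  qed
  have A': "condA (osucc \<alpha>) P'"
    unfolding condA_def
  proof (intro allI impI)
    fix \<theta> \<delta> \<beta> assume h: "omega \<le> \<theta> \<and> \<theta> < \<beta> \<and> \<delta> < \<beta> \<and> \<beta> \<le> osucc \<alpha>"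
    then consider "\<beta> = osucc \<alpha>" | "\<beta> \<le> \<alpha>" "\<beta> \<noteq> osucc \<alpha>" using ranks by blast
    then show "Jset P' \<theta> \<delta> \<beta> \<subseteq> Iset P' \<theta> \<beta>"
    proof cases
      case 1
      show ?thesis
      proof (cases "\<theta> = \<alpha>")
        case True
        then show ?thesis using 1 by (simp add: P'I I1_def)
      next
        case False
        then have "\<theta> < \<alpha>" using h 1 by (auto simp: less_osucc_iff le_less)
        then show ?thesis using 1 False Jd[of \<theta>] h J1_subset(1) by (simp add: P'I P'J)
      qed
    next
      case 2
      then show ?thesis using h conds(3) by (simp add: P'I P'J condA_def)
    qed
  qed
  have B': "condB (osucc \<alpha>) P'"
    unfolding condB_def
  proof (intro allI impI)
    fix \<theta> \<delta> assume h: "omega \<le> \<theta> \<and> \<theta> < osucc \<alpha> \<and> \<delta> < osucc \<alpha>"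
    consider "\<theta> = \<alpha>" | "\<theta> < \<alpha>" "\<delta> = \<alpha>" | "\<theta> < \<alpha>" "\<delta> < \<alpha>"
      using h by (auto simp: less_osucc_iff le_less)
    then show "N0set P' \<theta> \<delta> \<inter> N1set P' \<theta> \<delta> = {}"
    proof cases
      case 1
      have "4 * n \<noteq> 4 * m + (2::nat)" for n m by presburger
      then show ?thesis using 1 by (auto simp: P'N)
    next
      case 2
      then show ?thesis using MN h by (auto simp: P'N)
    next
      case 3
      then show ?thesis using conds(4) h by (auto simp: P'N condB_def)
    qed
  qed
  have C': "condC (osucc \<alpha>) P'"
    unfolding condC_def
  proof (intro allI impI)
    fix \<theta> \<delta> \<beta> assume h: "omega \<le> \<theta> \<and> \<theta> < \<beta> \<and> \<delta> < \<beta> \<and> \<beta> \<le> osucc \<alpha>"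
    show "infinite (Jset P' \<theta> \<delta> \<beta> \<inter> N0set P' \<theta> \<delta>) \<and> infinite (Jset P' \<theta> \<delta> \<beta> \<inter> N1set P' \<theta> \<delta>)"
    proof (cases "\<beta> = osucc \<alpha>")
      case True
      then consider "\<theta> = \<alpha>" | "\<theta> < \<alpha>" "\<delta> = \<alpha>" | "\<theta> < \<alpha>" "\<delta> < \<alpha>"
        using h by (auto simp: less_osucc_iff le_less)
      then show ?thesis
      proof cases
        case 1
        have e: "4 * n = 2 * (2 * n)" "4 * n + 2 = 2 * (2 * n + 1)" for n :: nat by simp_all
        have "?E \<inter> ?M = ?M" "?E \<inter> ?N = ?N" using e by blast+
        moreover have "infinite ?M" "infinite ?N" by (intro range_inj_infinite; simp add: inj_def)+
        ultimately show ?thesis using 1 True by (simp add: P'J P'N)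
      next
        case 2
        then show ?thesis using MN h True by (simp add: P'J P'N)
      next
        case 3
        then have "\<theta> \<noteq> \<alpha>" "\<delta> \<noteq> \<alpha>" by auto
        then show ?thesis using 3 J1_infinite[of \<theta> \<delta> False] J1_infinite[of \<theta> \<delta> True] h True
          by (simp add: P'J P'N Nset_def)
      qed
    next
      case False
      then have le: "\<beta> \<le> \<alpha>" using h ranks by blast
      then have "\<theta> \<noteq> \<alpha>" "\<delta> \<noteq> \<alpha>" using h by auto
      then show ?thesis using le h conds(5) False by (simp add: P'J P'N condC_def)
    qed
  qed
  have D': "condD (osucc \<alpha>) P'"
    unfolding condD_def
  proof (intro allI impI)
    fix \<theta> \<delta> \<beta>' \<beta> assume h: "omega \<le> \<theta> \<and> \<theta> < \<beta>' \<and> \<delta> < \<beta>' \<and> \<beta>' \<le> \<beta> \<and> \<beta> \<le> osucc \<alpha>"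
    have le: "\<beta>' \<le> osucc \<alpha>" using h order_trans by blast
    show "finite (Jset P' \<theta> \<delta> \<beta> - Jset P' \<theta> \<delta> \<beta>') \<and> finite (Iset P' \<theta> \<beta> - Iset P' \<theta> \<beta>')"
    proof (cases "\<beta>' = osucc \<alpha>")
      case True
      then show ?thesis using h by (metis Diff_cancel antisym finite.emptyI)
    next
      case False
      \<comment> \<open>If the smaller rank is old, both \<open>\<theta>\<close> and
        \<open>\<delta>\<close> lie below \<open>\<alpha>\<close>. The sets chosen for new pairs are
        thus never compared with an earlier rank.\<close>
      then have b': "\<beta>' \<le> \<alpha>" using ranks[OF le] by blast
      then have lt: "\<theta> < \<alpha>" "\<delta> < \<alpha>" using h by auto
      show ?thesis
      proof (cases "\<beta> = osucc \<alpha>")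
        case True
        have "finite (Jset P \<theta> \<delta> \<alpha> - Jset P \<theta> \<delta> \<beta>') \<and> finite (Iset P \<theta> \<alpha> - Iset P \<theta> \<beta>')"
          using conds(6) h b' unfolding condD_def by blast
        moreover have "J1 \<theta> \<delta> \<subseteq> Jset P \<theta> \<delta> \<alpha>" "I1 \<theta> \<subseteq> Iset P \<theta> \<alpha>" using J1_subset(2) I1_subset lt by auto
        ultimately have "finite (J1 \<theta> \<delta> - Jset P \<theta> \<delta> \<beta>') \<and> finite (I1 \<theta> - Iset P \<theta> \<beta>')"
          by (meson Diff_mono finite_subset order_refl)
        moreover have "\<theta> \<noteq> \<alpha>" "\<delta> \<noteq> \<alpha>" using lt by auto
        ultimately show ?thesis using True False by (simp add: P'J P'I)
      next
        case b: False
        then have "\<beta> \<le> \<alpha>" using h ranks by blast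
        then have "finite (Jset P \<theta> \<delta> \<beta> - Jset P \<theta> \<delta> \<beta>') \<and> finite (Iset P \<theta> \<beta> - Iset P \<theta> \<beta>')"
          using conds(6) h unfolding condD_def by blast
        then show ?thesis using b False by (simp add: P'J P'I)
      qed
    qed
  qed
  have E': "condE (osucc \<alpha>) P'"
    unfolding condE_def V
  proof (intro allI impI)
    fix \<theta> \<gamma> \<beta> assume h: "omega \<le> \<theta> \<and> \<theta> \<le> \<gamma> \<and> \<gamma> < \<beta> \<and> \<beta> \<le> osucc \<alpha>"
    show "\<exists>m. \<forall>n\<in>Iset P' \<theta> \<beta>. m \<le> n \<longrightarrow>
      (\<forall>t\<in>Vset P1 n \<theta> \<beta>. \<forall>t'\<in>Vset P1 n \<theta> \<beta>. \<pi> \<theta> t = \<pi> \<theta> t' \<longrightarrow> t \<gamma> = t' \<gamma>)"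
    proof (cases "\<beta> = osucc \<alpha>")
      case True
      then have "\<theta> \<le> \<alpha>" using h by (metis less_osucc_iff order_trans)
      then show ?thesis using E_new[of \<theta> \<gamma>] h True by (simp add: P'I)
    next
      case False
      then have b: "\<beta> \<le> \<alpha>" using h ranks by blast
      then have lt: "\<theta> < \<alpha>" using h by (meson le_less_trans less_le_trans)
      have "\<exists>m. \<forall>n\<in>Iset P \<theta> \<beta>. m \<le> n \<longrightarrow>
          (\<forall>t\<in>Vset P n \<theta> \<beta>. \<forall>t'\<in>Vset P n \<theta> \<beta>. \<pi> \<theta> t = \<pi> \<theta> t' \<longrightarrow> t \<gamma> = t' \<gamma>)"
        using conds(7) h b unfolding condE_def by blast
      then show ?thesis using h b lt False by (simp add: P'I Vset_P1)
    qed
  qed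
  have F': "condF (osucc \<alpha>) P'"
    unfolding condF_def B top
  proof (intro allI impI)
    fix \<theta> \<delta> \<beta> \<mu> assume h: "omega \<le> \<theta> \<and> \<theta> < \<beta> \<and> \<delta> < \<beta> \<and> \<beta> \<le> osucc \<alpha>" and \<mu>: "\<forall>n. \<mu> n \<in> Bset P1 n \<theta> \<delta> \<beta>"
    show "\<exists>\<mu>'\<in>radon_measures (top_at P1 \<beta>). weak_star_limit (top_at P1 \<beta>) \<mu> \<mu>' (along (Jset P' \<theta> \<delta> \<beta>))"
    proof (cases "\<beta> = osucc \<alpha>")
      case True
      then consider "\<theta> = \<alpha>" "\<delta> \<le> \<alpha>" | "\<theta> < \<alpha>" "\<delta> = \<alpha>" | "\<theta> < \<alpha>" "\<delta> < \<alpha>"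
        using h by (auto simp: less_osucc_iff le_less)
      then show ?thesis
      proof cases
        case 1
        then show ?thesis using F_top[of \<delta> \<mu>] \<mu> True by (simp add: P'J)
      next
        case 2
        then have "\<theta> \<noteq> \<alpha>" by auto
        then show ?thesis using 2 Jd[of \<theta>] h \<mu> True by (simp add: P'J)
      next
        case 3
        then have "\<theta> \<noteq> \<alpha>" "\<delta> \<noteq> \<alpha>" by auto
        then show ?thesis using 3 F_old[of \<theta> \<delta> \<mu>] h \<mu> True by (simp add: P'J)
      qed
    next
      case False
      then have b: "\<beta> \<le> \<alpha>" using h ranks by blast
      then have "\<theta> < \<alpha>" using h by (meson less_le_trans)
      moreover from this have "\<forall>n. \<mu> n \<in> Bset P n \<theta> \<delta> \<beta>" using \<mu> b by (simp add: Bset_P1)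
      then have "\<exists>\<mu>'\<in>radon_measures (top_at P \<beta>). weak_star_limit (top_at P \<beta>) \<mu> \<mu>' (along (Jset P \<theta> \<delta> \<beta>))"
        using conds(8) h b unfolding condF_def by blast
      ultimately show ?thesis using b False by (simp add: P'J top_P1)
    qed
  qed
  have G': "condG (osucc \<alpha>) P'"
    unfolding condG_def B P'_simps
  proof (intro allI impI)
    fix \<beta> \<theta> \<delta> \<mu> assume h: "omega \<le> \<beta> \<and> \<beta> < osucc \<alpha> \<and> sched P1 \<beta> = (\<theta>, \<delta>)"
      and \<mu>: "\<forall>n. \<mu> n \<in> Bset P1 n \<theta> \<delta> (osucc \<beta>)"
    show "infinite {n. 1 / 6 \<le> \<mu> n (append_bit \<beta> (upper P1 \<beta>) True)} \<and>
      infinite {n. \<mu> n (append_bit \<beta> (upper P1 \<beta>) True) = 0}"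
    proof (cases "\<beta> = \<alpha>")
      case True
      then have "(\<alpha>, \<alpha>) = (\<theta>, \<delta>)" using h P1_simps(4) by metis
      then have "\<mu> n \<in> Bset P1 n \<alpha> \<alpha> (osucc \<alpha>)" for n using \<mu> True by blast
      from G_top[of \<mu>, OF this] show ?thesis unfolding True by blast
    next
      case False
      then have lt: "\<beta> < \<alpha>" using h by (auto simp: less_osucc_iff le_less)
      then have sc: "sched P \<beta> = (\<theta>, \<delta>)" using h by (simp add: P1_simps)
      have "\<theta> < \<alpha>" using sched_bounds(2)[OF _ lt sc] h lt by simp
      then have "\<forall>n. \<mu> n \<in> Bset P n \<theta> \<delta> (osucc \<beta>)" using \<mu> lt by (simp add: Bset_P1 osucc_le_iff)
      then have "infinite {n. 1 / 6 \<le> \<mu> n (append_bit \<beta> (upper P \<beta>) True)} \<and>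
          infinite {n. \<mu> n (append_bit \<beta> (upper P \<beta>) True) = 0}"
        using conds(9) h lt sc unfolding condG_def by blast
      then show ?thesis using lt by (simp add: P1_simps)
    qed
  qed
  have pr: "partial_realisation (osucc \<alpha>) P'"
    unfolding partial_realisation_def using s sch enum A' B' C' D' E' F' G' by blast
  have ne: "\<beta> \<noteq> osucc \<alpha>" if "\<beta> \<le> \<alpha>" for \<beta> using that less_osucc[of \<alpha>] by auto
  have ag: "agree_upto \<alpha> P P'"
    unfolding agree_upto_def
    by (intro conjI allI impI) (auto simp: P'_simps spc_P1 P1_simps P'I P'J P'N ne)
  show ?thesis
    using pr ag EM(2)[OF order_refl] by (intro exI[of _ P']) (simp add: P'_simps P1_simps P'N)
qed

end

section \<open>The split determined by the guess\<close>

locale guess = realised +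
  fixes S :: "omega1 set" and F G :: "point set" and h :: "point \<Rightarrow> point"
  assumes diamond: "diamond S"
    and F: "closedin (top_at P \<alpha>) F" and G: "closedin (top_at P \<alpha>) G"
    and FG: "F \<inter> G = {}" and inf: "infinite F"
    and h: "homeomorphic_map (subtopology (top_at P \<alpha>) F) (subtopology (top_at P \<alpha>) G) h"
begin

abbreviation X :: "point topology" where "X \<equiv> top_at P \<alpha>"

lemma top_X: "topspace X = spc P \<alpha>"
  by (rule topspace_at[OF \<alpha> order_refl])

lemma F_sub: "F \<subseteq> spc P \<alpha>" and G_sub: "G \<subseteq> spc P \<alpha>"
  using closedin_subset[OF F] closedin_subset[OF G] top_X by auto

lemma boolean_X: "boolean_space X"
  by (rule boolean_at[OF \<alpha> order_refl])

lemma spc_ext: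
  assumes "s \<in> spc P \<alpha>" "t \<in> spc P \<alpha>" "s \<noteq> t" shows "\<exists>d<\<alpha>. s d \<noteq> t d"
proof (rule ccontr)
  assume n: "\<not> (\<exists>d<\<alpha>. s d \<noteq> t d)"
  have "s \<in> {..<\<alpha>} \<rightarrow>\<^sub>E UNIV" "t \<in> {..<\<alpha>} \<rightarrow>\<^sub>E UNIV"
    using assms(1,2) spc_subset[OF \<alpha> order_refl] unfolding topspace_cube by blast+
  then have "s = t" by (rule PiE_ext) (use n in auto)
  then show False using assms(3) by blast
qed

lemma h_maps: "t \<in> F \<Longrightarrow> h t \<in> G" and h_inj: "s \<in> F \<Longrightarrow> t \<in> F \<Longrightarrow> h s = h t \<Longrightarrow> s = t"
proof -
  have "topspace (subtopology X F) = F" "topspace (subtopology X G) = G"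
    using F_sub G_sub top_X by (auto simp: topspace_subtopology)
  then have "h ` F = G" "inj_on h F"
    using homeomorphic_imp_surjective_map[OF h] homeomorphic_imp_injective_map[OF h] by simp_all
  then show "t \<in> F \<Longrightarrow> h t \<in> G" "s \<in> F \<Longrightarrow> t \<in> F \<Longrightarrow> h s = h t \<Longrightarrow> s = t"
    by (blast, meson inj_onD)
qed

lemma ex_accumulation_point: "\<exists>p\<in>F. \<forall>U. openin X U \<and> p \<in> U \<longrightarrow> (\<exists>t\<in>F \<inter> U. t \<noteq> p)"
proof -
  have "compactin X F" by (rule closedin_compact_space[OF boolean_space.compact[OF boolean_X] F])
  then have "F \<inter> X derived_set_of F \<noteq> {}"
    using inf by (intro compactin_imp_Bolzano_Weierstrass) auto
  then obtain p where "p \<in> F" "p \<in> X derived_set_of F" by blast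
  then show ?thesis unfolding in_derived_set_of by (intro bexI[of _ p]) auto
qed

text \<open>A coordinate that separates \<open>y j\<close> from the limit \<open>q\<close> separates
  it from almost all other terms, and finitely many further coordinates deal with the rest. The
  resulting clopen sets are made disjoint by removing the earlier ones.\<close>

lemma disjoint_neighbourhoods:
  fixes y :: "nat \<Rightarrow> point"
  assumes y: "\<And>j. y j \<in> spc P \<alpha>" "inj y" and q: "q \<in> spc P \<alpha>" "\<And>j. y j \<noteq> q"
    and lim: "\<And>d. d < \<alpha> \<Longrightarrow> eventually (\<lambda>j. y j d = q d) sequentially"
  shows "\<exists>U. (\<forall>j. U j \<in> clopens X \<and> y j \<in> U j) \<and> disjoint_family U"
proof -
  have "\<exists>E\<in>clopens X. y j \<in> E \<and> (\<forall>i. i \<noteq> j \<longrightarrow> y i \<notin> E)" for j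
  proof -
    obtain d0 where d0: "d0 < \<alpha>" "y j d0 \<noteq> q d0" using spc_ext[OF y(1) q(1) q(2)] by blast
    obtain N where N: "\<And>i. i \<ge> N \<Longrightarrow> y i d0 = q d0" using lim[OF d0(1)] by (auto simp: eventually_sequentially)
    have "\<exists>d<\<alpha>. y i d \<noteq> y j d" if "i \<noteq> j" for i
      using spc_ext[OF y(1) y(1)] injD[OF y(2)] that by blast
    then obtain d where d: "\<And>i. i \<noteq> j \<Longrightarrow> d i < \<alpha> \<and> y i (d i) \<noteq> y j (d i)" by metis
    define D where "D = insert d0 (d ` ({..<N} - {j}))"
    have "{t \<in> spc P \<alpha>. \<forall>d\<in>D. t d = y j d} \<in> clopens X"
      using d0(1) d by (intro cylinder_at \<alpha>) (auto simp: D_def)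
    moreover have "y i \<notin> {t \<in> spc P \<alpha>. \<forall>d\<in>D. t d = y j d}" if i: "i \<noteq> j" for i
    proof (cases "i < N")
      case True
      then have "d i \<in> D" using i by (simp add: D_def)
      then show ?thesis using d[OF i] by blast
    next
      case False
      then have "y i d0 \<noteq> y j d0" using N[of i] d0(2) by simp
      moreover have "d0 \<in> D" by (simp add: D_def)
      ultimately show ?thesis by blast
    qed
    ultimately show ?thesis using y(1) by (intro bexI[of _ "{t \<in> spc P \<alpha>. \<forall>d\<in>D. t d = y j d}"]) auto
  qed
  then obtain E where E: "\<And>j. E j \<in> clopens X" "\<And>j. y j \<in> E j" "\<And>i j. i \<noteq> j \<Longrightarrow> y i \<notin> E j" by metis
  define U where "U j = E j - (\<Union>i<j. E i)" for j
  have un: "(\<Union>i<j. E i) \<in> clopens X" for j :: nat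
    by (induction j) (auto simp: lessThan_Suc clopens_empty intro: clopens_Un E(1))
  have "U j \<in> clopens X" for j unfolding U_def using E(1) un by (rule clopens_diff)
  moreover have "y j \<in> U j" for j unfolding U_def using E(2)[of j] E(3)[of j] by auto
  moreover have lt: "U i \<inter> U j = {}" if "i < j" for i j using that by (auto simp: U_def)
  have "disjoint_family U"
    unfolding disjoint_family_on_def
  proof (intro ballI impI)
    fix i j :: nat assume "i \<noteq> j"
    then show "U i \<inter> U j = {}" using lt[of i j] lt[of j i] by (cases "i < j") auto
  qed
  ultimately show ?thesis by blast
qed

text \<open>Prescribing \<open>EU\<close> at the index \<open>\<alpha>\<close> matters because the
  schedule at \<open>\<alpha>\<close> will select it. Admissibility is written with
  \<open>U n\<close> in place of V_n, since the extended realisation does not exist yet.\<close>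

lemma ex_enumerations:
  assumes U: "U \<in> clopen_sequences P \<alpha>" and z: "\<And>n. z n \<in> U n"
  shows "\<exists>EU :: omega1 \<Rightarrow> nat \<Rightarrow> point set. range EU = clopen_sequences P \<alpha> \<and> EU \<alpha> = U"
    and "\<exists>EM :: omega1 \<Rightarrow> nat \<Rightarrow> point set \<Rightarrow> real. range EM = {\<nu>. \<forall>n. \<nu> n \<in> radon_measures X \<and> tv_norm X (\<nu> n) = 1 \<and>
        variation X (\<nu> n) (U n) = 1 \<and> tv_norm X (pos_part X (\<nu> n)) \<ge> 1/2} \<and>
      (\<forall>\<delta>\<le>\<alpha>. EM \<delta> = (\<lambda>n. dirac X (z n)))"
proof -
  interpret X: boolean_space X by (rule boolean_X)
  have Uc: "U n \<in> clopens X" for n using U by (auto simp: clopen_sequences_def clopens_def)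
  then have zX: "z n \<in> topspace X" for n using z clopens_subset by blast
  obtain code :: "(nat \<Rightarrow> point set) \<Rightarrow> nat set" where "inj_on code {u. \<forall>n. u n \<in> clopens X}"
    using ex_code_clopen_sequences[OF X.countable_clopens] by blast
  then have "inj_on code (clopen_sequences P \<alpha>)"
    by (rule inj_on_subset) (auto simp: clopen_sequences_def clopens_def)
  from diamond_enumeration[OF diamond this U, of \<alpha>]
  show "\<exists>EU :: omega1 \<Rightarrow> nat \<Rightarrow> point set. range EU = clopen_sequences P \<alpha> \<and> EU \<alpha> = U" by auto
  let ?M = "{\<nu>. \<forall>n. \<nu> n \<in> radon_measures X \<and> tv_norm X (\<nu> n) = 1 \<and>
        variation X (\<nu> n) (U n) = 1 \<and> tv_norm X (pos_part X (\<nu> n)) \<ge> 1/2}"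
  obtain code' :: "(nat \<Rightarrow> point set \<Rightarrow> real) \<Rightarrow> nat set" where "inj_on code' {\<nu>. \<forall>n. signed_measure X (\<nu> n)}"
    using X.ex_code_measures by blast
  then have inj': "inj_on code' ?M" by (rule inj_on_subset) (auto simp: X.radon_iff)
  have "(\<lambda>n. dirac X (z n)) \<in> ?M"
    using zX z clopens_borel[OF Uc]
    by (auto simp: X.radon_iff signed_measure_dirac tv_norm_dirac variation_dirac pos_part_dirac dirac_eq)
  from diamond_enumeration[OF diamond inj' this, of \<alpha>]
  show "\<exists>EM :: omega1 \<Rightarrow> nat \<Rightarrow> point set \<Rightarrow> real. range EM = ?M \<and> (\<forall>\<delta>\<le>\<alpha>. EM \<delta> = (\<lambda>n. dirac X (z n)))" .
qed

lemma ex_split: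
  "\<exists>P' p W x. partial_realisation (osucc \<alpha>) P' \<and> agree_upto \<alpha> P P' \<and>
    p \<in> spc P \<alpha> - W \<and> lower P' \<alpha> = spc P \<alpha> - W \<and> upper P' \<alpha> = insert p W \<and>
    (\<forall>j. x j \<in> F \<and> x j \<noteq> p \<and> (x j \<in> W \<longleftrightarrow> even j)) \<and>
    meas P' \<alpha> \<alpha> = (\<lambda>n. dirac X (if even n then h (x (n div 2)) else x (n div 2))) \<and>
    N0set P' \<alpha> \<alpha> = range (\<lambda>n. 4 * n) \<and> N1set P' \<alpha> \<alpha> = range (\<lambda>n. 4 * n + 2)"
proof -
  interpret X: boolean_space X by (rule boolean_X)
  obtain p where pF: "p \<in> F" and acc_p: "\<And>U. openin X U \<Longrightarrow> p \<in> U \<Longrightarrow> \<exists>t\<in>F \<inter> U. t \<noteq> p"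
    using ex_accumulation_point by blast
  have ps: "p \<in> spc P \<alpha>" using pF F_sub by blast
  define e where "e = from_nat_into {..<\<alpha>}"
  have ne: "{..<\<alpha>} \<noteq> {}" using limit_ordinal_omega \<alpha> unfolding limit_ordinal_def by (metis empty_iff lessThan_iff less_le_trans)
  have e: "range e = {..<\<alpha>}" unfolding e_def using ne countable_lessThan_omega1 by (rule range_from_nat_into)
  \<comment> \<open>Since \<open>\<alpha>\<close> is countable, fixing the first \<open>m\<close>
    coordinates of an enumeration gives a decreasing clopen neighbourhood base at
    \<open>p\<close>.\<close>
  define Cy where "Cy m = {t \<in> spc P \<alpha>. \<forall>d\<in>e ` {..<m}. t d = p d}" for m
  have Cy: "Cy m \<in> clopens X" for m
    unfolding Cy_def using e by (intro cylinder_at \<alpha>) auto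
  have pCy: "p \<in> Cy m" for m using ps by (simp add: Cy_def)
  have dec: "decseq Cy" by (rule decseq_SucI) (auto simp: Cy_def)
  have Cy_nbhd: "\<exists>m. Cy m \<subseteq> Q" if Q: "openin X Q" "p \<in> Q" for Q
  proof -
    obtain C where C: "C \<in> clopens X" "p \<in> C" "C \<subseteq> Q" using X.clopen_base[OF Q] by blast
    obtain D where D: "finite D" "D \<subseteq> {..<\<alpha>}"
      "\<forall>t\<in>spc P \<alpha>. \<forall>t'\<in>spc P \<alpha>. (\<forall>d\<in>D. t d = t' d) \<longrightarrow> (t \<in> C \<longleftrightarrow> t' \<in> C)"
      using clopen_support_at[OF \<alpha> order_refl C(1)] by blast
    obtain M where M: "finite M" "D = e ` M" using finite_subset_image[OF D(1), of e UNIV] D(2) e by auto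
    obtain m where "\<forall>i\<in>M. i < m" using M(1) finite_nat_set_iff_bounded by blast
    then have Dm: "D \<subseteq> e ` {..<m}" using M(2) by blast
    have "t \<in> C" if t: "t \<in> Cy m" for t
    proof -
      have "t \<in> spc P \<alpha>" "\<forall>d\<in>D. t d = p d" using t Dm by (auto simp: Cy_def)
      then show ?thesis using D(3) ps C(2) by blast
    qed
    then show ?thesis using C(3) by blast
  qed
  have Cy_sep: "\<exists>m. t \<notin> Cy m" if t: "t \<in> spc P \<alpha>" "t \<noteq> p" for t
  proof -
    obtain d where d: "d < \<alpha>" "t d \<noteq> p d" using spc_ext[OF t(1) ps t(2)] by blast
    then have "d \<in> range e" using e by blast
    then obtain i where "d = e i" by blast
    then have "t \<notin> Cy (Suc i)" using d(2) by (auto simp: Cy_def)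
    then show ?thesis by blast
  qed
  have acc: "\<exists>l>m. F \<inter> (Cy m - Cy l) \<noteq> {}" for m
  proof -
    obtain t where t: "t \<in> F" "t \<in> Cy m" "t \<noteq> p" using acc_p[OF clopens_openin[OF Cy] pCy] by blast
    then obtain l where l: "t \<notin> Cy l" using Cy_sep F_sub by blast
    then have "m < l" using t(2) decseqD[OF dec, of l m] by (metis not_less subsetD)
    then show ?thesis using t l by blast
  qed
  have "p \<notin> G" using pF FG by blast
  \<comment> \<open>This neighbourhood of \<open>p\<close> will contain every annulus, so
    \<open>W\<close> stays away from all \<open>h (x j)\<close> and from their limit.\<close>
  then obtain k0 where "Cy k0 \<subseteq> topspace X - G"
    using Cy_nbhd[OF openin_diff[OF openin_topspace G]] ps top_X by blast
  then have k0: "Cy k0 \<inter> G = {}" by blast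
  \<comment> \<open>Ignoring the second component of the decoded pair repeats every task infinitely
    often.\<close>
  define task where "task i = from_nat_into tasks (fst (prod_decode i))" for i
  have "tasks \<subseteq> {..<\<alpha>} \<times> {..<\<alpha>} \<times> UNIV" by (auto simp: tasks_def)
  then have ct: "countable tasks"
    by (rule countable_subset) (intro countable_SIGMA countable_lessThan_omega1 countableI_type)
  have task_inf: "infinite {i. task i = \<tau>}" if \<tau>: "\<tau> \<in> tasks" for \<tau>
  proof -
    obtain k where k: "from_nat_into tasks k = \<tau>" using from_nat_into_surj[OF ct \<tau>] by blast
    have "infinite (range (\<lambda>m. prod_encode (k, m)))"
      by (intro range_inj_infinite) (auto simp: inj_def prod_encode_eq)
    moreover have "range (\<lambda>m. prod_encode (k, m)) \<subseteq> {i. task i = \<tau>}" using k by (auto simp: task_def)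
    ultimately show ?thesis by (rule infinite_super[rotated])
  qed
  define good where "good i A n \<longleftrightarrow> (\<forall>\<theta> \<delta> e. task i = (\<theta>, \<delta>, e) \<longrightarrow> task i \<in> tasks \<longrightarrow> approximates i p \<theta> \<delta> e A n)"
    for i A n
  \<comment> \<open>With no old pairs, as for \<open>\<alpha> = omega\<close>, \<open>task i\<close>
    is a junk value; the empty set then makes the requirement void.\<close>
  define V where "V i n = (if task i \<in> tasks then Vset P n (fst (task i)) \<alpha> else {})" for i n
  have ex_good: "\<exists>n. good i A n \<and> (\<exists>a. Cy a \<inter> V i n = {})" if A: "A \<in> clopens X" for i A
  proof (cases "task i \<in> tasks")
    case False
    then have "good i A 0" "Cy 0 \<inter> V i 0 = {}" by (auto simp: good_def V_def)
    then show ?thesis by blast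
  next
    case True
    obtain \<theta> \<delta> b where ti: "task i = (\<theta>, \<delta>, b)" by (metis prod_cases3)
    then have \<theta>: "omega \<le> \<theta>" "\<theta> < \<alpha>" using True by (auto simp: tasks_def)
    obtain n where n: "approximates i p \<theta> \<delta> b A n" using ex_approximates[OF True[unfolded ti] A] by blast
    have "Vset P n \<theta> \<alpha> \<in> clopens X"
      by (rule stage.Vset_clopen[OF stage_old[OF \<theta>] less_imp_le[OF \<theta>(2)] order_refl])
    then have "openin X (topspace X - Vset P n \<theta> \<alpha>)" by (simp add: clopens_def openin_diff)
    moreover have "p \<in> topspace X - Vset P n \<theta> \<alpha>" using n ps top_X by (simp add: approximates_def)
    ultimately obtain a where "Cy a \<subseteq> topspace X - Vset P n \<theta> \<alpha>" using Cy_nbhd by blast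
    then have "Cy a \<inter> V i n = {}" by (auto simp: V_def ti)
    then show ?thesis using n ti by (auto simp: good_def)
  qed
  have "A \<union> (Cy a - Cy b) \<in> clopens X" if "A \<in> clopens X" for A a b
    using that Cy by (intro clopens_Un clopens_diff) auto
  from sparse_sequences[where C = Cy and good = good and V = V and ?k0.0 = k0, OF dec ex_good clopens_empty this acc]
  obtain a b n where ab: "\<And>i. a i < b i" "\<And>i. b i < a (Suc i)" "\<And>i. k0 \<le> a i"
    and xa: "\<And>i. F \<inter> (Cy (a i) - Cy (b i)) \<noteq> {}" and xb: "\<And>i. F \<inter> (Cy (b i) - Cy (a (Suc i))) \<noteq> {}"
    and gd: "\<And>i. good i (\<Union>j<i. Cy (a j) - Cy (b j)) (n i)" and cv: "\<And>i. Cy (a i) \<inter> V i (n i) = {}"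
    by blast
  define A where "A i = (\<Union>j<i. Cy (a j) - Cy (b j))" for i
  define W where "W = (\<Union>i. A i)"
  have Wx: "t \<in> W \<longleftrightarrow> (\<exists>j. t \<in> Cy (a j) - Cy (b j))" for t
    unfolding W_def A_def by blast
  have amono: "strict_mono a" using ab(1,2) order.strict_trans by (intro strict_monoI_Suc) blast
  have a_ge: "i \<le> a i" for i by (rule strict_mono_imp_increasing[OF amono])
  have Ac: "A i \<in> clopens X" for i
    unfolding A_def by (induction i) (auto simp: lessThan_Suc clopens_empty intro!: clopens_Un clopens_diff Cy)
  have Ainc: "incseq A" unfolding A_def by (intro monoI UN_mono) auto
  have pW: "p \<notin> W" using Wx pCy by blast
  have closed_lower: "closedin X (spc P \<alpha> - W)"
    unfolding W_def top_X[symmetric] using Ac clopens_openin by (intro closedin_diff) auto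
  \<comment> \<open>Closedness is read off from an intersection of clopen sets: an annulus with
    number at least \<open>m\<close> lies in \<open>Cy m\<close>, since \<open>m \<le> a m\<close>,
    and the earlier ones make up \<open>A m\<close>.\<close>
  have "insert p W = (\<Inter>m. Cy m \<union> A m)"
  proof (intro equalityI subsetI)
    fix t assume t: "t \<in> insert p W"
    show "t \<in> (\<Inter>m. Cy m \<union> A m)"
    proof
      fix m
      show "t \<in> Cy m \<union> A m"
      proof (cases "t = p")
        case True
        then show ?thesis using pCy by blast
      next
        case False
        then obtain j where j: "t \<in> Cy (a j) - Cy (b j)" using t Wx by blast
        show ?thesis
        proof (cases "j < m")
          case True
          then show ?thesis using j by (auto simp: A_def)
        next
          case False
          then have "m \<le> a j" using a_ge[of j] by simp
          then show ?thesis using j decseqD[OF dec] by blast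
        qed
      qed
    qed
  next
    fix t assume t: "t \<in> (\<Inter>m. Cy m \<union> A m)"
    show "t \<in> insert p W"
    proof (cases "t = p")
      case False
      have "t \<in> Cy 0 \<union> A 0" using t by blast
      then have "t \<in> spc P \<alpha>" by (auto simp: A_def Cy_def)
      then obtain m where "t \<notin> Cy m" using Cy_sep False by blast
      then have "t \<in> A m" using t by blast
      then show ?thesis by (auto simp: W_def)
    qed simp
  qed
  moreover have "closedin X (\<Inter>m. Cy m \<union> A m)"
    using clopens_closedin[OF clopens_Un[OF Cy Ac]] by (intro closedin_INT) auto
  ultimately have closed_upper: "closedin X (insert p W)" by simp
  have AV: "W \<inter> V i (n i) = A i \<inter> V i (n i)" for i
  proof -
    have "t \<in> A i" if t: "t \<in> W" "t \<in> V i (n i)" for t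
    proof -
      obtain j where j: "t \<in> Cy (a j) - Cy (b j)" using t(1) Wx by blast
      have "\<not> i \<le> j"
      proof
        assume "i \<le> j"
        then have "a i \<le> a j" using amono by (simp add: strict_mono_less_eq)
        then have "t \<in> Cy (a i)" using j decseqD[OF dec] by blast
        then show False using cv t(2) by blast
      qed
      then show ?thesis using j by (auto simp: A_def)
    qed
    then show ?thesis by (auto simp: W_def)
  qed
  \<comment> \<open>Interleaving \<open>a\<close> and \<open>b\<close> turns the annuli of
    \<open>W\<close> and the gaps between them into one sequence: \<open>Ann j\<close> is part of
    \<open>W\<close> for even \<open>j\<close> and a gap for odd \<open>j\<close>.\<close>
  define \<kappa> where "\<kappa> j = (if even j then a (j div 2) else b (j div 2))" for j
  have \<kappa>_Suc: "\<kappa> j < \<kappa> (Suc j)" for j using ab by (auto simp: \<kappa>_def elim!: evenE oddE)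
  then have \<kappa>: "strict_mono \<kappa>" by (simp add: strict_mono_Suc_iff)
  have \<kappa>_ge: "j \<le> \<kappa> j" for j by (rule strict_mono_imp_increasing[OF \<kappa>])
  have \<kappa>0: "k0 \<le> \<kappa> j" for j
  proof -
    have "\<kappa> 0 \<le> \<kappa> j" using \<kappa> by (simp add: strict_mono_less_eq)
    then show ?thesis using ab(3)[of 0] by (simp add: \<kappa>_def)
  qed
  define Ann where "Ann j = Cy (\<kappa> j) - Cy (\<kappa> (Suc j))" for j
  have Ann_dj: "Ann i \<inter> Ann j = {}" if "i < j" for i j
  proof -
    have "\<kappa> (Suc i) \<le> \<kappa> j" using \<kappa> that by (simp add: strict_mono_less_eq)
    then show ?thesis using decseqD[OF dec] by (auto simp: Ann_def)
  qed
  have WAnn: "t \<in> W \<longleftrightarrow> (\<exists>j. t \<in> Ann (2 * j))" for t unfolding Wx by (simp add: Ann_def \<kappa>_def)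
  have "\<exists>t. t \<in> F \<inter> Ann j" for j
  proof (cases "even j")
    case True
    then obtain i where "j = 2 * i" by (rule evenE)
    then show ?thesis using xa[of i] by (auto simp: Ann_def \<kappa>_def)
  next
    case False
    then obtain i where "j = 2 * i + 1" by (rule oddE)
    then show ?thesis using xb[of i] by (auto simp: Ann_def \<kappa>_def)
  qed
  then obtain x where x: "\<And>j. x j \<in> F" "\<And>j. x j \<in> Ann j" by (metis IntD1 IntD2)
  have x_uniq: "x j \<in> Ann i \<Longrightarrow> i = j" for i j
    using x(2)[of j] Ann_dj[of i j] Ann_dj[of j i] by (metis disjoint_iff linorder_neqE_nat)
  have xW: "x j \<in> W \<longleftrightarrow> even j" for j
    unfolding WAnn using x_uniq x(2) by (metis dvd_triv_left evenE)
  have xp: "x j \<noteq> p" for j using x(2)[of j] pCy by (auto simp: Ann_def)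
  have x_inj: "inj x" using x_uniq x(2) by (metis injI)
  define y where "y j = h (x j)" for j
  define q where "q = h p"
  have yG: "y j \<in> G" and qG: "q \<in> G" for j using h_maps x(1) pF by (auto simp: y_def q_def)
  have ylim: "eventually (\<lambda>j. y j d = q d) sequentially" if d: "d < \<alpha>" for d
  proof -
    \<comment> \<open>Continuity of \<open>h\<close> at \<open>p\<close> is used one coordinate at a
      time: where coordinate \<open>d\<close> of \<open>h t\<close> agrees with that of
      \<open>q\<close> is a relatively open set, so it contains the points of \<open>F\<close> in
      some \<open>Cy m\<close>.\<close>
    have c1: "continuous_map (subtopology X F) X h"
      using homeomorphic_imp_continuous_map[OF h] by (simp add: continuous_map_in_subtopology)
    have "continuous_map X (discrete_topology UNIV) (\<lambda>t. t d)"
      unfolding top_at_def using d by (intro continuous_map_from_subtopology continuous_coordinate) simp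
    from continuous_map_compose[OF c1 this]
    have "continuous_map (subtopology X F) (discrete_topology UNIV) (\<lambda>t. h t d)" by (simp add: comp_def)
    then have "openin (subtopology X F) {t \<in> topspace (subtopology X F). h t d \<in> {q d}}"
      by (rule openin_continuous_map_preimage) simp
    then obtain Q where Q: "openin X Q" "{t \<in> topspace (subtopology X F). h t d \<in> {q d}} = Q \<inter> F"
      unfolding openin_subtopology by blast
    have tF: "topspace (subtopology X F) = F" using F_sub top_X by (auto simp: topspace_subtopology)
    have "p \<in> Q" using Q(2) pF tF by (auto simp: q_def)
    then obtain m where m: "Cy m \<subseteq> Q" using Cy_nbhd[OF Q(1)] by blast
    have "y j d = q d" if "j \<ge> m" for j
    proof -
      have "x j \<in> Cy (\<kappa> j)" using x(2) by (simp add: Ann_def)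
      then have "x j \<in> Q" using m decseqD[OF dec, of m "\<kappa> j"] \<kappa>_ge[of j] that by fastforce
      then have "x j \<in> {t \<in> topspace (subtopology X F). h t d \<in> {q d}}" using Q(2) x(1) by blast
      then show ?thesis by (simp add: y_def)
    qed
    then show ?thesis by (auto simp: eventually_sequentially)
  qed
  have "inj y" using h_inj x(1) x_inj unfolding y_def inj_def by blast
  moreover have "y j \<noteq> q" for j using h_inj x(1) pF xp unfolding y_def q_def by blast
  ultimately obtain Uy0 where Uy0: "\<And>j. Uy0 j \<in> clopens X" "\<And>j. y j \<in> Uy0 j" "disjoint_family Uy0"
    using disjoint_neighbourhoods[of y q] yG qG G_sub ylim by blast
  \<comment> \<open>Removing \<open>Cy k0\<close> makes these sets disjoint from every
    \<open>Ann j\<close> and from \<open>p\<close>, and loses no \<open>y j\<close> because these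
    lie in \<open>G\<close>.\<close>
  define Uy where "Uy j = Uy0 j - Cy k0" for j
  have Uy: "Uy j \<in> clopens X" "y j \<in> Uy j" for j
    using Uy0 Cy clopens_diff k0 yG unfolding Uy_def by blast+
  \<comment> \<open>Even indices carry the points \<open>y j\<close>, along which convergence is
    needed. Odd indices carry the points \<open>x j\<close>, half of which lie in \<open>W\<close>,
    as (G) requires.\<close>
  define U where "U n = (if even n then Uy (n div 2) else Ann (n div 2))" for n
  define z where "z n = (if even n then y (n div 2) else x (n div 2))" for n
  have zU: "z n \<in> U n" for n using Uy(2) x(2) by (simp add: z_def U_def)
  have AnnCy: "Ann j \<subseteq> Cy k0" for j using decseqD[OF dec \<kappa>0[of j]] by (auto simp: Ann_def)
  have Uc: "U n \<in> clopens X" for n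
    using Uy(1) clopens_diff[OF Cy Cy] by (auto simp: U_def Ann_def)
  have Udj: "U i \<inter> U j = {}" if ij: "i \<noteq> j" for i j
  proof -
    have yy: "Uy i \<inter> Uy j = {}" if "i \<noteq> j" for i j
      using Uy0(3) that unfolding disjoint_family_on_def Uy_def by blast
    have aa: "Ann i \<inter> Ann j = {}" if "i \<noteq> j" for i j
      using Ann_dj[of i j] Ann_dj[of j i] that by (metis Int_commute linorder_neqE_nat)
    have ya: "Uy i \<inter> Ann j = {}" for i j using AnnCy unfolding Uy_def by blast
    show ?thesis
    proof (cases "even i \<longleftrightarrow> even j")
      case True
      then have "i div 2 \<noteq> j div 2" using ij by (metis bit_eq_rec)
      then show ?thesis using True yy aa by (simp add: U_def)
    next
      case False
      then show ?thesis using ya by (auto simp: U_def)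
    qed
  qed
  have U: "U \<in> clopen_sequences P \<alpha>"
    using Uc Udj zU unfolding clopen_sequences_def clopens_def disjoint_family_on_def by blast
  have pU: "p \<notin> U m" for m using pCy by (auto simp: U_def Uy_def Ann_def)
  have WCy: "W \<subseteq> Cy k0" using WAnn AnnCy by blast
  have z2: "z (2 * m) \<notin> W" for m using WCy k0 yG by (auto simp: z_def)
  have zW1: "infinite {m. z m \<in> W}"
  proof (rule infinite_super)
    show "range (\<lambda>i. 4 * i + 1) \<subseteq> {m. z m \<in> W}"
    proof safe
      fix i :: nat
      have "z (4 * i + 1) = x (2 * i)" by (simp add: z_def)
      then show "z (4 * i + 1) \<in> W" using xW by simp
    qed
    show "infinite (range (\<lambda>i::nat. 4 * i + 1))" by (intro range_inj_infinite) (simp add: inj_def)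
  qed
  have zW0: "infinite {m. z m \<notin> W}"
  proof (rule infinite_super)
    show "range (\<lambda>i. 2 * i) \<subseteq> {m. z m \<notin> W}" using z2 by auto
    show "infinite (range (\<lambda>i::nat. 2 * i))" by (intro range_inj_infinite) (simp add: inj_def)
  qed
  obtain EU where EU: "range EU = clopen_sequences P \<alpha>" "EU \<alpha> = U" using ex_enumerations(1)[OF U zU] by blast
  obtain EM where EM: "range EM = {\<nu>. \<forall>n. \<nu> n \<in> radon_measures X \<and> tv_norm X (\<nu> n) = 1 \<and>
        variation X (\<nu> n) (U n) = 1 \<and> tv_norm X (pos_part X (\<nu> n)) \<ge> 1/2}"
      "\<And>\<delta>. \<delta> \<le> \<alpha> \<Longrightarrow> EM \<delta> = (\<lambda>n. dirac X (z n))" using ex_enumerations(2)[OF U zU] by blast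
  have qW: "q \<in> spc P \<alpha> - W" using qG G_sub WCy k0 by blast
  interpret extension \<alpha> P p A W task n U z q EU EM
  proof unfold_locales
    show "p \<in> spc P \<alpha>" "p \<notin> W" by (rule ps, rule pW)
    show "closedin X (insert p W)" "closedin X (spc P \<alpha> - W)" by (rule closed_upper, rule closed_lower)
    show "incseq A" "A i \<in> clopens X" "(\<Union>i. A i) = W" for i by (rule Ainc, rule Ac, simp add: W_def)
    show "infinite {i. task i = \<tau>}" if "\<tau> \<in> tasks" for \<tau> using that by (rule task_inf)
    show "approximates i p \<theta> \<delta> e (A i) (n i)" if "task i = (\<theta>, \<delta>, e)" "task i \<in> tasks" for i \<theta> \<delta> e
      using gd[of i] that unfolding good_def A_def by blast
    show "W \<inter> Vset P (n i) \<theta> \<alpha> = A i \<inter> Vset P (n i) \<theta> \<alpha>" if "task i = (\<theta>, \<delta>, e)" "task i \<in> tasks" for i \<theta> \<delta> e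
      using AV[of i] that by (simp add: V_def)
    show "U \<in> clopen_sequences P \<alpha>" "p \<notin> U m" "z m \<in> U m" for m by (rule U, rule pU, rule zU)
    show "infinite {m. z m \<in> W}" "infinite {m. z m \<notin> W}" "z (2 * m) \<notin> W" for m by (rule zW1, rule zW0, rule z2)
    show "q \<in> spc P \<alpha> - W" by (rule qW)
    show "eventually (\<lambda>m. z (2 * m) d = q d) sequentially" if "d < \<alpha>" for d
      using ylim[OF that] by (simp add: z_def)
  qed (fact EU EM)+
  show ?thesis
    using ex_realisation ps pW x(1) xp xW unfolding z_def y_def by blast
qed

end

section \<open>Full realisations\<close>

lemma compact_cube: "compact_space (cube A)"
  unfolding cube_def by (simp add: compact_space_product_topology compact_space_discrete_topology)

lemma full_spaces: "full_realisation R \<Longrightarrow> omega \<le> \<beta> \<Longrightarrow> partial_spaces \<beta> R"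
  unfolding full_realisation_def partial_realisation_def by unfold_locales blast

lemma compact_final:
  assumes R: "full_realisation R" shows "compactin (cube UNIV) (final_space R)"
proof -
  have cl: "closedin (cube UNIV) {t \<in> topspace (cube UNIV). \<pi> \<beta> t \<in> spc R \<beta>}" if \<beta>: "omega \<le> \<beta>" for \<beta>
  proof -
    have "closedin (cube {..<\<beta>}) (spc R \<beta>)"
      by (rule compactin_imp_closedin[OF Hausdorff_cube partial_spaces.compactin_spc[OF full_spaces[OF R \<beta>] \<beta> order_refl]])
    then show ?thesis by (intro closedin_continuous_map_preimage[OF continuous_\<pi>]) auto
  qed
  have "final_space R = (\<Inter>\<beta>\<in>{omega..}. {t \<in> topspace (cube UNIV). \<pi> \<beta> t \<in> spc R \<beta>})"
    by (auto simp: final_space_def topspace_cube)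
  also have "closedin (cube UNIV) \<dots>" using cl by (intro closedin_INT) auto
  finally show ?thesis using closedin_compact_space[OF compact_cube] by blast
qed

text \<open>Lifts of the guessed points \<open>h (x j)\<close> converge along the set \<open>Jset\<close> of every later rank, whichever
  lifts are taken; so the lifts with \<open>j\<close> even and those with \<open>j\<close> odd cannot be separated by finitely many
  coordinates. The lifts of the points \<open>x j\<close> themselves are separated by the coordinate \<open>\<alpha>\<close>.\<close>

lemma no_lift:
  assumes \<alpha>: "omega \<le> \<alpha>" and R: "full_realisation R"
    and p: "p \<in> spc R \<alpha> - W" "lower R \<alpha> = spc R \<alpha> - W" "upper R \<alpha> = insert p W"
    and x: "\<And>j. x j \<in> F" "\<And>j. x j \<noteq> p" "\<And>j. x j \<in> W \<longleftrightarrow> even j"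
    and meas: "meas R \<alpha> \<alpha> = (\<lambda>n. dirac (top_at R \<alpha>) (if even n then h (x (n div 2)) else x (n div 2)))"
    and N: "N0set R \<alpha> \<alpha> = range (\<lambda>n. 4 * n)" "N1set R \<alpha> \<alpha> = range (\<lambda>n. 4 * n + 2)"
    and F': "closedin (final_top R) F'" "\<pi> \<alpha> ` F' = F"
    and H: "homeomorphic_map (subtopology (final_top R) F') (subtopology (final_top R) G') H"
    and G': "closedin (final_top R) G'"
    and comm: "\<And>t. t \<in> F' \<Longrightarrow> \<pi> \<alpha> (H t) = h (\<pi> \<alpha> t)"
  shows False
proof -
  let ?T = "final_top R"
  have fin_sub: "final_space R \<subseteq> topspace (cube UNIV)" by (simp add: topspace_cube)
  have topT: "topspace ?T = final_space R" using fin_sub by (auto simp: final_top_def topspace_subtopology)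
  have cT: "compact_space ?T" unfolding final_top_def by (rule compact_space_subtopology[OF compact_final[OF R]])
  have F'T: "F' \<subseteq> final_space R" and G'T: "G' \<subseteq> final_space R"
    using closedin_subset[OF F'(1)] closedin_subset[OF G'] topT by auto
  have tF: "topspace (subtopology ?T F') = F'" and tG: "topspace (subtopology ?T G') = G'"
    using F'T G'T topT by (auto simp: topspace_subtopology)
  have HF: "H ` F' = G'" "inj_on H F'"
    using homeomorphic_imp_surjective_map[OF H] homeomorphic_imp_injective_map[OF H] tF tG by simp_all
  have "\<forall>j. \<exists>t. t \<in> F' \<and> \<pi> \<alpha> t = x j" using x(1) F'(2) by (metis imageE)
  then obtain xh where xh: "\<And>j. xh j \<in> F'" "\<And>j. \<pi> \<alpha> (xh j) = x j" by metis
  have osucc: "omega \<le> osucc \<alpha>" "\<alpha> < osucc \<alpha>" using \<alpha> less_osucc[of \<alpha>] by auto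
  interpret sp: split_space \<alpha> R p
    by (intro split_space.intro split_space_axioms.intro full_spaces[OF R osucc(1)] \<alpha>) (use p in auto)
  have bit: "xh j \<alpha> \<longleftrightarrow> even j" for j
  proof -
    have t: "\<pi> (osucc \<alpha>) (xh j) \<in> spc R (osucc \<alpha>)" using xh(1) F'T osucc(1) by (auto simp: final_space_def)
    have "\<pi> (osucc \<alpha>) (xh j) \<alpha> = xh j \<alpha>" by (rule \<pi>_apply[OF osucc(2)])
    moreover have "\<pi> \<alpha> (\<pi> (osucc \<alpha>) (xh j)) = x j" using \<pi>_\<pi>[of \<alpha> "osucc \<alpha>"] osucc(2) xh(2) by simp
    ultimately show ?thesis using sp.succ_upper[OF t] sp.succ_lower[OF t] p(2,3) x(2,3)[of j] by auto
  qed
  define E where "E b = {t \<in> F'. t \<alpha> = b}" for b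
  have cE: "compactin (cube UNIV) (H ` E b)" for b
  proof -
    have "{t \<in> final_space R. t \<alpha> = b} \<in> clopens ?T"
      unfolding final_top_def using fin_sub by (intro coordinate_clopen[of _ _ _ "\<lambda>c. c = b"]) auto
    then have "closedin ?T (F' \<inter> {t \<in> final_space R. t \<alpha> = b})" by (intro closedin_Int[OF F'(1) clopens_closedin])
    moreover have "F' \<inter> {t \<in> final_space R. t \<alpha> = b} = E b" using F'T by (auto simp: E_def)
    ultimately have "compactin ?T (E b)" using closedin_compact_space[OF cT] by simp
    then have "compactin (subtopology ?T F') (E b)" by (auto simp: compactin_subtopology E_def)
    moreover have "continuous_map (subtopology ?T F') ?T H"
      using homeomorphic_imp_continuous_map[OF H] by (simp add: continuous_map_in_subtopology)
    ultimately have "compactin ?T (H ` E b)" by (rule image_compactin)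
    then show ?thesis by (simp add: final_top_def compactin_subtopology)
  qed
  \<comment> \<open>Injectivity of \<open>H\<close> sends the two compact halves of
    \<open>F'\<close>, cut by coordinate \<open>\<alpha>\<close>, to disjoint compact sets, which
    finitely many coordinates \<open>D\<close> then tell apart.\<close>
  have "H ` E True \<inter> H ` E False = {}"
    using HF(2) by (auto simp: E_def dest: inj_onD)
  from compact_cube_separation[OF cE cE this]
  obtain D where D: "finite D" "\<forall>t\<in>H ` E True. \<forall>t'\<in>H ` E False. \<exists>d\<in>D. t d \<noteq> t' d"
    by (elim exE conjE) (rule that)
  \<comment> \<open>A countable rank that sees all of \<open>D\<close> and lies above
    \<open>\<alpha>\<close>, where (C) and (F) can be used. Inserting \<open>osucc \<alpha>\<close>
    also keeps the maximum defined for empty \<open>D\<close>.\<close>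
  define \<beta> where "\<beta> = osucc (Max (insert (osucc \<alpha>) D))"
  have \<beta>': "\<alpha> < \<beta>" "\<And>d. d \<in> D \<Longrightarrow> d < \<beta>"
  proof -
    have "d \<le> Max (insert (osucc \<alpha>) D)" if "d \<in> insert (osucc \<alpha>) D" for d using that D(1) by (intro Max_ge) auto
    then have "d < \<beta>" if "d \<in> insert (osucc \<alpha>) D" for d using that unfolding \<beta>_def less_osucc_iff by blast
    then show "\<alpha> < \<beta>" "\<And>d. d \<in> D \<Longrightarrow> d < \<beta>" using osucc(2) by (auto intro: less_trans)
  qed
  have \<beta>: "omega \<le> \<beta>" "\<alpha> \<le> \<beta>" using \<beta>'(1) \<alpha> by auto
  interpret B: partial_spaces \<beta> R by (rule full_spaces[OF R \<beta>(1)])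
  interpret X: boolean_space "top_at R \<beta>" by (rule B.boolean_at[OF \<beta>(1) order_refl])
  have pr: "partial_realisation \<beta> R" using R \<beta>(1) by (simp add: full_realisation_def)
  \<comment> \<open>A lift of the whole sequence, since (F) speaks about complete sequences. At even
    indices it is the image under \<open>H\<close>, which lies over \<open>h (x j)\<close> by the
    commutation with \<open>h\<close>; at odd indices any lift of \<open>x j\<close> will
    do.\<close>
  define zh where "zh n = (if even n then H (xh (n div 2)) else xh (n div 2))" for n
  have zh: "zh n \<in> final_space R" for n using xh(1) HF(1) F'T G'T by (auto simp: zh_def)
  have z\<alpha>: "\<pi> \<alpha> (zh n) = (if even n then h (x (n div 2)) else x (n div 2))" for n
    using comm[OF xh(1)] xh(2) by (simp add: zh_def)
  define \<mu> where "\<mu> n = dirac (top_at R \<beta>) (\<pi> \<beta> (zh n))" for n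
  have z\<beta>: "\<pi> \<beta> (zh n) \<in> spc R \<beta>" for n using zh \<beta>(1) by (simp add: final_space_def)
  then have z\<beta>': "\<pi> \<beta> (zh n) \<in> topspace (top_at R \<beta>)" for n using B.topspace_at[OF \<beta>(1) order_refl] by simp
  have sm: "signed_measure (top_at R \<beta>) (\<mu> n)" for n unfolding \<mu>_def by (rule signed_measure_dirac)
  have "\<mu> n \<in> Bset R n \<alpha> \<alpha> \<beta>" for n
    unfolding Bset_def
  proof (intro CollectI conjI)
    show "\<mu> n \<in> radon_measures (top_at R \<beta>)" using X.signed_measure_radon[OF sm] .
    show "tv_norm (top_at R \<beta>) (\<mu> n) = 1" unfolding \<mu>_def by (rule tv_norm_dirac[OF z\<beta>'])
    have "push_forward (top_at R \<beta>) (top_at R \<alpha>) (\<pi> \<alpha>) (\<mu> n) = dirac (top_at R \<alpha>) (\<pi> \<alpha> (\<pi> \<beta> (zh n)))"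
      unfolding \<mu>_def by (rule push_forward_dirac[OF B.continuous_\<pi>_at[OF \<alpha> \<beta>(2) order_refl] z\<beta>'])
    then show "push_forward (top_at R \<beta>) (top_at R \<alpha>) (\<pi> \<alpha>) (\<mu> n) = meas R \<alpha> \<alpha> n"
      by (simp add: \<pi>_\<pi>[OF \<beta>(2)] z\<alpha> meas)
  qed
  then obtain \<mu>' where \<mu>': "\<mu>' \<in> radon_measures (top_at R \<beta>)"
      "weak_star_limit (top_at R \<beta>) \<mu> \<mu>' (along (Jset R \<alpha> \<alpha> \<beta>))"
    using pr \<alpha> \<beta>'(1) unfolding partial_realisation_def condF_def by blast
  let ?C = "\<lambda>d. {t \<in> spc R \<beta>. t d}"
  \<comment> \<open>The values of the Dirac measures on \<open>?C d\<close> are 0 or 1. Two of them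
    closer than 1/2 to a common limit coincide, so all late lifts with index in J have the same
    coordinates in \<open>D\<close>.\<close>
  have "eventually (\<lambda>n. dist (\<mu> n (?C d)) (\<mu>' (?C d)) < 1/2) (along (Jset R \<alpha> \<alpha> \<beta>))" if "d \<in> D" for d
  proof -
    have "?C d \<in> clopens (top_at R \<beta>)"
      unfolding top_at_def using B.spc_subset[OF \<beta>(1) order_refl] \<beta>'(2)[OF that]
      by (intro coordinate_clopen[of _ _ _ "\<lambda>c. c"]) auto
    then show ?thesis
      by (intro tendstoD X.weak_star_limit_clopen[OF \<mu>'(2) sm radon_imp_signed[OF \<mu>'(1)]]) auto
  qed
  then have "eventually (\<lambda>n. \<forall>d\<in>D. dist (\<mu> n (?C d)) (\<mu>' (?C d)) < 1/2) (along (Jset R \<alpha> \<alpha> \<beta>))"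
    using D(1) by (simp add: eventually_ball_finite)
  then obtain m where m: "\<And>n d. n \<ge> m \<Longrightarrow> n \<in> Jset R \<alpha> \<alpha> \<beta> \<Longrightarrow> d \<in> D \<Longrightarrow> dist (\<mu> n (?C d)) (\<mu>' (?C d)) < 1/2"
    unfolding eventually_along by blast
  have val: "\<mu> n (?C d) = (if zh n d then 1 else 0)" if "d \<in> D" for n d
  proof -
    have "?C d \<in> borel_sets (top_at R \<beta>)"
      unfolding top_at_def using B.spc_subset[OF \<beta>(1) order_refl] \<beta>'(2)[OF that]
      by (intro clopens_borel coordinate_clopen[of _ _ _ "\<lambda>c. c"]) auto
    moreover have "\<pi> \<beta> (zh n) d = zh n d" by (rule \<pi>_apply[OF \<beta>'(2)[OF that]])
    ultimately show ?thesis using z\<beta>[of n] by (simp add: \<mu>_def dirac_eq)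
  qed
  have agree: "zh n d = zh n' d" if n: "n \<ge> m" "n \<in> Jset R \<alpha> \<alpha> \<beta>" "n' \<ge> m" "n' \<in> Jset R \<alpha> \<alpha> \<beta>" and d: "d \<in> D" for n n' d
    using m[OF n(1,2) d] m[OF n(3,4) d] val[OF d, of n] val[OF d, of n']
    by (cases "zh n d"; cases "zh n' d") (auto simp: dist_real_def)
  have "infinite (Jset R \<alpha> \<alpha> \<beta> \<inter> N0set R \<alpha> \<alpha>)" "infinite (Jset R \<alpha> \<alpha> \<beta> \<inter> N1set R \<alpha> \<alpha>)"
    using pr \<alpha> \<beta>'(1) unfolding partial_realisation_def condC_def by blast+
  then obtain n n' where n: "n \<ge> m" "n \<in> Jset R \<alpha> \<alpha> \<beta>" "n \<in> N0set R \<alpha> \<alpha>"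
    and n': "n' \<ge> m" "n' \<in> Jset R \<alpha> \<alpha> \<beta>" "n' \<in> N1set R \<alpha> \<alpha>"
    unfolding infinite_nat_iff_unbounded_le by blast
  obtain i where i: "n = 4 * i" using n(3) N(1) by auto
  obtain j where j: "n' = 4 * j + 2" using n'(3) N(2) by auto
  have "zh n = H (xh (2 * i))" using i by (simp add: zh_def)
  moreover have "n' div 2 = 2 * j + 1" "even n'" using j by auto
  then have "zh n' = H (xh (2 * j + 1))" by (simp add: zh_def)
  moreover have "xh (2 * i) \<in> E True" "xh (2 * j + 1) \<in> E False" using xh(1) bit by (auto simp: E_def)
  ultimately obtain d where "d \<in> D" "zh n d \<noteq> zh n' d" using D(2) by (metis imageI)
  then show False using agree[OF n(1,2) n'(1,2)] by blast
qed

theorem theorem4: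
  fixes S :: "omega1 set" and \<alpha> :: omega1 and P :: realisation
    and F G :: "point set" and h :: "point \<Rightarrow> point"
  assumes "stationary S" and "stationary (UNIV - S)" and "diamond S"
    and "omega \<le> \<alpha>"
    and "partial_realisation \<alpha> P"
    and "closedin (top_at P \<alpha>) F" and "closedin (top_at P \<alpha>) G"
    and "F \<inter> G = {}" and "infinite F" and "infinite G"
    and "homeomorphic_map (subtopology (top_at P \<alpha>) F) (subtopology (top_at P \<alpha>) G) h"
  shows "\<exists>P'. partial_realisation (osucc \<alpha>) P' \<and> agree_upto \<alpha> P P' \<and>
    (\<forall>R. full_realisation R \<and> agree_upto (osucc \<alpha>) P' R \<longrightarrow>
      \<not> (\<exists>F' G' H. closedin (final_top R) F' \<and> closedin (final_top R) G' \<and>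
          \<pi> \<alpha> ` F' = F \<and> \<pi> \<alpha> ` G' = G \<and>
          homeomorphic_map (subtopology (final_top R) F') (subtopology (final_top R) G') H \<and>
          (\<forall>x\<in>F'. \<pi> \<alpha> (H x) = h (\<pi> \<alpha> x))))"
proof -
  interpret guess \<alpha> P S F G h
    using assms by unfold_locales auto
  obtain P' p W x where P': "partial_realisation (osucc \<alpha>) P'" "agree_upto \<alpha> P P'"
    and pW: "p \<in> spc P \<alpha> - W" "lower P' \<alpha> = spc P \<alpha> - W" "upper P' \<alpha> = insert p W"
    and x: "\<forall>j. x j \<in> F \<and> x j \<noteq> p \<and> (x j \<in> W \<longleftrightarrow> even j)"
    and meas: "meas P' \<alpha> \<alpha> = (\<lambda>n. dirac X (if even n then h (x (n div 2)) else x (n div 2)))"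
    and N: "N0set P' \<alpha> \<alpha> = range (\<lambda>n. 4 * n)" "N1set P' \<alpha> \<alpha> = range (\<lambda>n. 4 * n + 2)"
    using ex_split by (elim exE conjE) (rule that; assumption)
  have contradiction: False if R: "full_realisation R" "agree_upto (osucc \<alpha>) P' R"
    and F': "closedin (final_top R) F'" "closedin (final_top R) G'" "\<pi> \<alpha> ` F' = F"
      "homeomorphic_map (subtopology (final_top R) F') (subtopology (final_top R) G') H"
      "\<forall>x\<in>F'. \<pi> \<alpha> (H x) = h (\<pi> \<alpha> x)" for R F' G' H
  proof -
    note lt = less_osucc[of \<alpha>] assms(4)
    have "spc R \<alpha> = spc P' \<alpha>" using R(2) lt unfolding agree_upto_def by simp
    moreover have "spc P' \<alpha> = spc P \<alpha>" using P'(2) lt unfolding agree_upto_def by simp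
    ultimately have sp: "spc R \<alpha> = spc P \<alpha>" by simp
    then have top: "top_at R \<alpha> = X" by (simp add: top_at_def)
    have eqs: "lower R \<alpha> = lower P' \<alpha>" "upper R \<alpha> = upper P' \<alpha>" "meas R \<alpha> = meas P' \<alpha>"
      "N0set R \<alpha> \<alpha> = N0set P' \<alpha> \<alpha>" "N1set R \<alpha> \<alpha> = N1set P' \<alpha> \<alpha>"
      using R(2) lt unfolding agree_upto_def by auto
    show False
    proof (rule no_lift[OF assms(4) R(1) _ _ _ _ _ _ _ _ _ F'(1,3,4,2)])
      show "p \<in> spc R \<alpha> - W" "lower R \<alpha> = spc R \<alpha> - W" "upper R \<alpha> = insert p W"
        unfolding sp eqs by (rule pW)+
      show "x j \<in> F" "x j \<noteq> p" "x j \<in> W \<longleftrightarrow> even j" for j using x by blast+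
      show "meas R \<alpha> \<alpha> = (\<lambda>n. dirac (top_at R \<alpha>) (if even n then h (x (n div 2)) else x (n div 2)))"
        unfolding eqs top by (rule meas)
      show "N0set R \<alpha> \<alpha> = range (\<lambda>n. 4 * n)" "N1set R \<alpha> \<alpha> = range (\<lambda>n. 4 * n + 2)"
        unfolding eqs by (rule N)+
      show "\<pi> \<alpha> (H t) = h (\<pi> \<alpha> t)" if "t \<in> F'" for t using F'(5) that by blast
    qed
  qed
  show ?thesis
    by (intro exI[of _ P'] conjI P' allI impI notI) (elim exE conjE, (rule contradiction; assumption))
qed

end
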